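(* Let $(P_D,A(D))$ be an oriented parity functor on the diagrams of an oriented virtual knot $\mathcal K$. Let $\delta^P_D\in C_1(D,A(D)_{ext})$ and $\pi^P_D\colon\mathcal V(D)\to A(D)_{ext}$ be the 1-chain and the map defined in the context. The chain $\delta^P_D$ has the properties: (a) $\delta^P_D$ is a cycle, i.e. $\delta^P_D\in H_1(D,A(D)_{ext})$; (b) $\delta^P_D$ is invariant: for any Reidemeister move $f\colon D\to D'$ and any correspondent arcs $a\in\mathcal A(D)$, $a'\in\mathcal A(D')$ one has $A(f_{ext})(\delta^P_D(a))=\delta^P_{D'}(a')$; (c) $\delta^P_D$ is normalized: $D\cdot\delta^P_D=0$. The family of maps $\pi^P_D$ has the properties: (Q0) for any Reidemeister move $f\colon D\to D'$ and any correspondent crossings $v\in\mathcal V(D)$, $v'=f_*(v)\in\mathcal V(D')$ which do not take part in the move, $A(f_{ext})(\pi^P_D(v))=\pi^P_{D'}(v')$; (Q2) $\pi^P_D(v_1)=\pi^P_D(v_2)$ for any crossings $v_1,v_2\in\mathcal V(D)$ to which a decreasing second Reidemeister move can be applied; (Q3) if $v_1,v_2,v_3\in\mathcal V(D)$ take part in a third Reidemeister move $f\colon D\to D'$ and $v'_1,v'_2,v'_3$ are the corresponding crossings in $D'$, then for any $i,j=1,2,3$ $$A(f_{ext})\bigl(\epsilon(v_i)\pi^P_D(v_i)-\epsilon(v_j)\pi^P_D(v_j)\bigr)=\epsilon(v'_i)\pi^P_{D'}(v'_i)-\epsilon(v'_j)\pi^P_{D'}(v'_j),$$ where $\epsilon(v)$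 is the incidence index of the crossing $v$ to the triangle of the move. The map $\pi^P$ and the cycle $\delta^P$ are connected by $$\delta^P_D=\sum_{v\in\mathcal V(D)}\pi^P_D(v)\cdot D^r_v+\rho(D)\cdot D\in H_1(D,A(D)_{ext})$$ with a unique $\rho(D)\in A(D)_{ext}$.
   Context: Diagrams. A virtual knot diagram $D$ is a generic oriented closed curve in the plane whose double points are marked classical (with over/under information) or virtual. A virtual knot $\mathcal K$ is a class of diagrams modulo isotopy, classical Reidemeister moves R1, R2, R3 and detour moves (replacing a path containing only virtual crossings by another path with the same ends containing only virtual crossings). $\mathcal V(D)$ is the set of classical crossings; $\mathcal A(D)$ is the set of arcs, i.e. pieces of $D$ between consecutive classical crossings (one closed arc if there are no classical crossings). A move $f\colon D\to D'$ induces a partial bijection $f_*\colon\mathcal V(D)\to\mathcal V(D')$ between surviving crossings. Arcs $a\in\mathcal A(D)$, $a'\in\mathcal A(D')$ are correspondent under a Reidemeister move if they share a point outside the region of the move. Local picture. Draw a classical crossing $v$ with both strands directed upward: the incoming arcs are SW, SE, the outgoing ones NW, NE, and the strands run SW$\to$NE and SE$\to$NW. The oriented smoothing at $v$ splits $D$ into the left half $D^l_v$ (leaving $v$ along NW, returning along SW) and the right half $D^r_v$ (leaving along NE, returning along SE). The incidence index $\epsilon_\Delta(v)$ of $v$ to a triangle $\Delta$ with a corner at $v$ is $+1$ if $\Delta$ lies to the left or right of $v$ (between SW and NW, or between SE and NE) and $-1$ if it lies above or below $v$. Chains. For an abelian group $B$, $C_1(D,B)$ is the group of $B$-linear combinations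 of arcs, i.e. 1-chains of the graph $\tilde D$ with vertices $\mathcal V(D)$ and edges $\mathcal A(D)$ oriented along $D$; $H_1(D,B)$ is its subgroup of 1-cycles. $\tilde D$ is embedded in the closed oriented surface $AD(D)$ obtained by gluing discs to the boundary of the ribbon surface that is the (immersed) neighbourhood of $D$ (virtual crossings not being vertices). $C_1\cdot C_2$ is the intersection number in $AD(D)$, a transverse intersection counting $+1$ when (tangent of $C_1$, tangent of $C_2$) is positively oriented. Parity functor. A partial isomorphism between abelian groups $A_1$, $A_2$ is an isomorphism between subgroups of $A_1$ and $A_2$. An oriented parity functor on the diagrams of $\mathcal K$ is a family of pairs $(P_D,A(D))$, with $A(D)$ an abelian group and $P_D\colon\mathcal V(D)\to A(D)$ a map, and for every isotopy or Reidemeister move $f\colon D\to D'$ a partial isomorphism $A(f)$ between $A(D)$ and $A(D')$, such that: (P0) $P_{D'}(f_*(v))=A(f)(P_D(v))$ for corresponding crossings $v$ and $f_*(v)$; (P1) $P_D(v)=0$ if $v$ disappears in a decreasing R1; (P2) $P_D(v_1)+P_D(v_2)=0$ if $v_1,v_2$ disappear in a decreasing R2; (P3+) $\sum_{i=1}^3\epsilon_\Delta(v_i)P_D(v_i)=0$ if $v_1,v_2,v_3$ are the crossings of an R3 with disappearing triangle $\Delta$. For a sequence of moves, $A$ of the sequence is the composition of the partial isomorphisms. Extended diagram. For an arc $a$, a fold on $a$ is made as follows: take two disjoint subsegments of $a$, bring them by detour moves side by side, parallel and in the same direction, and apply an increasing R2 to them; let $v_a$ be the new crossing at which both strands enter the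 new bigon. The extended diagram $D_{ext}$ is obtained from $D$ by making a fold on every arc of $D$, and $A(D)_{ext}=A(D_{ext})$. Put $\delta^P_a=P_{D_{ext}}(v_a)$ and $\delta^P_D=\sum_{a\in\mathcal A(D)}\delta^P_a\cdot a$. For a crossing $v$ put $\pi^P_D(v)=\delta^P_{NE}-\delta^P_{SW}=\delta^P_{SE}-\delta^P_{NW}$ (values on the arcs at $v$). The partial isomorphisms $A(f_{ext})$. If $f\colon D\to D'$ is an increasing R1 or R2, then $f_{ext}\colon D_{ext}\to D'_{ext}$ is the sequence of increasing R1 and R2 moves (and detour moves) performing $f$ away from the folds of $D_{ext}$ and then making folds on those arcs of $D'$ which do not yet carry one; for a decreasing R1 or R2 one uses the inverse sequence and the inverse partial isomorphism. If $f$ is an R3, let $\bar D_{ext}$ (resp. $\bar D'_{ext}$) be the diagram obtained from $D$ (resp. $D'$) by making folds on all arcs except the three sides of the triangle of the move; $f$ induces an R3 move $\bar f_{ext}\colon\bar D_{ext}\to\bar D'_{ext}$, there are sequences of increasing R2 moves $e\colon\bar D_{ext}\to D_{ext}$, $e'\colon\bar D'_{ext}\to D'_{ext}$ making the remaining folds, and $A(f_{ext})$ denotes the partial isomorphism $A(e')\circ A(\bar f_{ext})\circ A(e)^{-1}$ from $A(D_{ext})$ to $A(D'_{ext})$. An equality $A(f_{ext})(x)=y$ includes the assertion that $x$ is in the domain. *)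

theory Defs
  imports "HOL-Algebra.FiniteProduct" "HOL-Algebra.Coset" "HOL-Combinatorics.Transposition"
begin

section \<open>Diagrams\<close>

text \<open>
  A virtual knot diagram, considered up to isotopy of the plane and detour moves, is the same thing
  as a Gauss diagram: an oriented circle with signed chords directed from the overpass to the
  underpass; every such datum is realised by a planar diagram.  We work with Gauss diagrams.
  A diagram is given by the cyclic word of the passages through its classical crossings, in the
  order in which they are met along the knot, together with the set of its positive crossings.  The
  passage \<open>(v, True)\<close> is the overpass of the crossing \<open>v\<close> and \<open>(v, False)\<close> is its underpass.
  The place where the word starts has no significance: moving it is one of the isotopies below, and all
  notions that depend on the order of the word are cyclic.
\<close>

type_synonym point = "nat \<times> bool"

datatype diagram = Diagram (word: "point list") (pos: "nat set")

definition crossings :: "diagram \<Rightarrow> nat set" where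
  "crossings D = fst ` set (word D)"

definition gauss_diagram :: "diagram \<Rightarrow> bool" where
  "gauss_diagram D \<longleftrightarrow> distinct (word D)
     \<and> (\<forall>v b. (v, b) \<in> set (word D) \<longrightarrow> (v, \<not> b) \<in> set (word D))
     \<and> pos D \<subseteq> crossings D"

definition writhe :: "diagram \<Rightarrow> nat \<Rightarrow> int" where
  "writhe D v = (if v \<in> pos D then 1 else -1)"

definition cut_at :: "point \<Rightarrow> point list \<Rightarrow> point list" where
  "cut_at p w = dropWhile (\<lambda>q. q \<noteq> p) w @ takeWhile (\<lambda>q. q \<noteq> p) w"

definition next_point :: "diagram \<Rightarrow> point \<Rightarrow> point" where
  "next_point D p = cut_at p (word D) ! 1"

definition prev_point :: "diagram \<Rightarrow> point \<Rightarrow> point" where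
  "prev_point D p = last (cut_at p (word D))"

text \<open>The points \<open>ps\<close> follow each other immediately in the cyclic word of \<open>D\<close>.\<close>

definition consecutive :: "diagram \<Rightarrow> point list \<Rightarrow> bool" where
  "consecutive D ps \<longleftrightarrow> take (length ps) (cut_at (hd ps) (word D)) = ps"

definition delete :: "nat set \<Rightarrow> diagram \<Rightarrow> diagram" where
  "delete X D = Diagram (filter (\<lambda>p. fst p \<notin> X) (word D)) (pos D - X)"

text \<open>
  The arc \<open>Some p\<close> starts at the point \<open>p\<close> and ends at the next point;
  \<open>None\<close> is the closed arc of a diagram without classical crossings.
\<close>

type_synonym arc = "point option"

definition arcs :: "diagram \<Rightarrow> arc set" where
  "arcs D = (if word D = [] then {None} else Some ` set (word D))"

text \<open>
  The local picture at \<open>v\<close> with both strands directed upward.  The strand from SW to NE is the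
  overpass if \<open>v\<close> is positive and the underpass if \<open>v\<close> is negative.
\<close>

definition NE :: "diagram \<Rightarrow> nat \<Rightarrow> arc" where
  "NE D v = Some (v, v \<in> pos D)"

definition NW :: "diagram \<Rightarrow> nat \<Rightarrow> arc" where
  "NW D v = Some (v, v \<notin> pos D)"

definition SW :: "diagram \<Rightarrow> nat \<Rightarrow> arc" where
  "SW D v = Some (prev_point D (v, v \<in> pos D))"

definition SE :: "diagram \<Rightarrow> nat \<Rightarrow> arc" where
  "SE D v = Some (prev_point D (v, v \<notin> pos D))"

section \<open>Moves\<close>

text \<open>
  A move keeps the labels of the surviving crossings, except that an isotopy may rename the
  crossings.  In terms of planar diagrams an isotopy is a composition of isotopies and detour moves.
\<close>

datatype kind =
    Isotopy "nat \<Rightarrow> nat"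
  | R1_inc nat bool | R1_dec nat bool
  | R2_inc nat nat | R2_dec nat nat
  | R3 nat nat nat

text \<open>The arc from \<open>(x, b)\<close> to \<open>(x, \<not> b)\<close> is the loop of the kink.\<close>

definition kink :: "diagram \<Rightarrow> nat \<Rightarrow> bool \<Rightarrow> bool" where
  "kink D x b \<longleftrightarrow> consecutive D [(x, b), (x, \<not> b)]"

text \<open>The upper strand of the bigon meets \<open>x\<close> first; the lower strand has either direction.\<close>

definition bigon :: "diagram \<Rightarrow> nat \<Rightarrow> nat \<Rightarrow> bool" where
  "bigon D x y \<longleftrightarrow> consecutive D [(x, True), (y, True)]
     \<and> (consecutive D [(x, False), (y, False)] \<or> consecutive D [(y, False), (x, False)])
     \<and> (x \<in> pos D \<longleftrightarrow> y \<notin> pos D)"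

text \<open>
  The three strands of a third move are ordered by height.  The top strand meets the middle one at
  \<open>u\<close> and the bottom one at \<open>v\<close>; the middle and the bottom strands meet at \<open>w\<close>.
  The map \<open>side_swap u v w\<close> interchanges the ends of each side of the triangle.
\<close>

definition side_swap :: "nat \<Rightarrow> nat \<Rightarrow> nat \<Rightarrow> point \<Rightarrow> point" where
  "side_swap u v w =
     transpose (u, True) (v, True) \<circ> transpose (u, False) (w, True) \<circ> transpose (v, False) (w, False)"

definition sides :: "diagram \<Rightarrow> nat \<Rightarrow> nat \<Rightarrow> nat \<Rightarrow> arc set" where
  "sides D u v w = {Some p | p. fst p \<in> {u, v, w} \<and> next_point D p = side_swap u v w p}"

text \<open>
  The triangle lies to the left or to the right of its corner \<open>c\<close> iff one of the two sides at \<open>c\<close>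
  leaves \<open>c\<close> and the other one arrives at \<open>c\<close>.
\<close>

definition incidence :: "diagram \<Rightarrow> nat \<Rightarrow> nat \<Rightarrow> nat \<Rightarrow> nat \<Rightarrow> int" where
  "incidence D u v w c =
     (if (Some (c, True) \<in> sides D u v w) \<noteq> (Some (c, False) \<in> sides D u v w) then 1 else -1)"

text \<open>
  The condition on the signs says that the three strands can be drawn as three oriented lines.
  Give a side the sign \<open>+\<close> if it runs counterclockwise around the triangle and \<open>-\<close> otherwise; then
  the incidence index of a corner is the product of the signs of its two sides.  If the top, middle
  and bottom sides follow each other counterclockwise, then the upper strand and the lower strand
  are met in this order at \<open>u\<close> and \<open>w\<close> and in the opposite order at \<open>v\<close>, so the writhe is
  the incidence index at \<open>u\<close> and \<open>w\<close> and minus the incidence index at \<open>v\<close>.  If they follow each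
  other clockwise, all three writhes are reversed.
\<close>

definition triangle :: "diagram \<Rightarrow> nat \<Rightarrow> nat \<Rightarrow> nat \<Rightarrow> bool" where
  "triangle D u v w \<longleftrightarrow> distinct [u, v, w] \<and> {u, v, w} \<subseteq> crossings D
     \<and> (\<forall>p. fst p \<in> {u, v, w} \<longrightarrow>
          consecutive D [p, side_swap u v w p] \<or> consecutive D [side_swap u v w p, p])
     \<and> (\<exists>\<kappa> \<in> {1, -1}. writhe D u = \<kappa> * incidence D u v w u
                    \<and> writhe D w = \<kappa> * incidence D u v w w
                    \<and> writhe D v = - \<kappa> * incidence D u v w v)"

datatype move = Move (source: diagram) (kind: kind) (target: diagram)

fun performs :: "diagram \<Rightarrow> kind \<Rightarrow> diagram \<Rightarrow> bool" where
  "performs D (Isotopy \<sigma>) D' \<longleftrightarrow> inj_on \<sigma> (crossings D)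
     \<and> (\<exists>n. word D' = rotate n (map (map_prod \<sigma> id) (word D))) \<and> pos D' = \<sigma> ` pos D"
| "performs D (R1_inc x b) D' \<longleftrightarrow> kink D' x b \<and> D = delete {x} D'"
| "performs D (R1_dec x b) D' \<longleftrightarrow> kink D x b \<and> D' = delete {x} D"
| "performs D (R2_inc x y) D' \<longleftrightarrow> bigon D' x y \<and> D = delete {x, y} D'"
| "performs D (R2_dec x y) D' \<longleftrightarrow> bigon D x y \<and> D' = delete {x, y} D"
| "performs D (R3 u v w) D' \<longleftrightarrow> triangle D u v w
     \<and> D' = Diagram (map (side_swap u v w) (word D)) (pos D)"

definition is_move :: "move \<Rightarrow> bool" where
  "is_move f \<longleftrightarrow> gauss_diagram (source f) \<and> gauss_diagram (target f)
     \<and> performs (source f) (kind f) (target f)"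

definition reidemeister :: "move \<Rightarrow> bool" where
  "reidemeister f \<longleftrightarrow> is_move f \<and> (\<forall>\<sigma>. kind f \<noteq> Isotopy \<sigma>)"

text \<open>The map \<open>f\<^sub>*\<close>; it is meaningful on the crossings that survive.\<close>

fun crossing_map :: "kind \<Rightarrow> nat \<Rightarrow> nat" where
  "crossing_map (Isotopy \<sigma>) v = \<sigma> v"
| "crossing_map _ v = v"

text \<open>The crossings that take part in a move, apart from those it creates or removes.\<close>

fun involved :: "kind \<Rightarrow> nat set" where
  "involved (R3 u v w) = {u, v, w}"
| "involved _ = {}"

definition virtual_knot :: "diagram set \<Rightarrow> bool" where
  "virtual_knot K \<longleftrightarrow> (\<exists>D. gauss_diagram D
     \<and> K = {D'. equivclp (\<lambda>D1 D2. \<exists>k. is_move (Move D1 k D2)) D D'})"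

text \<open>
  Correspondent arcs.  For an increasing first or second move \<open>inner_arcs\<close> are the arcs of the new
  diagram inside the region of the move (the loop, or the two sides of the bigon).  Every other arc
  of the new diagram is a piece of the arc of the old diagram that is found by going back to the
  last point which is not created by the move.
\<close>

fun created :: "kind \<Rightarrow> nat set" where
  "created (R1_inc x b) = {x}"
| "created (R2_inc x y) = {x, y}"
| "created _ = {}"

fun inner_arcs :: "diagram \<Rightarrow> kind \<Rightarrow> arc set" where
  "inner_arcs D' (R1_inc x b) = {Some (x, b)}"
| "inner_arcs D' (R2_inc x y) = {Some (x, True),
     if consecutive D' [(x, False), (y, False)] then Some (x, False) else Some (y, False)}"
| "inner_arcs D' _ = {}"

fun piece_of :: "diagram \<Rightarrow> nat set \<Rightarrow> arc \<Rightarrow> arc \<Rightarrow> bool" where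
  "piece_of D' X None a' \<longleftrightarrow> True"
| "piece_of D' X (Some q) a' \<longleftrightarrow>
     (\<exists>ps. consecutive D' (q # ps) \<and> fst ` set ps \<subseteq> X \<and> a' = Some (last (q # ps)))"

definition correspondent_inc :: "diagram \<Rightarrow> kind \<Rightarrow> diagram \<Rightarrow> arc \<Rightarrow> arc \<Rightarrow> bool" where
  "correspondent_inc D k D' a a' \<longleftrightarrow>
     a \<in> arcs D \<and> a' \<in> arcs D' - inner_arcs D' k \<and> piece_of D' (created k) a a'"

fun correspondent :: "move \<Rightarrow> arc \<Rightarrow> arc \<Rightarrow> bool" where
  "correspondent (Move D (R1_inc x b) D') a a' \<longleftrightarrow> correspondent_inc D (R1_inc x b) D' a a'"
| "correspondent (Move D (R2_inc x y) D') a a' \<longleftrightarrow> correspondent_inc D (R2_inc x y) D' a a'"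
| "correspondent (Move D (R1_dec x b) D') a a' \<longleftrightarrow> correspondent_inc D' (R1_inc x b) D a' a"
| "correspondent (Move D (R2_dec x y) D') a a' \<longleftrightarrow> correspondent_inc D' (R2_inc x y) D a' a"
| "correspondent (Move D (R3 u v w) D') a a' \<longleftrightarrow>
     a \<in> arcs D - sides D u v w \<and> a' = map_option (side_swap u v w) a"
| "correspondent (Move D (Isotopy \<sigma>) D') a a' \<longleftrightarrow> False"

section \<open>Chains\<close>

text \<open>Abelian groups are written multiplicatively, as objects of \<^locale>\<open>comm_group\<close>.\<close>

definition chains :: "'g monoid \<Rightarrow> diagram \<Rightarrow> (arc \<Rightarrow> 'g) set" where
  "chains B D = arcs D \<rightarrow>\<^sub>E carrier B"

definition incoming :: "diagram \<Rightarrow> nat \<Rightarrow> arc set" where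
  "incoming D v = {Some p | p. p \<in> set (word D) \<and> fst (next_point D p) = v}"

definition outgoing :: "diagram \<Rightarrow> nat \<Rightarrow> arc set" where
  "outgoing D v = {Some p | p. p \<in> set (word D) \<and> fst p = v}"

definition boundary :: "'g monoid \<Rightarrow> diagram \<Rightarrow> (arc \<Rightarrow> 'g) \<Rightarrow> nat \<Rightarrow> 'g" where
  "boundary B D c v = finprod B c (incoming D v) \<otimes>\<^bsub>B\<^esub> inv\<^bsub>B\<^esub> (finprod B c (outgoing D v))"

definition cycles :: "'g monoid \<Rightarrow> diagram \<Rightarrow> (arc \<Rightarrow> 'g) set" where
  "cycles B D = {c \<in> chains B D. \<forall>v \<in> crossings D. boundary B D c v = \<one>\<^bsub>B\<^esub>}"

definition knot_cycle :: "arc \<Rightarrow> int" where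
  "knot_cycle a = 1"

definition right_half :: "diagram \<Rightarrow> nat \<Rightarrow> arc \<Rightarrow> int" where
  "right_half D v a =
     (if a \<in> Some ` set (takeWhile (\<lambda>p. p \<noteq> (v, v \<notin> pos D)) (cut_at (v, v \<in> pos D) (word D)))
      then 1 else 0)"

text \<open>
  The intersection number of an integral cycle \<open>c\<close> and a cycle \<open>d\<close> with coefficients in \<open>B\<close> in the
  surface that contains the graph of the diagram.  Push \<open>c\<close> off the graph to its left inside the
  ribbon surface, so that at a crossing the four ends of the pushed copy are joined in the corner
  between SW and NW.  The copies of SW and NW do not meet the graph there.  The copy of NE meets NW
  with the sign \<open>+\<close> (its tangent points to the right and that of NW points upward), and the copy of
  SE meets SW with the sign \<open>-\<close> (its tangent points to the left and that of SW points upward).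
\<close>

definition intersection_number ::
    "'g monoid \<Rightarrow> diagram \<Rightarrow> (arc \<Rightarrow> int) \<Rightarrow> (arc \<Rightarrow> 'g) \<Rightarrow> 'g" where
  "intersection_number B D c d =
     (\<Otimes>\<^bsub>B\<^esub>v\<in>crossings D. d (NW D v) [^]\<^bsub>B\<^esub> c (NE D v) \<otimes>\<^bsub>B\<^esub> inv\<^bsub>B\<^esub> (d (SW D v) [^]\<^bsub>B\<^esub> c (SE D v)))"

section \<open>Parity functors\<close>

text \<open>A partial isomorphism is represented by its graph.\<close>

definition partial_iso :: "'g monoid \<Rightarrow> 'g monoid \<Rightarrow> ('g \<times> 'g) set \<Rightarrow> bool" where
  "partial_iso G H R \<longleftrightarrow> (\<exists>S T h. subgroup S G \<and> subgroup T H
     \<and> h \<in> iso (G\<lparr>carrier := S\<rparr>) (H\<lparr>carrier := T\<rparr>) \<and> R = {(g, h g) | g. g \<in> S})"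

locale oriented_parity_functor =
  fixes K :: "diagram set"
    and G :: "diagram \<Rightarrow> 'g monoid"
    and P :: "diagram \<Rightarrow> nat \<Rightarrow> 'g"
    and A :: "move \<Rightarrow> ('g \<times> 'g) set"
  assumes group: "D \<in> K \<Longrightarrow> comm_group (G D)"
    and parity_closed: "D \<in> K \<Longrightarrow> v \<in> crossings D \<Longrightarrow> P D v \<in> carrier (G D)"
    and iso: "is_move f \<Longrightarrow> source f \<in> K \<Longrightarrow> partial_iso (G (source f)) (G (target f)) (A f)"
    and P0: "is_move f \<Longrightarrow> source f \<in> K \<Longrightarrow> v \<in> crossings (source f) \<Longrightarrow>
      crossing_map (kind f) v \<in> crossings (target f) \<Longrightarrow>
      (P (source f) v, P (target f) (crossing_map (kind f) v)) \<in> A f"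
    and P1: "D \<in> K \<Longrightarrow> is_move (Move D (R1_dec x b) D') \<Longrightarrow> P D x = \<one>\<^bsub>G D\<^esub>"
    and P2: "D \<in> K \<Longrightarrow> is_move (Move D (R2_dec x y) D') \<Longrightarrow> P D x \<otimes>\<^bsub>G D\<^esub> P D y = \<one>\<^bsub>G D\<^esub>"
    and P3: "D \<in> K \<Longrightarrow> is_move (Move D (R3 u v w) D') \<Longrightarrow>
      P D u [^]\<^bsub>G D\<^esub> incidence D u v w u \<otimes>\<^bsub>G D\<^esub> P D v [^]\<^bsub>G D\<^esub> incidence D u v w v
        \<otimes>\<^bsub>G D\<^esub> P D w [^]\<^bsub>G D\<^esub> incidence D u v w w = \<one>\<^bsub>G D\<^esub>"

text \<open>The partial isomorphism of a sequence of moves that starts at the diagram \<open>D\<close>.\<close>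

fun transport :: "(diagram \<Rightarrow> 'g monoid) \<Rightarrow> (move \<Rightarrow> ('g \<times> 'g) set) \<Rightarrow> diagram \<Rightarrow> move list
    \<Rightarrow> ('g \<times> 'g) set" where
  "transport G A D [] = Id_on (carrier (G D))"
| "transport G A D (f # fs) = A f O transport G A (target f) fs"

section \<open>Extended diagrams\<close>

text \<open>
  \<open>E\<close> carries a fold on the arc \<open>a\<close> with the crossings \<open>x\<close>, \<open>y\<close>.  The word of the fold consists
  of the two parallel segments of the arc one after the other; both of them enter the bigon at \<open>x\<close>.
  Which of the two segments is the upper one (\<open>b\<close>) and which one is on the left (the sign of \<open>x\<close>)
  is left open.
\<close>

definition carries_fold :: "diagram \<Rightarrow> arc \<Rightarrow> nat \<Rightarrow> nat \<Rightarrow> bool" where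
  "carries_fold E a x y \<longleftrightarrow>
     (\<exists>b. consecutive E ((case a of None \<Rightarrow> [] | Some p \<Rightarrow> [p])
                         @ [(x, b), (y, b), (x, \<not> b), (y, \<not> b)]))
     \<and> (x \<in> pos E \<longleftrightarrow> y \<notin> pos E)"

text \<open>
  \<open>E\<close> is obtained from \<open>D\<close> by making folds on the arcs in \<open>S\<close>; the fold on \<open>a\<close> has the crossings
  \<open>x a\<close> (the crossing \<open>v\<^sub>a\<close>) and \<open>y a\<close>.
\<close>

definition folded :: "diagram \<Rightarrow> arc set \<Rightarrow> diagram \<Rightarrow> (arc \<Rightarrow> nat) \<Rightarrow> (arc \<Rightarrow> nat) \<Rightarrow> bool" where
  "folded D S E x y \<longleftrightarrow> gauss_diagram D \<and> gauss_diagram E \<and> S \<subseteq> arcs D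
     \<and> inj_on x S \<and> inj_on y S \<and> x ` S \<inter> y ` S = {}
     \<and> D = delete (x ` S \<union> y ` S) E
     \<and> (\<forall>a \<in> S. carries_fold E a (x a) (y a))"

definition extended :: "diagram \<Rightarrow> diagram \<Rightarrow> (arc \<Rightarrow> nat) \<Rightarrow> (arc \<Rightarrow> nat) \<Rightarrow> bool" where
  "extended D E x y \<longleftrightarrow> folded D (arcs D) E x y"

definition delta :: "(diagram \<Rightarrow> nat \<Rightarrow> 'g) \<Rightarrow> diagram \<Rightarrow> diagram \<Rightarrow> (arc \<Rightarrow> nat) \<Rightarrow> arc \<Rightarrow> 'g" where
  "delta P D E x = (\<lambda>a \<in> arcs D. P E (x a))"

definition quasi_index ::
    "(diagram \<Rightarrow> 'g monoid) \<Rightarrow> (diagram \<Rightarrow> nat \<Rightarrow> 'g) \<Rightarrow> diagram \<Rightarrow> diagram \<Rightarrow> (arc \<Rightarrow> nat)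
      \<Rightarrow> nat \<Rightarrow> 'g" where
  "quasi_index G P D E x v =
     delta P D E x (NE D v) \<otimes>\<^bsub>G E\<^esub> inv\<^bsub>G E\<^esub> (delta P D E x (SW D v))"

text \<open>
  \<open>fold_sequence D x y S E fs T F\<close>: the sequence \<open>fs\<close> of increasing second moves, possibly with
  detour moves in between, turns the diagram \<open>E\<close> with folds on the arcs in \<open>S\<close> into the diagram
  \<open>F\<close> with folds on the arcs in \<open>T\<close> by making the missing folds one by one.  A detour move does not
  change the Gauss diagram, but a parity functor still assigns a partial isomorphism to it.
\<close>

inductive fold_sequence :: "diagram \<Rightarrow> (arc \<Rightarrow> nat) \<Rightarrow> (arc \<Rightarrow> nat) \<Rightarrow> arc set \<Rightarrow> diagram
    \<Rightarrow> move list \<Rightarrow> arc set \<Rightarrow> diagram \<Rightarrow> bool"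
  for D x y S E where
  start: "folded D S E x y \<Longrightarrow> fold_sequence D x y S E [] S E"
| detour: "fold_sequence D x y S E fs T F \<Longrightarrow>
    fold_sequence D x y S E (fs @ [Move F (Isotopy id) F]) T F"
| fold: "fold_sequence D x y S E fs T F \<Longrightarrow> a \<in> arcs D - T \<Longrightarrow>
    folded D (insert a T) F' x y \<Longrightarrow> F = delete {x a, y a} F' \<Longrightarrow>
    fold_sequence D x y S E (fs @ [Move F (R2_inc (x a) (y a)) F']) (insert a T) F'"

text \<open>
  The sequences \<open>f\<^sub>e\<^sub>x\<^sub>t\<close> for an increasing first or second move \<open>f\<close>.  The move is performed on \<open>E\<close>,
  away from its folds, with the result \<open>F\<close>; the folds of \<open>E\<close> become folds of \<open>F\<close> on the arcs in
  a set \<open>S\<close> of arcs of the target of \<open>f\<close>; then folds are made on the remaining arcs.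
\<close>

definition extended_sequence :: "move \<Rightarrow> diagram \<Rightarrow> (arc \<Rightarrow> nat) \<Rightarrow> (arc \<Rightarrow> nat)
    \<Rightarrow> diagram \<Rightarrow> (arc \<Rightarrow> nat) \<Rightarrow> (arc \<Rightarrow> nat) \<Rightarrow> move list \<Rightarrow> bool" where
  "extended_sequence f E x y E' x' y' fs \<longleftrightarrow> extended (source f) E x y
     \<and> (\<exists>S F n es. is_move (Move E (kind f) F)
          \<and> folded (target f) S F x' y'
          \<and> (\<lambda>a. (x' a, y' a)) ` S = (\<lambda>a. (x a, y a)) ` arcs (source f)
          \<and> fold_sequence (target f) x' y' S F es (arcs (target f)) E'
          \<and> fs = replicate n (Move E (Isotopy id) E) @ Move E (kind f) F # es)"

text \<open>
  \<open>extended_iso G A f E x y E' x' y' R\<close>: \<open>R\<close> is the partial isomorphism \<open>A(f\<^sub>e\<^sub>x\<^sub>t)\<close> from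
  \<open>A(D\<^sub>e\<^sub>x\<^sub>t)\<close> to \<open>A(D'\<^sub>e\<^sub>x\<^sub>t)\<close>, for some admissible choice of the sequence of moves \<open>f\<^sub>e\<^sub>x\<^sub>t\<close>.
\<close>

inductive extended_iso :: "(diagram \<Rightarrow> 'g monoid) \<Rightarrow> (move \<Rightarrow> ('g \<times> 'g) set) \<Rightarrow> move
    \<Rightarrow> diagram \<Rightarrow> (arc \<Rightarrow> nat) \<Rightarrow> (arc \<Rightarrow> nat)
    \<Rightarrow> diagram \<Rightarrow> (arc \<Rightarrow> nat) \<Rightarrow> (arc \<Rightarrow> nat) \<Rightarrow> ('g \<times> 'g) set \<Rightarrow> bool"
  for G A where
  R1_inc: "extended_sequence (Move D (R1_inc c b) D') E x y E' x' y' fs \<Longrightarrow>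
    extended_iso G A (Move D (R1_inc c b) D') E x y E' x' y' (transport G A E fs)"
| R2_inc: "extended_sequence (Move D (R2_inc c d) D') E x y E' x' y' fs \<Longrightarrow>
    extended_iso G A (Move D (R2_inc c d) D') E x y E' x' y' (transport G A E fs)"
| R1_dec: "extended_sequence (Move D' (R1_inc c b) D) E' x' y' E x y fs \<Longrightarrow>
    extended_iso G A (Move D (R1_dec c b) D') E x y E' x' y' ((transport G A E' fs)\<inverse>)"
| R2_dec: "extended_sequence (Move D' (R2_inc c d) D) E' x' y' E x y fs \<Longrightarrow>
    extended_iso G A (Move D (R2_dec c d) D') E x y E' x' y' ((transport G A E' fs)\<inverse>)"
| R3: "fold_sequence D x y (arcs D - sides D u v w) F e (arcs D) E \<Longrightarrow>
    fold_sequence D' x' y' (arcs D' - sides D' u v w) F' e' (arcs D') E' \<Longrightarrow>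
    is_move (Move F (R3 u v w) F') \<Longrightarrow>
    (\<And>a. a \<in> arcs D - sides D u v w \<Longrightarrow>
       x' (map_option (side_swap u v w) a) = x a \<and> y' (map_option (side_swap u v w) a) = y a) \<Longrightarrow>
    extended_iso G A (Move D (R3 u v w) D') E x y E' x' y'
      ((transport G A F e)\<inverse> O A (Move F (R3 u v w) F') O transport G A F' e')"

end

theory Submission
  imports Defs "HOL-Library.Function_Algebras" "HOL-Library.Sublist"
begin

text \<open>
  The theorem compares parities of crossings of different folds, and the axioms relate only crossings
  of one move.  The bridge is a finger.  Fix a base point \<open>z\<close> of a diagram \<open>E\<close>, and from \<open>z\<close> push
  a finger over the diagram until it crosses the knot in a gap \<open>u\<close> between two points of the word.
  This is a second move.  It makes a negative and a positive crossing, together a probe; the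
  parity of the negative one is denoted \<open>\<gamma>(u)\<close> if the two strands of the probe are parallel and
  \<open>\<alpha>(u)\<close> if they are antiparallel.  All fingers can be made at once, and each of them can be
  removed again.  Since the partial isomorphisms of the moves are injective, a relation between parities of
  surviving crossings may be checked after any first and second moves that remove other crossings.

  Two probes of one type in adjacent gaps have equal parities, because the positive crossing of one and
  the negative crossing of the other bound a bigon (\<open>adjacent_probes\<close>).  Pushing the finger across a
  crossing \<open>v\<close> is a third move after a second one; with (P3+) it expresses the parity of \<open>v\<close> as a
  difference of potentials (\<open>slide\<close>, \<open>crossing_relation\<close>):
  \<open>P(v) = \<alpha>(SW) - \<alpha>(NW) = \<alpha>(NE) - \<gamma>(NW) = \<gamma>(SW) - \<alpha>(SE) = \<gamma>(NE) - \<gamma>(SE)\<close>.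
  For \<open>\<epsilon> = \<gamma> - \<alpha>\<close> this gives \<open>\<epsilon>(NE) + \<epsilon>(NW) = \<epsilon>(SW) + \<epsilon>(SE)\<close>, and \<open>\<alpha>\<close> changes by
  \<open>\<epsilon>(NW)\<close> from SW to NE and by \<open>-\<epsilon>(SW)\<close> from SE to NW.

  A fold on an arc does not change the potentials from one side to the other, as it can be removed.
  Hence the relations at its first crossing \<open>v\<^sub>a\<close> say that \<open>P(v\<^sub>a) = \<epsilon>(a)\<close> (\<open>fold_parity\<close>): the chain
  \<open>\<delta>\<close> is \<open>\<epsilon>\<close>.  In particular two folds that follow each other have the same parity
  (\<open>adjacent_folds\<close>), whatever their over- and underpasses and signs are.

  The conservation law for \<open>\<epsilon>\<close> is the cycle condition.  The sum of the jumps of \<open>\<alpha>\<close> along the whole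
  knot is the sum of all \<open>\<epsilon>(NW) - \<epsilon>(SW)\<close>, which is \<open>D \<cdot> \<delta>\<close>; it vanishes because \<open>\<alpha>\<close> is \<open>0\<close> on both
  sides of the base point, where the finger is a kink (\<open>fold_cycle\<close>, \<open>fold_normal\<close>).

  A move carries the fold on an arc to a fold on a corresponding arc, and (P0) carries its parity.  Two
  arcs of the new diagram that correspond to the same old arc differ by crossings that the move
  creates; deleting these makes their folds adjacent, so the parities agree (\<open>corresponding_folds\<close>).
  This is the invariance of \<open>\<delta>\<close> (\<open>extended_iso_parity\<close>).

  The rest is algebra.  By the cycle condition \<open>\<delta>\<close> grows by \<open>\<pi>(v)\<close> from SW to NE at \<open>v\<close> and drops by
  \<open>\<pi>(v)\<close> from SE to NW; so does the multiple of \<open>D\<^sup>r\<^sub>v\<close> in the decomposition, and the difference is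
  constant along the knot.  The quasi-indices are differences of values of \<open>\<delta>\<close> on arcs at a crossing.
  If the crossing does not take part in the move, these arcs survive, hence (Q0).  In (Q2) and (Q3) the
  growth of \<open>\<delta>\<close> along a strand through the region of the move is a combination of the quasi-indices
  of the two crossings on the strand; it vanishes for a bigon, and it is the same before and after a third
  move.
\<close>

section \<open>Cyclic words\<close>

definition cyc :: "'a list \<Rightarrow> 'a list \<Rightarrow> bool" where
  "cyc w w' \<longleftrightarrow> (\<exists>us vs. w = us @ vs \<and> w' = vs @ us)"

lemma cyc_refl [simp, intro]: "cyc w w"
  unfolding cyc_def by (metis append_Nil append_Nil2)

lemma cyc_iff_rotate: "cyc w w' \<longleftrightarrow> (\<exists>n. w' = rotate n w)"
proof
  assume "cyc w w'"
  then obtain us vs where "w = us @ vs" "w' = vs @ us" unfolding cyc_def by blast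
  then show "\<exists>n. w' = rotate n w" by (metis rotate_append)
next
  assume "\<exists>n. w' = rotate n w"
  then show "cyc w w'" unfolding cyc_def by (metis append_take_drop_id rotate_drop_take)
qed

lemma cyc_trans: "cyc u v \<Longrightarrow> cyc v w \<Longrightarrow> cyc u w"
  unfolding cyc_iff_rotate by (metis rotate_rotate)

lemma cyc_swap: "cyc (us @ vs) (vs @ us)"
  unfolding cyc_def by blast

lemma cyc_set: "cyc u v \<Longrightarrow> set v = set u"
  unfolding cyc_def by auto

lemma cyc_distinct: "cyc u v \<Longrightarrow> distinct v \<longleftrightarrow> distinct u"
  unfolding cyc_def by auto

lemma cyc_length: "cyc u v \<Longrightarrow> length v = length u"
  unfolding cyc_def by auto

lemma cyc_map: "cyc u v \<Longrightarrow> cyc (map f u) (map f v)"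
  unfolding cyc_def by force

lemma cyc_filter: "cyc u v \<Longrightarrow> cyc (filter f u) (filter f v)"
  unfolding cyc_def by force

lemma cyc_concat_map: "cyc u v \<Longrightarrow> cyc (concat (map f u)) (concat (map f v))"
  unfolding cyc_def by force

lemma cut_at_append: "p \<notin> set us \<Longrightarrow> cut_at p (us @ p # vs) = p # vs @ us"
proof -
  assume p: "p \<notin> set us"
  then have "takeWhile (\<lambda>q. q \<noteq> p) (us @ p # vs) = us" by (induction us) auto
  moreover have "dropWhile (\<lambda>q. q \<noteq> p) (us @ p # vs) = p # vs" using p by (induction us) auto
  ultimately show ?thesis unfolding cut_at_def by simp
qed

lemma cyc_cut_at: "cyc w (cut_at p w)"
  unfolding cyc_def cut_at_def by (metis takeWhile_dropWhile_id)

lemma cut_at_eq: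
  assumes "distinct w" "cyc w (p # vs)"
  shows "cut_at p w = p # vs"
proof -
  obtain us ws where w: "w = us @ ws" "p # vs = ws @ us" using assms(2) unfolding cyc_def by blast
  show ?thesis
  proof (cases ws)
    case Nil
    then have "w = p # vs" using w by simp
    then show ?thesis by (simp add: cut_at_def)
  next
    case (Cons q ws')
    then have "q = p" "vs = ws' @ us" using w by auto
    then show ?thesis using w Cons assms(1) cut_at_append[of p us ws'] by auto
  qed
qed

lemma cut_at_in: "p \<in> set w \<Longrightarrow> \<exists>vs. cut_at p w = p # vs"
  by (metis append_Cons cut_at_append split_list_first)

lemma consecutive_iff:
  assumes "distinct (word D)" "ps \<noteq> []"
  shows "consecutive D ps \<longleftrightarrow> (\<exists>rest. cyc (word D) (ps @ rest))"
proof
  assume "consecutive D ps"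
  then have "cut_at (hd ps) (word D) = ps @ drop (length ps) (cut_at (hd ps) (word D))"
    unfolding consecutive_def by (metis append_take_drop_id)
  then show "\<exists>rest. cyc (word D) (ps @ rest)" using cyc_cut_at by metis
next
  assume "\<exists>rest. cyc (word D) (ps @ rest)"
  then obtain rest where r: "cyc (word D) (ps @ rest)" by blast
  obtain p qs where ps: "ps = p # qs" using assms(2) by (cases ps) auto
  then have "cyc (word D) (p # qs @ rest)" using r by simp
  then have "cut_at p (word D) = ps @ rest" using cut_at_eq[OF assms(1)] ps by simp
  then show "consecutive D ps" unfolding consecutive_def using ps by simp
qed

lemma consecutive_Nil [simp]: "consecutive D []"
  unfolding consecutive_def by simp

lemma consecutive_in: "distinct (word D) \<Longrightarrow> consecutive D ps \<Longrightarrow> set ps \<subseteq> set (word D)"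
  unfolding consecutive_def by (metis cyc_cut_at cyc_set set_take_subset)

lemma consecutive_single: "p \<in> set (word D) \<Longrightarrow> consecutive D [p]"
  unfolding consecutive_def using cut_at_in[of p "word D"] by auto

lemma consecutive_mid:
  assumes "distinct (word D)" "consecutive D (us @ ps @ vs)"
  shows "consecutive D ps"
proof (cases "ps = []")
  case False
  then obtain rest where "cyc (word D) (us @ ps @ vs @ rest)"
    using assms by (auto simp: consecutive_iff)
  then have "cyc (word D) ((ps @ vs @ rest) @ us)"
    by (rule cyc_trans) (rule cyc_swap)
  then show ?thesis using False assms(1) by (auto simp: consecutive_iff)
qed simp

lemma consecutive_distinct:
  assumes "distinct (word D)" "consecutive D ps"
  shows "distinct ps"
  using assms(2) distinct_take[of "cut_at (hd ps) (word D)" "length ps"] cyc_distinct[OF cyc_cut_at] assms(1)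
  unfolding consecutive_def by metis

lemma consecutive_append_unique:
  assumes "distinct (word D)" "consecutive D (p # ps)" "consecutive D (p # qs)" "length ps \<le> length qs"
  shows "\<exists>rs. qs = ps @ rs"
proof -
  have "p # ps = take (Suc (length ps)) (cut_at p (word D))"
       "p # qs = take (Suc (length qs)) (cut_at p (word D))"
    using assms(2,3) unfolding consecutive_def by auto
  then have "p # ps = take (Suc (length ps)) (p # qs)" using assms(4)
    by (metis Suc_le_mono min.absorb1 take_take)
  then show ?thesis by (metis append_take_drop_id list.inject take_Suc_Cons)
qed

lemma consecutive_delete:
  assumes "distinct (word D)" "consecutive D ps"
  shows "consecutive (delete X D) (filter (\<lambda>p. fst p \<notin> X) ps)"
proof (cases "filter (\<lambda>p. fst p \<notin> X) ps = []")
  case False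
  then obtain rest where "cyc (word D) (ps @ rest)" using assms consecutive_iff by (metis filter.simps(1))
  from cyc_filter[OF this, of "\<lambda>p. fst p \<notin> X"]
  have "\<exists>r. cyc (word (delete X D)) (filter (\<lambda>p. fst p \<notin> X) ps @ r)" by (auto simp: delete_def)
  moreover have "distinct (word (delete X D))" using assms(1) by (simp add: delete_def)
  ultimately show ?thesis using False by (simp add: consecutive_iff)
next
  case True
  then show ?thesis by (metis consecutive_Nil)
qed

text \<open>
  All diagrams constructed below, those with fingers and those with probes, arise in this way: every
  point is replaced by a block that contains it and new points.
\<close>

definition expand :: "(point \<Rightarrow> point list) \<Rightarrow> nat set \<Rightarrow> diagram \<Rightarrow> diagram" where
  "expand blk N D = Diagram (concat (map blk (word D))) (pos D \<union> N)"

lemma consecutive_expand: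
  assumes "distinct (word D)" "distinct (word (expand blk N D))" "consecutive D ps"
  shows "consecutive (expand blk N D) (concat (map blk ps))"
proof (cases "concat (map blk ps) = []")
  case False
  then have "ps \<noteq> []" by auto
  then obtain rest where "cyc (word D) (ps @ rest)" using assms(1,3) consecutive_iff by metis
  from cyc_concat_map[OF this, of blk]
  have "\<exists>r. cyc (word (expand blk N D)) (concat (map blk ps) @ r)"
    by (auto simp: expand_def)
  then show ?thesis using consecutive_iff assms(2) False by blast
next
  case True
  then show ?thesis by (metis consecutive_Nil)
qed

lemma consecutive_map:
  assumes "distinct (word D)" "inj_on f (set (word D))" "consecutive D ps"
  shows "consecutive (Diagram (map f (word D)) N) (map f ps)"
proof (cases "ps = []")
  case False
  then obtain rest where "cyc (word D) (ps @ rest)" using assms(1,3) consecutive_iff by metis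
  from cyc_map[OF this, of f]
  have "\<exists>r. cyc (word (Diagram (map f (word D)) N)) (map f ps @ r)" by auto
  then show ?thesis using consecutive_iff[of "Diagram (map f (word D)) N" "map f ps"] False assms(1,2) by (auto simp: distinct_map)
qed simp

lemma consecutive_last:
  assumes d: "distinct (word D)" and c: "consecutive D (h # us @ q # vs)"
  shows "consecutive D [last (h # us), q]"
proof -
  have "butlast (h # us) @ [last (h # us)] = h # us" by (rule append_butlast_last_id) simp
  then have "h # us @ q # vs = butlast (h # us) @ [last (h # us), q] @ vs"
    by (metis append.assoc append_Cons append_Nil)
  then show ?thesis using c consecutive_mid[OF d] by metis
qed

lemma cyc_prefix_unique:
  fixes w :: "point list"
  assumes "distinct w" "cyc w (p # us)" "cyc w (p # vs)"
  shows "us = vs"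
  using cut_at_eq[OF assms(1,2)] cut_at_eq[OF assms(1,3)] by simp

text \<open>
  Without the last hypothesis the two segments together could run around the knot more than once.
\<close>

lemma consecutive_join:
  assumes d: "distinct (word D)" and a: "consecutive D (us @ [q])" and b: "consecutive D (q # vs)"
    and disj: "set us \<inter> set vs = {}"
  shows "consecutive D (us @ q # vs)"
proof (cases us)
  case (Cons p us')
  obtain r1 where r1: "cyc (word D) ((us @ [q]) @ r1)" using a d consecutive_iff by blast
  obtain r2 where r2: "cyc (word D) ((q # vs) @ r2)" using b d consecutive_iff by blast
  have "cyc (word D) (q # r1 @ us)" using r1 cyc_trans[OF _ cyc_swap[of us "q # r1"]] by simp
  \<comment> \<open>Both sides list the points after \<open>q\<close> once around the knot.\<close>
  then have e: "vs @ r2 = r1 @ us" using cyc_prefix_unique[OF d] r2 by fastforce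
  then obtain k where k: "vs = r1 @ k \<and> k @ r2 = us \<or> vs @ k = r1"
    unfolding append_eq_append_conv2 by blast
  obtain r3 where r3: "r1 = vs @ r3"
  proof (cases "vs @ k = r1")
    case False
    then have "vs = r1 @ k" "set k \<subseteq> set us" using k by auto
    then have "k = []" using disj by (cases k) auto
    then show ?thesis using that[of "[]"] \<open>vs = r1 @ k\<close> by simp
  qed (use that in blast)
  have "cyc (word D) ((us @ q # vs) @ r3)" using r1 r3 by simp
  then show ?thesis using consecutive_iff[OF d] by blast
qed (use b in simp)

lemma two_cycle:
  assumes d: "distinct (word D)" and a: "consecutive D [p, q]" "consecutive D [q, p]" and n: "p \<noteq> q"
  shows "set (word D) = {p, q}"
proof -
  obtain r where r: "cyc (word D) (p # q # r)" using a(1) consecutive_iff[OF d, of "[p, q]"] by auto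
  obtain r' where r': "cyc (word D) (q # p # r')" using a(2) consecutive_iff[OF d, of "[q, p]"] by auto
  have "cyc (word D) (q # r @ [p])" using r cyc_trans[OF _ cyc_swap[of "[p]" "q # r"]] by simp
  then have e: "r @ [p] = p # r'" using cyc_prefix_unique[OF d] r' by blast
  have "p \<notin> set r" using cyc_distinct[OF r] d by simp
  then have "r = []" using e by (cases r) auto
  then show ?thesis using cyc_set[OF r] by simp
qed

lemma consecutive_neq:
  assumes "distinct (word D)" "consecutive D (us @ [p] @ vs @ [q] @ ws)"
  shows "p \<noteq> q"
  using consecutive_distinct[OF assms] by auto

lemma consecutive_sublist:
  "distinct (word D) \<Longrightarrow> consecutive D qs \<Longrightarrow> sublist ps qs \<Longrightarrow> consecutive D ps"
  using consecutive_mid unfolding sublist_def by blast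

lemma next_pointI:
  assumes "distinct (word D)" "consecutive D [p, q]"
  shows "next_point D p = q"
  using assms unfolding consecutive_def next_point_def
  by simp (metis One_nat_def lessI less_Suc_eq nth_Cons_0 nth_Cons_Suc nth_take)

lemma prev_pointI:
  assumes "distinct (word D)" "consecutive D [p, q]"
  shows "prev_point D q = p"
proof -
  obtain rest where "cyc (word D) ([p,q] @ rest)" using assms by (auto simp: consecutive_iff)
  then have "cyc (word D) (q # rest @ [p])" using cyc_trans cyc_swap[of "[p]" "q # rest"] by auto
  then have "cut_at q (word D) = q # rest @ [p]" using cut_at_eq assms(1) by blast
  then show ?thesis unfolding prev_point_def by simp
qed

lemma consecutive_next:
  assumes "distinct (word D)" "p \<in> set (word D)" "2 \<le> length (word D)"
  shows "consecutive D [p, next_point D p]"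
proof -
  obtain vs where c: "cut_at p (word D) = p # vs" using cut_at_in[OF assms(2)] by blast
  have "length (p # vs) = length (word D)" using cyc_length[OF cyc_cut_at] c by metis
  then obtain q ws where "vs = q # ws" using assms(3) by (cases vs) auto
  then show ?thesis using c unfolding consecutive_def next_point_def by simp
qed

lemma consecutive_prev:
  assumes "distinct (word D)" "p \<in> set (word D)" "2 \<le> length (word D)"
  shows "consecutive D [prev_point D p, p]"
proof -
  obtain vs where c: "cut_at p (word D) = p # vs" using cut_at_in[OF assms(2)] by blast
  have "length (p # vs) = length (word D)" using cyc_length[OF cyc_cut_at] c by metis
  then obtain q ws where v: "vs = ws @ [q]" using assms(3) by (cases vs rule: rev_cases) auto
  then have "prev_point D p = q" using c unfolding prev_point_def by simp
  moreover have "cyc (word D) (p # ws @ [q])" using c v cyc_cut_at by metis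
  then have "cyc (word D) ([q, p] @ ws)" using cyc_trans cyc_swap[of "p # ws" "[q]"] by auto
  ultimately show ?thesis using consecutive_iff assms(1) by blast
qed

lemma consecutive_unique_next:
  "distinct (word D) \<Longrightarrow> consecutive D [p, q] \<Longrightarrow> consecutive D [p, q'] \<Longrightarrow> q = q'"
  using next_pointI by blast

lemma consecutive_unique_prev:
  "distinct (word D) \<Longrightarrow> consecutive D [q, p] \<Longrightarrow> consecutive D [q', p] \<Longrightarrow> q = q'"
  using prev_pointI by blast

section \<open>Gauss diagrams and their reductions\<close>

lemma gauss_distinct: "gauss_diagram D \<Longrightarrow> distinct (word D)"
  unfolding gauss_diagram_def by blast

lemma gauss_partner: "gauss_diagram D \<Longrightarrow> (v, b) \<in> set (word D) \<longleftrightarrow> v \<in> crossings D"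
proof -
  assume g: "gauss_diagram D"
  have "(v, b) \<in> set (word D)" if "(v, b') \<in> set (word D)" for b'
    using g that unfolding gauss_diagram_def by (cases "b = b'") auto
  then show ?thesis unfolding crossings_def by (metis (no_types, lifting) fst_conv image_iff prod.collapse)
qed

lemma gauss_delete: "gauss_diagram D \<Longrightarrow> gauss_diagram (delete X D)"
  unfolding gauss_diagram_def by (auto simp: delete_def crossings_def image_iff)

lemma crossings_delete [simp]: "crossings (delete X D) = crossings D - X"
  unfolding crossings_def delete_def by auto

lemma word_delete: "word (delete X D) = filter (\<lambda>p. fst p \<notin> X) (word D)"
  by (simp add: delete_def)

lemma pos_delete [simp]: "pos (delete X D) = pos D - X"
  by (simp add: delete_def)

lemma lift_pair:
  assumes d: "distinct (word F)" and c: "consecutive (delete X F) [p, q]"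
  shows "\<exists>us. consecutive F (p # us @ [q]) \<and> fst ` set us \<subseteq> X \<and> fst p \<notin> X \<and> fst q \<notin> X"
proof -
  let ?E = "delete X F"
  have dE: "distinct (word ?E)" using d by (simp add: delete_def)
  obtain rest where r: "cyc (word ?E) (p # q # rest)" using consecutive_iff[OF dE, of "[p, q]"] c by auto
  have pw: "p \<in> set (word F)" "fst p \<notin> X" "fst q \<notin> X" using cyc_set[OF r] by (auto simp: word_delete)
  obtain vs where v: "cyc (word F) (p # vs)" using cut_at_in[OF pw(1)] cyc_cut_at by metis
  have "cyc (word ?E) (p # filter (\<lambda>p. fst p \<notin> X) vs)"
    using cyc_filter[OF v, of "\<lambda>p. fst p \<notin> X"] pw by (simp add: word_delete)
  then have "filter (\<lambda>p. fst p \<notin> X) vs = q # rest" using cyc_prefix_unique[OF dE] r by blast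
  then obtain us ws where u: "vs = us @ q # ws" "\<forall>u\<in>set us. \<not> fst u \<notin> X"
    unfolding filter_eq_Cons_iff by blast
  have "cyc (word F) ((p # us @ [q]) @ ws)" using v u by simp
  then have "consecutive F (p # us @ [q])" using consecutive_iff[OF d] by blast
  then show ?thesis using u(2) pw by (intro exI[of _ us]) auto
qed

lemma delete_delete: "delete X (delete Y D) = delete (X \<union> Y) D"
  unfolding delete_def by (auto intro!: filter_cong)

lemma delete_empty [simp]: "delete {} D = D"
  unfolding delete_def by (cases D) simp

lemma finite_crossings [simp]: "finite (crossings D)"
  unfolding crossings_def by simp

lemma length_ge2:
  assumes "gauss_diagram D" "word D \<noteq> []"
  shows "2 \<le> length (word D)"
proof -
  obtain v b where "(v, b) \<in> set (word D)" using assms(2) by (metis hd_in_set surj_pair)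
  then have "{(v,b), (v, \<not> b)} \<subseteq> set (word D)" using assms(1) unfolding gauss_diagram_def by blast
  then have "card {(v,b), (v, \<not> b)} \<le> card (set (word D))" by (intro card_mono) auto
  then show ?thesis using card_length[of "word D"] by auto
qed

lemma bigon_delete:
  assumes "gauss_diagram D" "bigon D x y" "x \<notin> X" "y \<notin> X"
  shows "bigon (delete X D) x y"
proof -
  have c: "consecutive (delete X D) [(u, b), (v, b')]"
    if "consecutive D [(u, b), (v, b')]" "u \<notin> X" "v \<notin> X" for u v b b'
    using consecutive_delete[OF gauss_distinct[OF assms(1)] that(1), of X] that(2,3) by simp
  show ?thesis using assms(2) c assms(3,4) unfolding bigon_def by simp blast
qed

lemma bigon_crossings: "gauss_diagram D \<Longrightarrow> bigon D x y \<Longrightarrow> x \<in> crossings D \<and> y \<in> crossings D"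
  unfolding bigon_def using consecutive_in[OF gauss_distinct, of D "[(x,True),(y,True)]"]
  by (auto simp: gauss_partner)

lemma kink_crossings: "gauss_diagram D \<Longrightarrow> kink D x b \<Longrightarrow> x \<in> crossings D"
  unfolding kink_def using consecutive_in[OF gauss_distinct, of D "[(x,b),(x,\<not>b)]"]
  by (auto simp: gauss_partner)

text \<open>
  Parities of different diagrams are compared along decreasing first and second moves only: they
  leave the labels of the surviving crossings unchanged and preserve the relations between them.
\<close>

inductive reduces :: "diagram \<Rightarrow> diagram \<Rightarrow> bool" where
  stop: "reduces M M"
| bigon: "reduces M D \<Longrightarrow> bigon D x y \<Longrightarrow> reduces M (delete {x, y} D)"
| kink: "reduces M D \<Longrightarrow> kink D x b \<Longrightarrow> reduces M (delete {x} D)"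

lemma reduces_trans:
  assumes "reduces M D" "reduces D E" shows "reduces M E"
  using assms(2,1) by (induction) (auto intro: reduces.intros)

lemma reduces_gauss: "reduces M D \<Longrightarrow> gauss_diagram M \<Longrightarrow> gauss_diagram D"
  by (induction rule: reduces.induct) (simp_all add: gauss_delete)

text \<open>Removing a bigon keeps the disjoint ones, so the order of the moves does not matter.\<close>

lemma reduces_bigons:
  assumes "finite I" "gauss_diagram M" "\<And>i. i \<in> I \<Longrightarrow> bigon M (f i) (g i)"
    "\<And>i j. i \<in> I \<Longrightarrow> j \<in> I \<Longrightarrow> i \<noteq> j \<Longrightarrow> {f i, g i} \<inter> {f j, g j} = {}"
  shows "reduces M (delete (f ` I \<union> g ` I) M)"
  using assms
proof (induction I rule: finite_induct)
  case empty
  then show ?case by (simp add: reduces.stop)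
next
  case (insert i I)
  have IH: "reduces M (delete (f ` I \<union> g ` I) M)"
    by (rule insert.IH) (use insert.prems in auto)
  have "f i \<notin> f ` I \<union> g ` I" "g i \<notin> f ` I \<union> g ` I"
    using insert.prems(3)[of i] insert.hyps(2) by force+
  then have "bigon (delete (f ` I \<union> g ` I) M) (f i) (g i)"
    using bigon_delete insert.prems(1,2) by blast
  note red = reduces.bigon[OF IH this]
  have "{f i, g i} \<union> (f ` I \<union> g ` I) = f ` insert i I \<union> g ` insert i I" by auto
  then show ?case using red by (simp only: delete_delete)
qed

lemma is_move_bigon:
  "gauss_diagram D \<Longrightarrow> bigon D x y \<Longrightarrow> is_move (Move D (R2_dec x y) (delete {x, y} D))"
  unfolding is_move_def by (simp add: gauss_delete)

lemma is_move_bigon_inc: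
  "gauss_diagram D \<Longrightarrow> bigon D x y \<Longrightarrow> is_move (Move (delete {x, y} D) (R2_inc x y) D)"
  unfolding is_move_def by (simp add: gauss_delete)

lemma is_move_kink:
  "gauss_diagram D \<Longrightarrow> kink D x b \<Longrightarrow> is_move (Move D (R1_dec x b) (delete {x} D))"
  unfolding is_move_def by (simp add: gauss_delete)

section \<open>Relations between parities\<close>

text \<open>
  What remains of a partial isomorphism under composition and inversion without mentioning its
  domain: the graph is a subgroup of the product.
\<close>

definition group_rel :: "'a monoid \<Rightarrow> 'b monoid \<Rightarrow> ('a \<times> 'b) set \<Rightarrow> bool" where
  "group_rel G H R \<longleftrightarrow> group G \<and> group H \<and> R \<subseteq> carrier G \<times> carrier H \<and> (\<one>\<^bsub>G\<^esub>, \<one>\<^bsub>H\<^esub>) \<in> R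
     \<and> (\<forall>a b c d. (a, b) \<in> R \<longrightarrow> (c, d) \<in> R \<longrightarrow> (a \<otimes>\<^bsub>G\<^esub> c, b \<otimes>\<^bsub>H\<^esub> d) \<in> R)
     \<and> (\<forall>a b. (a, b) \<in> R \<longrightarrow> (inv\<^bsub>G\<^esub> a, inv\<^bsub>H\<^esub> b) \<in> R)"

lemma group_rel_mult: "group_rel G H R \<Longrightarrow> (a, b) \<in> R \<Longrightarrow> (c, d) \<in> R \<Longrightarrow> (a \<otimes>\<^bsub>G\<^esub> c, b \<otimes>\<^bsub>H\<^esub> d) \<in> R"
  unfolding group_rel_def by blast

lemma group_rel_inv: "group_rel G H R \<Longrightarrow> (a, b) \<in> R \<Longrightarrow> (inv\<^bsub>G\<^esub> a, inv\<^bsub>H\<^esub> b) \<in> R"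
  unfolding group_rel_def by blast

lemma group_rel_one: "group_rel G H R \<Longrightarrow> (\<one>\<^bsub>G\<^esub>, \<one>\<^bsub>H\<^esub>) \<in> R"
  unfolding group_rel_def by blast

lemma group_rel_int_pow:
  assumes R: "group_rel G H R" and ab: "(a, b) \<in> R"
  shows "(a [^]\<^bsub>G\<^esub> (n::int), b [^]\<^bsub>H\<^esub> n) \<in> R"
proof -
  interpret G: group G using R unfolding group_rel_def by blast
  interpret H: group H using R unfolding group_rel_def by blast
  have nat: "(a [^]\<^bsub>G\<^esub> (k::nat), b [^]\<^bsub>H\<^esub> k) \<in> R" for k
    by (induction k) (auto intro: group_rel_one[OF R] group_rel_mult[OF R _ ab])
  show ?thesis
    by (cases "n < 0") (simp_all only: int_pow_def2 if_True if_False nat group_rel_inv[OF R nat])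
qed

lemma group_rel_Id:
  assumes "group G" shows "group_rel G G (Id_on (carrier G))"
proof -
  interpret group G by fact
  show ?thesis unfolding group_rel_def using assms by blast
qed

lemma group_rel_O:
  assumes R: "group_rel G H R" and S: "group_rel H L S"
  shows "group_rel G L (R O S)"
  unfolding group_rel_def
proof (intro conjI allI impI)
  show "(\<one>\<^bsub>G\<^esub>, \<one>\<^bsub>L\<^esub>) \<in> R O S" using group_rel_one[OF R] group_rel_one[OF S] by (rule relcompI)
  fix a b c d assume "(a, b) \<in> R O S" "(c, d) \<in> R O S"
  then show "(a \<otimes>\<^bsub>G\<^esub> c, b \<otimes>\<^bsub>L\<^esub> d) \<in> R O S"
    by (elim relcompE Pair_inject) (auto intro!: relcompI intro: group_rel_mult[OF R] group_rel_mult[OF S])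
next
  fix a b assume "(a, b) \<in> R O S"
  then show "(inv\<^bsub>G\<^esub> a, inv\<^bsub>L\<^esub> b) \<in> R O S"
    by (elim relcompE Pair_inject) (auto intro: relcompI group_rel_inv[OF R] group_rel_inv[OF S])
qed (use R S in \<open>auto simp: group_rel_def\<close>)

lemma group_rel_converse: "group_rel G H R \<Longrightarrow> group_rel H G (R\<inverse>)"
  unfolding group_rel_def by auto

lemma partial_iso_group_rel:
  assumes "partial_iso G H R" "group G" "group H"
  shows "group_rel G H R"
proof -
  obtain S T h where S: "subgroup S G" and T: "subgroup T H"
    and h: "h \<in> iso (G\<lparr>carrier := S\<rparr>) (H\<lparr>carrier := T\<rparr>)" and R: "R = {(g, h g) | g. g \<in> S}"
    using assms(1) unfolding partial_iso_def by blast
  interpret h: group_hom "G\<lparr>carrier := S\<rparr>" "H\<lparr>carrier := T\<rparr>" h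
    using h subgroup.subgroup_is_group[OF S assms(2)] subgroup.subgroup_is_group[OF T assms(3)]
    unfolding group_hom_def group_hom_axioms_def iso_def by auto
  have inv: "h (inv\<^bsub>G\<^esub> a) = inv\<^bsub>H\<^esub> h a" if "a \<in> S" for a
    using h.hom_inv[of a] that group.m_inv_consistent[OF assms(2) S that]
      group.m_inv_consistent[OF assms(3) T, of "h a"] h.hom_closed[of a] by simp
  have mult: "h (a \<otimes>\<^bsub>G\<^esub> b) = h a \<otimes>\<^bsub>H\<^esub> h b" if "a \<in> S" "b \<in> S" for a b
    using h.hom_mult[of a b] that by simp
  have one: "h \<one>\<^bsub>G\<^esub> = \<one>\<^bsub>H\<^esub>" using h.hom_one by simp
  have cl: "h a \<in> T" if "a \<in> S" for a using h.hom_closed[of a] that by simp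
  show ?thesis unfolding group_rel_def
  proof (intro conjI allI impI)
    show "R \<subseteq> carrier G \<times> carrier H" using R cl subgroup.subset[OF S] subgroup.subset[OF T] by auto
    show "(\<one>\<^bsub>G\<^esub>, \<one>\<^bsub>H\<^esub>) \<in> R" using R one subgroup.one_closed[OF S] by force
    fix a b c d assume "(a, b) \<in> R" "(c, d) \<in> R"
    then show "(a \<otimes>\<^bsub>G\<^esub> c, b \<otimes>\<^bsub>H\<^esub> d) \<in> R" using R mult subgroup.m_closed[OF S] by force
  next
    fix a b assume "(a, b) \<in> R"
    then show "(inv\<^bsub>G\<^esub> a, inv\<^bsub>H\<^esub> b) \<in> R" using R inv subgroup.m_inv_closed[OF S] by force
  qed (use assms in auto)
qed

text \<open>
  The injectivity of the partial isomorphism.  It allows relations to be transferred back from the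
  target of a move to its source.
\<close>

lemma partial_iso_unique:
  assumes "partial_iso G H R" "group G" "group H" "(g, h) \<in> R"
  shows "g = \<one>\<^bsub>G\<^esub> \<longleftrightarrow> h = \<one>\<^bsub>H\<^esub>"
proof -
  obtain S T f where S: "subgroup S G"
    and f: "f \<in> iso (G\<lparr>carrier := S\<rparr>) (H\<lparr>carrier := T\<rparr>)" and R: "R = {(g, f g) | g. g \<in> S}"
    using assms(1) unfolding partial_iso_def by blast
  have "inj_on f S" using f unfolding iso_def bij_betw_def by simp
  moreover have "(\<one>\<^bsub>G\<^esub>, \<one>\<^bsub>H\<^esub>) \<in> R" using group_rel_one[OF partial_iso_group_rel[OF assms(1-3)]] .
  ultimately show ?thesis using R assms(4) unfolding inj_on_def by auto
qed

text \<open>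
  Formal integral combinations of crossings are functions with addition pointwise; \<open>gen v\<close> is the
  generator \<open>v\<close>.  They carry a relation between parities from one diagram to another, although the
  coefficient groups differ.
\<close>

definition gen :: "nat \<Rightarrow> nat \<Rightarrow> int" where
  "gen v = (\<lambda>u. if u = v then 1 else 0)"

definition supp :: "(nat \<Rightarrow> int) \<Rightarrow> nat set" where
  "supp f = {v. f v \<noteq> 0}"

lemma supp_gen [simp]: "supp (gen v) = {v}"
  unfolding supp_def gen_def by auto

lemma supp_add: "supp f \<subseteq> X \<Longrightarrow> supp g \<subseteq> X \<Longrightarrow> supp (f + g) \<subseteq> X"
  unfolding supp_def by (simp add: subset_iff) (metis add_0)

lemma supp_minus [simp]: "supp (- f) = supp f"
  unfolding supp_def by auto

lemma supp_0 [simp]: "supp 0 = {}"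
  unfolding supp_def by auto

lemma supp_sum:
  assumes "\<And>i. i \<in> I \<Longrightarrow> supp (f i) \<subseteq> X" shows "supp (\<Sum>i\<in>I. f i) \<subseteq> X"
  using assms
proof (induction I rule: infinite_finite_induct)
  case (insert i I)
  then have "supp (f i + (\<Sum>i\<in>I. f i)) \<subseteq> X" by (intro supp_add) auto
  then show ?case by (simp only: sum.insert[OF insert.hyps])
qed simp_all

lemma supp_diff: "supp f \<subseteq> X \<Longrightarrow> supp g \<subseteq> X \<Longrightarrow> supp (f - g) \<subseteq> X"
  using supp_add[of f X "- g"] by simp

locale knot_parity = oriented_parity_functor +
  assumes knot: "virtual_knot K"
begin

lemma K_move: "is_move f \<Longrightarrow> source f \<in> K \<longleftrightarrow> target f \<in> K"
proof -
  assume f: "is_move f"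
  obtain D where K: "K = {D'. equivclp (\<lambda>D1 D2. \<exists>k. is_move (Move D1 k D2)) D D'}"
    using knot unfolding virtual_knot_def by blast
  have "equivclp (\<lambda>D1 D2. \<exists>k. is_move (Move D1 k D2)) (source f) (target f)"
    using f by (metis move.collapse r_into_equivclp)
  then show ?thesis unfolding K by (auto intro: equivclp_trans equivclp_sym)
qed

lemma K_gauss:
  assumes "D' \<in> K" shows "gauss_diagram D'"
proof -
  obtain D where D: "gauss_diagram D" and K: "K = {D'. equivclp (\<lambda>D1 D2. \<exists>k. is_move (Move D1 k D2)) D D'}"
    using knot unfolding virtual_knot_def by blast
  have "equivclp (\<lambda>D1 D2. \<exists>k. is_move (Move D1 k D2)) D D'" using assms K by blast
  then show ?thesis
  proof (induction rule: equivclp_induct)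
    case (step y z)
    then show ?case by (auto simp: is_move_def)
  qed (rule D)
qed

lemma reduces_K: "reduces M D \<Longrightarrow> gauss_diagram M \<Longrightarrow> M \<in> K \<longleftrightarrow> D \<in> K"
proof (induction rule: reduces.induct)
  case (bigon M D x y)
  then show ?case using K_move[OF is_move_bigon] reduces_gauss by fastforce
next
  case (kink M D x b)
  then show ?case using K_move[OF is_move_kink] reduces_gauss by fastforce
qed simp

definition val :: "diagram \<Rightarrow> (nat \<Rightarrow> int) \<Rightarrow> 'a" where
  "val D f = finprod (G D) (\<lambda>v. P D v [^]\<^bsub>G D\<^esub> f v) (crossings D)"

lemma pow_closed: "D \<in> K \<Longrightarrow> v \<in> crossings D \<Longrightarrow> P D v [^]\<^bsub>G D\<^esub> (n::int) \<in> carrier (G D)"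
  using parity_closed group by (simp add: group.int_pow_closed comm_group.axioms)

lemma val_closed [simp]: "D \<in> K \<Longrightarrow> val D f \<in> carrier (G D)"
  unfolding val_def using group[of D] pow_closed
  by (intro comm_monoid.finprod_closed) (auto simp: comm_group.axioms)

lemma val_zero [simp]: "D \<in> K \<Longrightarrow> val D 0 = \<one>\<^bsub>G D\<^esub>"
  unfolding val_def using group[of D]
  by (intro comm_monoid.finprod_one_eqI) (auto simp: comm_group.axioms)

lemma val_add:
  assumes "D \<in> K" shows "val D (f + g) = val D f \<otimes>\<^bsub>G D\<^esub> val D g"
proof -
  interpret comm_group "G D" using group assms by blast
  have "val D (f + g) = finprod (G D) (\<lambda>v. P D v [^]\<^bsub>G D\<^esub> f v \<otimes>\<^bsub>G D\<^esub> P D v [^]\<^bsub>G D\<^esub> g v) (crossings D)"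
    unfolding val_def using assms parity_closed
    by (intro finprod_cong') (auto simp: int_pow_mult)
  then show ?thesis unfolding val_def using assms parity_closed by (simp add: finprod_multf Pi_def)
qed

lemma val_minus:
  assumes "D \<in> K" shows "val D (- f) = inv\<^bsub>G D\<^esub> val D f"
proof -
  interpret comm_group "G D" using group assms by blast
  have "val D (- f) \<otimes>\<^bsub>G D\<^esub> val D f = \<one>\<^bsub>G D\<^esub>" using val_add[OF assms, of "- f" f] assms by simp
  then show ?thesis using inv_equality[of "val D (- f)" "val D f"] assms by simp
qed

lemma val_diff: "D \<in> K \<Longrightarrow> val D (f - g) = val D f \<otimes>\<^bsub>G D\<^esub> inv\<^bsub>G D\<^esub> val D g"
  using val_add[of D f "- g"] val_minus[of D g] by simp

lemma val_gen:
  assumes "D \<in> K" "v \<in> crossings D" shows "val D (gen v) = P D v"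
proof -
  interpret comm_group "G D" using group assms by blast
  have "val D (gen v) = finprod (G D) (\<lambda>u. if v = u then P D u else \<one>\<^bsub>G D\<^esub>) (crossings D)"
    unfolding val_def gen_def using assms parity_closed by (intro finprod_cong') auto
  then show ?thesis using finprod_singleton[OF assms(2), of "P D"] assms parity_closed by simp
qed

lemma val_sum:
  assumes "D \<in> K" "finite I"
  shows "val D (\<Sum>i\<in>I. f i) = finprod (G D) (\<lambda>i. val D (f i)) I"
proof -
  interpret comm_group "G D" using group assms by blast
  show ?thesis using assms(2)
  proof (induction I rule: finite_induct)
    case (insert i I)
    have "(\<lambda>i. val D (f i)) \<in> I \<rightarrow> carrier (G D)" using assms(1) by simp
    then show ?case using insert assms(1) by (simp only: sum.insert[OF insert.hyps] val_add[OF assms(1)] insert.IH) simp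
  qed (use assms(1) in \<open>simp only: sum.empty val_zero finprod_empty\<close>)
qed

lemma val_supp:
  assumes "D \<in> K" "supp f \<subseteq> crossings D"
  shows "val D f = finprod (G D) (\<lambda>v. P D v [^]\<^bsub>G D\<^esub> f v) (supp f)"
proof -
  interpret comm_group "G D" using group assms by blast
  show ?thesis unfolding val_def
    by (rule finprod_mono_neutral_cong_left[symmetric])
      (use assms in \<open>auto simp: supp_def pow_closed parity_closed\<close>)
qed

lemma val_pair:
  assumes "D \<in> K" "D' \<in> K" "group_rel (G D) (G D') R" "supp f \<subseteq> crossings D \<inter> crossings D'"
    and "\<And>v. v \<in> supp f \<Longrightarrow> (P D v, P D' v) \<in> R"
  shows "(val D f, val D' f) \<in> R"
proof -
  interpret g: comm_group "G D" using group assms by blast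
  interpret g': comm_group "G D'" using group assms by blast
  have "finite X \<Longrightarrow> X \<subseteq> supp f \<Longrightarrow> (finprod (G D) (\<lambda>v. P D v [^]\<^bsub>G D\<^esub> f v) X,
      finprod (G D') (\<lambda>v. P D' v [^]\<^bsub>G D'\<^esub> f v) X) \<in> R" for X
  proof (induction X rule: finite_induct)
    case (insert v X)
    have c: "X \<subseteq> crossings D" "X \<subseteq> crossings D'" "v \<in> crossings D" "v \<in> crossings D'"
      using insert.prems assms(4) by auto
    then have "(\<lambda>v. P D v [^]\<^bsub>G D\<^esub> f v) \<in> X \<rightarrow> carrier (G D)" "(\<lambda>v. P D' v [^]\<^bsub>G D'\<^esub> f v) \<in> X \<rightarrow> carrier (G D')"
      using assms(1,2) pow_closed by auto
    then show ?case using insert c assms(1,2)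
      by (auto simp: pow_closed parity_closed intro!: group_rel_mult[OF assms(3)] group_rel_int_pow[OF assms(3)] assms(5))
  qed (simp add: group_rel_one[OF assms(3)])
  from this[of "supp f"] show ?thesis using assms(1,2,4) val_supp finite_subset[OF _ finite_crossings[of D], of "supp f"] by simp
qed

text \<open>
  The support is part of the definition because a crossing that is absent from \<open>D\<close> would contribute
  nothing to the value, and the relation could not be transferred to a larger diagram.
\<close>

definition rel :: "diagram \<Rightarrow> (nat \<Rightarrow> int) \<Rightarrow> bool" where
  "rel D f \<longleftrightarrow> supp f \<subseteq> crossings D \<and> val D f = \<one>\<^bsub>G D\<^esub>"

lemma rel_zero: "D \<in> K \<Longrightarrow> rel D 0"
  unfolding rel_def by simp

lemma rel_add: "D \<in> K \<Longrightarrow> rel D f \<Longrightarrow> rel D g \<Longrightarrow> rel D (f + g)"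
  unfolding rel_def using group[of D] by (auto simp: val_add supp_add comm_group_def monoid.one_closed monoid.l_one group.is_monoid)

lemma rel_minus: "D \<in> K \<Longrightarrow> rel D f \<Longrightarrow> rel D (- f)"
  unfolding rel_def using group[of D] by (auto simp: val_minus comm_group_def monoid.inv_one group.is_monoid)

lemma rel_diff: "D \<in> K \<Longrightarrow> rel D f \<Longrightarrow> rel D g \<Longrightarrow> rel D (f - g)"
  using rel_add[of D f "- g"] rel_minus[of D g] by simp

lemma rel_sum: "finite I \<Longrightarrow> D \<in> K \<Longrightarrow> (\<And>i. i \<in> I \<Longrightarrow> rel D (f i)) \<Longrightarrow> rel D (\<Sum>i\<in>I. f i)"
proof (induction I rule: finite_induct)
  case (insert i I)
  then have "rel D (f i + (\<Sum>i\<in>I. f i))" by (intro rel_add) auto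
  then show ?case by (simp only: sum.insert[OF insert.hyps])
qed (simp only: sum.empty rel_zero)

lemma rel_eq:
  assumes "D \<in> K" "rel D (f - g)" shows "val D f = val D g"
proof -
  interpret comm_group "G D" using group assms by blast
  have "val D f = val D ((f - g) + g)" by simp
  also have "\<dots> = val D (f - g) \<otimes>\<^bsub>G D\<^esub> val D g" using val_add[OF assms(1)] by blast
  finally show ?thesis using assms unfolding rel_def by simp
qed

text \<open>One direction is (P0); the other one needs that partial isomorphisms are injective.\<close>

lemma move_rel:
  assumes "is_move f" "source f \<in> K" "crossing_map (kind f) = id"
    "supp g \<subseteq> crossings (source f)" "supp g \<subseteq> crossings (target f)"
  shows "rel (source f) g \<longleftrightarrow> rel (target f) g"
proof -
  have t: "target f \<in> K" using K_move assms(1,2) by blast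
  have g: "group (G (source f))" "group (G (target f))"
    using group assms(2) t by (auto simp: comm_group_def)
  have pi: "partial_iso (G (source f)) (G (target f)) (A f)" using iso assms(1,2) by blast
  have "(P (source f) v, P (target f) v) \<in> A f" if "v \<in> supp g" for v
    using P0[OF assms(1,2), of v] assms(3-5) that by auto
  then have "(val (source f) g, val (target f) g) \<in> A f"
    using val_pair[OF assms(2) t partial_iso_group_rel[OF pi g]] assms(4,5) by auto
  then show ?thesis unfolding rel_def using partial_iso_unique[OF pi g] assms(4,5) by auto
qed

lemma crossing_map_dec [simp]: "crossing_map (R1_dec x b) = id" "crossing_map (R2_dec x y) = id"
  "crossing_map (R1_inc x b) = id" "crossing_map (R2_inc x y) = id" "crossing_map (R3 u v w) = id"
  by (auto simp: fun_eq_iff)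

lemma reduces_rel:
  assumes "reduces M D" "M \<in> K" "supp g \<subseteq> crossings D"
  shows "rel M g \<longleftrightarrow> rel D g"
  using assms
proof (induction rule: reduces.induct)
  case (bigon M D x y)
  have D: "D \<in> K" "gauss_diagram D" using bigon reduces_K K_gauss by auto
  show ?case using bigon move_rel[OF is_move_bigon[OF D(2) bigon(2)], of g] D by auto
next
  case (kink M D x b)
  have D: "D \<in> K" "gauss_diagram D" using kink reduces_K K_gauss by auto
  show ?case using kink move_rel[OF is_move_kink[OF D(2) kink(2)], of g] D by auto
qed simp

lemma reduces_rel_up:
  assumes "reduces M D" "M \<in> K" "rel D g"
  shows "rel M g"
  using reduces_rel[OF assms(1,2)] assms(3) rel_def by blast

lemma rel_bigon:
  assumes "D \<in> K" "bigon D x y"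
  shows "rel D (gen x + gen y)"
proof -
  have g: "gauss_diagram D" using K_gauss assms(1) by blast
  have "x \<in> crossings D" "y \<in> crossings D" using bigon_crossings g assms(2) by auto
  then show ?thesis unfolding rel_def using P2[OF assms(1) is_move_bigon[OF g assms(2)]] assms(1)
    by (simp add: val_add val_gen supp_add)
qed

lemma rel_kink:
  assumes "D \<in> K" "kink D x b"
  shows "rel D (gen x)"
proof -
  have g: "gauss_diagram D" using K_gauss assms(1) by blast
  have "x \<in> crossings D" using kink_crossings g assms(2) by auto
  then show ?thesis unfolding rel_def using P1[OF assms(1) is_move_kink[OF g assms(2)]] assms(1)
    by (simp add: val_gen)
qed

end

section \<open>Sliding a finger across a crossing\<close>

lemma distinct_concat_map:
  assumes "distinct ws" "\<And>p. p \<in> set ws \<Longrightarrow> distinct (blk p)"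
    "\<And>p q. p \<in> set ws \<Longrightarrow> q \<in> set ws \<Longrightarrow> p \<noteq> q \<Longrightarrow> set (blk p) \<inter> set (blk q) = {}"
  shows "distinct (concat (map blk ws))"
  using assms
proof (induction ws)
  case (Cons p ws)
  have "distinct (concat (map blk ws))" using Cons by simp
  moreover have "set (blk p) \<inter> set (blk q) = {}" if "q \<in> set ws" for q
    using Cons.prems(1,3) that by (metis distinct.simps(2) list.set_intros(1,2))
  ultimately show ?case using Cons.prems(2)[of p] by auto
qed simp

lemma concat_map_single: "concat (map (\<lambda>p. [p]) ws) = ws"
  by (induction ws) auto

lemma delete_expand:
  assumes "\<And>p. p \<in> set (word D) \<Longrightarrow> filter (\<lambda>q. fst q \<notin> X) (blk p) = [p]" "N \<subseteq> X" "pos D \<inter> X = {}"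
  shows "delete X (expand blk N D) = D"
proof -
  have "filter (\<lambda>q. fst q \<notin> X) (concat (map blk (word D))) = concat (map (\<lambda>p. [p]) (word D))"
    using assms(1) by (simp add: filter_concat comp_def cong: map_cong)
  then have "filter (\<lambda>q. fst q \<notin> X) (concat (map blk (word D))) = word D" by (simp only: concat_map_single)
  moreover have "pos D \<union> N - X = pos D" using assms(2,3) by blast
  ultimately show ?thesis unfolding delete_def expand_def by (cases D) simp
qed

definition sg :: "bool \<Rightarrow> (nat \<Rightarrow> int) \<Rightarrow> (nat \<Rightarrow> int)" where
  "sg b f = (if b then f else - f)"

lemma supp_sg [simp]: "supp (sg b f) = supp f"
  unfolding sg_def by simp

context knot_parity
begin

lemma val_sg_gen:
  assumes "D \<in> K" "v \<in> crossings D"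
  shows "val D (sg b (gen v)) = P D v [^]\<^bsub>G D\<^esub> (if b then 1 else -1 :: int)"
proof -
  interpret comm_group "G D" using group assms by blast
  have "P D v \<in> carrier (G D)" using assms parity_closed by blast
  then show ?thesis unfolding sg_def using assms by (simp add: val_minus val_gen int_pow_neg)
qed

lemma rel_triangle:
  assumes "D \<in> K" "is_move (Move D (R3 u v w) D')"
  shows "rel D (sg (incidence D u v w u = 1) (gen u) + sg (incidence D u v w v = 1) (gen v)
    + sg (incidence D u v w w = 1) (gen w))"
proof -
  have c: "u \<in> crossings D" "v \<in> crossings D" "w \<in> crossings D"
    using assms(2) by (simp_all add: is_move_def triangle_def)
  have pw: "P D c [^]\<^bsub>G D\<^esub> incidence D u v w c = val D (sg (incidence D u v w c = 1) (gen c))"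
    if "c \<in> crossings D" for c
    using val_sg_gen[OF assms(1) that, of "incidence D u v w c = 1"] by (auto simp: incidence_def)
  show ?thesis unfolding rel_def using P3[OF assms] c assms(1)
    by (simp add: pw val_add supp_add)
qed

text \<open>
  A finger \<open>z\<close> crosses both strands of \<open>v\<close>: it meets the strand of \<open>(v, b)\<close> in the pair \<open>x', x\<close> and the
  other one in the pair \<open>r', r\<close>; \<open>i\<close> and \<open>j\<close> tell on which side of \<open>v\<close> along the strand this
  happens.  A second move makes a pair \<open>w', w\<close> on the second strand, on the other side of \<open>v\<close>, such that
  \<open>x, w, v\<close> bound a triangle.  After the third move at this triangle, \<open>w\<close> and \<open>r'\<close> bound a bigon.
  Hence \<open>w\<close> has the parity of \<open>r\<close>, and the relation is (P3+) with \<open>w\<close> replaced by \<open>r\<close>.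
\<close>

lemma slide:
  assumes D: "D \<in> K" and lab: "distinct [v, x, x', r, r']"
    and z: "consecutive D [(x', True), (x, True), (r', True), (r, True)]"
    and I: "consecutive D (if i then [(x', False), (x, False), (v, b)] else [(v, b), (x, False), (x', False)])"
    and J: "consecutive D (if j then [(v, \<not> b), (r', False), (r, False)] else [(r, False), (r', False), (v, \<not> b)])"
    and sv: "v \<in> pos D \<longleftrightarrow> b = (i \<noteq> j)"
    and sx: "x \<in> pos D \<longleftrightarrow> i" and sr: "r \<in> pos D \<longleftrightarrow> j" "r' \<in> pos D \<longleftrightarrow> \<not> j"
  shows "rel D (sg i (gen x) - sg j (gen r) + sg (i \<noteq> j) (gen v))"
proof -
  have gD: "gauss_diagram D" using K_gauss D by blast
  have dD: "distinct (word D)" using gauss_distinct gD by blast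
  obtain w where w: "w \<notin> crossings D" using ex_new_if_finite[OF infinite_UNIV_nat finite_crossings] by blast
  obtain w' where w': "w' \<notin> insert w (crossings D)"
    using ex_new_if_finite[OF infinite_UNIV_nat, of "insert w (crossings D)"] by auto
  have inz: "(x', True) \<in> set (word D)" "(x, True) \<in> set (word D)" "(r', True) \<in> set (word D)" "(r, True) \<in> set (word D)"
    using consecutive_in[OF dD z] by auto
  have inJ: "(v, \<not> b) \<in> set (word D)" using consecutive_in[OF dD J] by (auto split: if_splits)
  have cr: "x' \<in> crossings D" "x \<in> crossings D" "r' \<in> crossings D" "r \<in> crossings D" "v \<in> crossings D"
    using inz inJ by (auto simp: gauss_partner[OF gD])
  have ww: "w \<noteq> w'" "w \<notin> {x,x',r,r',v}" "w' \<notin> {x,x',r,r',v}" using w w' cr by auto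
  then have wv: "x \<noteq> w" "x \<noteq> w'" "v \<noteq> w" "v \<noteq> w'" by auto
  \<comment> \<open>The second move: its upper strand is inserted between \<open>x'\<close> and \<open>x\<close> on the finger, its lower
    strand next to \<open>v\<close>.\<close>
  define blk where "blk p = (if p = (x, True) then [(w', True), (w, True), p]
     else if p = (v, \<not> b) then (if j then [(w', False), (w, False), p] else [p, (w, False), (w', False)]) else [p])" for p
  define E where "E = expand blk {if j then w else w'} D"
  have fresh: "fst p \<noteq> w \<and> fst p \<noteq> w'" if "p \<in> set (word D)" for p
    using that w w' unfolding crossings_def by blast
  have delE: "delete {w', w} E = D"
    unfolding E_def
  proof (rule delete_expand)
    fix p assume "p \<in> set (word D)"
    then have "fst p \<noteq> w" "fst p \<noteq> w'" using fresh by blast+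
    then show "filter (\<lambda>q. fst q \<notin> {w', w}) (blk p) = [p]" using ww(1) wv by (simp add: blk_def)
  next
    have "pos D \<subseteq> crossings D" using gD by (simp add: gauss_diagram_def)
    then show "pos D \<inter> {w', w} = {}" using w w' by auto
  qed auto
  have dE: "distinct (word E)"
    unfolding E_def expand_def diagram.sel
  proof (rule distinct_concat_map[OF dD])
    fix p assume "p \<in> set (word D)"
    then have "fst p \<noteq> w" "fst p \<noteq> w'" using fresh by blast+
    then show "distinct (blk p)" using ww(1) by (auto simp: blk_def)
  next
    fix p q assume "p \<in> set (word D)" "q \<in> set (word D)" "p \<noteq> q"
    then have "p \<noteq> q" "\<And>c. p \<noteq> (w, c) \<and> p \<noteq> (w', c) \<and> q \<noteq> (w, c) \<and> q \<noteq> (w', c)" using fresh by force+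
    then show "set (blk p) \<inter> set (blk q) = {}" using lab ww(1) wv by (auto simp: blk_def)
  qed
  have setE: "set (word E) = set (word D) \<union> {w, w'} \<times> UNIV"
  proof -
    have b1: "set (blk p) \<subseteq> insert p ({w, w'} \<times> UNIV)" and b2: "p \<in> set (blk p)" for p
      unfolding blk_def by auto
    have E: "set (word E) = (\<Union>p\<in>set (word D). set (blk p))" unfolding E_def expand_def by simp
    have "blk (x, True) = [(w', True), (w, True), (x, True)]" by (simp add: blk_def)
    then have T: "(w, True) \<in> set (word E)" "(w', True) \<in> set (word E)"
      unfolding E by (auto intro!: bexI[OF _ inz(2)])
    have "(w, False) \<in> set (blk (v, \<not> b))" "(w', False) \<in> set (blk (v, \<not> b))"
      using lab by (simp_all add: blk_def)
    then have F: "(w, False) \<in> set (word E)" "(w', False) \<in> set (word E)"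
      unfolding E by (auto intro!: bexI[OF _ inJ])
    have "(w, c) \<in> set (word E)" "(w', c) \<in> set (word E)" for c
      using T F by (cases c; simp)+
    moreover have "set (word D) \<subseteq> set (word E)" unfolding E using b2 by blast
    ultimately have "set (word D) \<union> {w, w'} \<times> UNIV \<subseteq> set (word E)" by blast
    moreover have "set (word E) \<subseteq> set (word D) \<union> {w, w'} \<times> UNIV" unfolding E using b1 by blast
    ultimately show ?thesis by (rule subset_antisym[rotated])
  qed
  have posE: "pos E = insert (if j then w else w') (pos D)" unfolding E_def expand_def by simp
  have crE: "crossings E = crossings D \<union> {w, w'}" unfolding crossings_def setE by force
  have gE: "gauss_diagram E"
    using gD dE unfolding gauss_diagram_def posE crE unfolding setE by (auto simp: crossings_def)
  have cE: "consecutive E (concat (map blk ps))" if "consecutive D ps" for ps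
    using consecutive_expand[OF dD _ that] dE unfolding E_def by blast
  have zE: "consecutive E [(x',True),(w',True),(w,True),(x,True),(r',True),(r,True)]"
    using cE[OF z] lab by (auto simp: blk_def)
  have iE1: "i \<Longrightarrow> consecutive E [(x', False), (x, False), (v, b)]"
   and iE2: "\<not> i \<Longrightarrow> consecutive E [(v, b), (x, False), (x', False)]"
    using cE[OF I] lab by (auto simp: blk_def)
  have jE1: "j \<Longrightarrow> consecutive E [(w', False), (w, False), (v, \<not> b), (r', False), (r, False)]"
   and jE2: "\<not> j \<Longrightarrow> consecutive E [(r, False), (r', False), (v, \<not> b), (w, False), (w', False)]"
    using cE[OF J] lab by (auto simp: blk_def)
  have sub: "consecutive E ps" if "consecutive E qs" "sublist ps qs" for ps qs
    using that consecutive_mid[OF dE] unfolding sublist_def by blast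
  have bigE: "bigon E w' w"
  proof -
    have "w' \<notin> pos D" "w \<notin> pos D" using w w' gD by (auto simp: gauss_diagram_def)
    moreover have "consecutive E [(w',True),(w,True)]" by (rule sub[OF zE]) (auto simp: sublist_code)
    moreover have "j \<Longrightarrow> consecutive E [(w',False),(w,False)]" using sub[OF jE1] by (auto simp: sublist_code)
    moreover have "\<not> j \<Longrightarrow> consecutive E [(w,False),(w',False)]" using sub[OF jE2] by (auto simp: sublist_code)
    ultimately show ?thesis unfolding bigon_def posE using ww(1) by (cases j) auto
  qed
  have red: "reduces E D" using reduces.bigon[OF reduces.stop bigE] delE by simp
  have EK: "E \<in> K" using reduces_K[OF red gE] D by simp
  \<comment> \<open>The finger is the top strand of the triangle.  The middle strand is the overpass at \<open>v\<close>; the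
    finger meets it at \<open>x\<close> if this is the strand of \<open>(v, b)\<close> with \<open>b = True\<close>, and at \<open>w\<close> otherwise.\<close>
  define u where "u = (if b then x else w)"
  define t where "t = (if b then w else x)"
  define s where "s = side_swap u t v"
  have s: "s (x, True) = (w, True)" "s (w, True) = (x, True)" "s (x, False) = (v, b)" "s (v, b) = (x, False)"
    "s (w, False) = (v, \<not> b)" "s (v, \<not> b) = (w, False)"
    using lab ww unfolding s_def u_def t_def side_swap_def transpose_def by (auto split: if_splits)
  have s_other: "s p = p" if "fst p \<notin> {x, w, v}" for p
    using that unfolding s_def u_def t_def side_swap_def transpose_def by (auto split: if_splits)
  have six: "p \<in> {(x, True), (x, False), (w, True), (w, False), (v, b), (v, \<not> b)}"
    if "fst p \<in> {x, w, v}" for p :: point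
    using that by (cases p; cases b; cases "snd p") auto
  have uset: "{u, t, v} = {x, w, v}" unfolding u_def t_def by auto
  have l2: "2 \<le> length (word E)" using length_ge2[OF gE] setE by (cases "word E") auto
  have nx: "next_point E p = q" if "consecutive E qs" "sublist [p, q] qs" for p q qs
    using next_pointI[OF dE] sub[OF that] by blast
  have sides: "Some p \<in> sides E u t v \<longleftrightarrow> fst p \<in> {x, w, v} \<and> next_point E p = s p" for p
    unfolding sides_def s_def[symmetric] uset by (cases p) auto
  have nwT: "next_point E (w, True) = (x, True)" "next_point E (x, True) = (r', True)"
    using nx[OF zE] by (auto simp: sublist_code)
  have sw: "Some (w, True) \<in> sides E u t v" "Some (x, True) \<notin> sides E u t v"
    unfolding sides s nwT using ww by auto
  have not_next: "next_point E q \<noteq> p" if "consecutive E qs" "sublist [p', p] qs" "q \<noteq> p'" "q \<in> set (word E)" for p p' q qs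
    using consecutive_unique_prev[OF dE sub[OF that(1,2)]] consecutive_next[OF dE that(4) l2] that(3) by metis
  have inE: "(v, c) \<in> set (word E)" for c using cr(5) by (simp add: gauss_partner[OF gE] crE)
  have si: "Some (x, False) \<in> sides E u t v \<longleftrightarrow> i" "Some (v, b) \<in> sides E u t v \<longleftrightarrow> \<not> i"
  proof -
    have "i \<Longrightarrow> next_point E (x, False) = (v, b)" using nx[OF iE1] by (auto simp: sublist_code)
    moreover have "\<not> i \<Longrightarrow> next_point E (x, False) = (x', False)" using nx[OF iE2] by (auto simp: sublist_code)
    ultimately show "Some (x, False) \<in> sides E u t v \<longleftrightarrow> i" unfolding sides s using lab by (cases i) auto
    have "i \<Longrightarrow> next_point E (v, b) \<noteq> (x, False)"
      using not_next[OF iE1, of "(x', False)" "(x, False)" "(v, b)"] inE lab by (auto simp: sublist_code)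
    moreover have "\<not> i \<Longrightarrow> next_point E (v, b) = (x, False)" using nx[OF iE2] by (auto simp: sublist_code)
    ultimately show "Some (v, b) \<in> sides E u t v \<longleftrightarrow> \<not> i" unfolding sides s by (cases i) auto
  qed
  have sj: "Some (w, False) \<in> sides E u t v \<longleftrightarrow> j" "Some (v, \<not> b) \<in> sides E u t v \<longleftrightarrow> \<not> j"
  proof -
    have "j \<Longrightarrow> next_point E (w, False) = (v, \<not> b)" using nx[OF jE1] by (auto simp: sublist_code)
    moreover have "\<not> j \<Longrightarrow> next_point E (w, False) = (w', False)" using nx[OF jE2] by (auto simp: sublist_code)
    ultimately show "Some (w, False) \<in> sides E u t v \<longleftrightarrow> j" unfolding sides s using ww by (cases j) auto
    have "j \<Longrightarrow> next_point E (v, \<not> b) = (r', False)" using nx[OF jE1] by (auto simp: sublist_code)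
    moreover have "\<not> j \<Longrightarrow> next_point E (v, \<not> b) = (w, False)" using nx[OF jE2] by (auto simp: sublist_code)
    ultimately show "Some (v, \<not> b) \<in> sides E u t v \<longleftrightarrow> \<not> j" unfolding sides s using ww by (cases j) auto
  qed
  have inc: "incidence E u t v x = (if i then 1 else -1)" "incidence E u t v w = (if j then -1 else 1)"
    "incidence E u t v v = (if i \<noteq> j then 1 else -1)"
  proof -
    show "incidence E u t v x = (if i then 1 else -1)" unfolding incidence_def using sw si by auto
    show "incidence E u t v w = (if j then -1 else 1)" unfolding incidence_def using sw sj by auto
    have "(Some (v, True) \<in> sides E u t v) \<noteq> (Some (v, False) \<in> sides E u t v) \<longleftrightarrow>
      (Some (v, b) \<in> sides E u t v) \<noteq> (Some (v, \<not> b) \<in> sides E u t v)" by (cases b) auto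
    then show "incidence E u t v v = (if i \<noteq> j then 1 else -1)" unfolding incidence_def using si(2) sj(2) by auto
  qed
  have wr: "writhe E x = (if i then 1 else -1)" "writhe E w = (if j then 1 else -1)"
    "writhe E v = (if b = (i \<noteq> j) then 1 else -1)"
  proof -
    have "w \<notin> pos D" using w gD by (auto simp: gauss_diagram_def)
    then show "writhe E x = (if i then 1 else -1)" "writhe E w = (if j then 1 else -1)"
    "writhe E v = (if b = (i \<noteq> j) then 1 else -1)"
      unfolding writhe_def posE using sx sv ww by auto
  qed
  have tri: "triangle E u t v"
    unfolding triangle_def s_def[symmetric] uset
  proof (intro conjI allI impI)
    show "distinct [u, t, v]" using lab ww unfolding u_def t_def by auto
    show "{x, w, v} \<subseteq> crossings E" using cr crE by auto
  next
    fix p :: point assume p: "fst p \<in> {x, w, v}"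
    have "consecutive E [(w, True), (x, True)]" using sub[OF zE] by (auto simp: sublist_code)
    moreover have "i \<Longrightarrow> consecutive E [(x, False), (v, b)]" using sub[OF iE1] by (auto simp: sublist_code)
    moreover have "\<not> i \<Longrightarrow> consecutive E [(v, b), (x, False)]" using sub[OF iE2] by (auto simp: sublist_code)
    moreover have "j \<Longrightarrow> consecutive E [(w, False), (v, \<not> b)]" using sub[OF jE1] by (auto simp: sublist_code)
    moreover have "\<not> j \<Longrightarrow> consecutive E [(v, \<not> b), (w, False)]" using sub[OF jE2] by (auto simp: sublist_code)
    moreover note six[OF p]
    ultimately show "consecutive E [p, s p] \<or> consecutive E [s p, p]" using s by (cases i; cases j) auto
  next
    show "\<exists>\<kappa>\<in>{1, - 1}. writhe E u = \<kappa> * incidence E u t v u \<and> writhe E v = \<kappa> * incidence E u t v v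
        \<and> writhe E t = - \<kappa> * incidence E u t v t"
      by (rule bexI[of _ "if b then 1 else -1"]) (use inc wr in \<open>auto simp: u_def t_def\<close>)
  qed
  define F where "F = Diagram (map s (word E)) (pos E)"
  have ss: "s (s p) = p" for p :: point
  proof (cases "fst p \<in> {x, w, v}")
    case True
    then show ?thesis using six[of p] s by auto
  qed (use s_other in auto)
  have "inj s" using ss by (metis injI)
  then have injE: "inj_on s (set (word E))" by (rule inj_on_subset) simp
  have fsts: "fst (s p) \<in> {x, w, v}" if "fst p \<in> {x, w, v}" for p :: point
    using six[OF that] s by auto
  have "s p \<in> set (word E)" if "p \<in> set (word E)" for p
  proof (cases "fst p \<in> {x, w, v}")
    case True
    have "{x, w, v} \<subseteq> crossings E" using cr crE by auto
    then have "fst (s p) \<in> crossings E" using fsts[OF True] by blast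
    then show ?thesis using gauss_partner[OF gE, of "fst (s p)" "snd (s p)"] by simp
  qed (use s_other that in auto)
  then have "s ` set (word E) = set (word E)" using ss by (metis (no_types, lifting) image_eqI image_subsetI subsetI subset_antisym)
  then have setF: "set (word F) = set (word E)" unfolding F_def by simp
  have gF: "gauss_diagram F"
    using gE setF injE unfolding gauss_diagram_def crossings_def
    by (simp add: F_def distinct_map)
  have mv: "is_move (Move E (R3 u t v) F)" unfolding is_move_def using gE gF tri by (simp add: F_def s_def)
  have rT: "rel E (sg i (gen x) + sg (\<not> j) (gen w) + sg (i \<noteq> j) (gen v))"
  proof -
    have inc1: "incidence E u t v x = 1 \<longleftrightarrow> i" "incidence E u t v w = 1 \<longleftrightarrow> \<not> j"
      "incidence E u t v v = 1 \<longleftrightarrow> i \<noteq> j" by (simp_all add: inc)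
    have "sg (incidence E u t v u = 1) (gen u) + sg (incidence E u t v t = 1) (gen t)
      = sg (incidence E u t v x = 1) (gen x) + sg (incidence E u t v w = 1) (gen w)"
      by (cases b) (simp_all add: u_def t_def add.commute)
    then show ?thesis using rel_triangle[OF EK mv] by (simp only: inc1)
  qed
  have cF: "consecutive F (map s ps)" if "consecutive E ps" for ps
    unfolding F_def by (rule consecutive_map[OF dE injE that])
  have dF: "distinct (word F)" using gF gauss_distinct by blast
  have so: "s (r, c) = (r, c)" "s (r', c) = (r', c)" "s (x', c) = (x', c)" "s (w', c) = (w', c)" for c
    using s_other lab ww by auto
  have subF: "consecutive F ps" if "consecutive F qs" "sublist ps qs" for ps qs
    using that consecutive_mid[OF dF] unfolding sublist_def by blast
  \<comment> \<open>On the finger the move has interchanged \<open>x\<close> and \<open>w\<close>, on the other strand \<open>w\<close> and \<open>v\<close>.\<close>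
  have bigF: "bigon F w r'"
  proof -
    have "w \<notin> pos D" using w gD by (auto simp: gauss_diagram_def)
    moreover have "consecutive F [(w, True), (r', True)]"
      using subF[OF cF[OF zE], of "[(w, True), (r', True)]"] by (simp add: s so sublist_code)
    moreover have "j \<Longrightarrow> consecutive F [(w, False), (r', False)]"
      using subF[OF cF[OF jE1], of "[(w, False), (r', False)]"] by (simp add: s so sublist_code)
    moreover have "\<not> j \<Longrightarrow> consecutive F [(r', False), (w, False)]"
      using subF[OF cF[OF jE2], of "[(r', False), (w, False)]"] by (simp add: s so sublist_code)
    ultimately show ?thesis unfolding bigon_def using sr ww by (cases j) (auto simp: F_def posE)
  qed
  have FK: "F \<in> K" using K_move[OF mv] EK by simp
  have crF: "crossings F = crossings E" unfolding crossings_def setF ..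
  have "rel F (gen w + gen r')" using rel_bigon[OF FK bigF] .
  then have r1: "rel E (gen w + gen r')"
    using move_rel[OF mv, of "gen w + gen r'"] EK by (simp add: rel_def crF)
  have bigD: "bigon D r' r"
  proof -
    have "consecutive D [(r', True), (r, True)]" using consecutive_mid[OF dD, of "[(x',True),(x,True)]" _ "[]"] z by simp
    moreover have "j \<Longrightarrow> consecutive D [(r', False), (r, False)]"
      using consecutive_mid[OF dD, of "[(v,\<not>b)]" "[(r', False), (r, False)]" "[]"] J by simp
    moreover have "\<not> j \<Longrightarrow> consecutive D [(r, False), (r', False)]"
      using consecutive_mid[OF dD, of "[]" "[(r, False), (r', False)]" "[(v,\<not>b)]"] J by simp
    ultimately show ?thesis unfolding bigon_def using sr by (cases j) auto
  qed
  have r2: "rel E (gen r' + gen r)" using reduces_rel_up[OF red EK rel_bigon[OF D bigD]] .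
  \<comment> \<open>The pair \<open>r', r\<close> bounds a bigon as well.\<close>
  have r3: "rel E (gen w - gen r)" using rel_diff[OF EK r1 r2] by (simp add: algebra_simps)
  have "rel E (sg i (gen x) - sg j (gen r) + sg (i \<noteq> j) (gen v))"
  proof (cases j)
    case True
    then show ?thesis using rel_add[OF EK rT r3] by (simp add: sg_def algebra_simps)
  next
    case False
    then show ?thesis using rel_diff[OF EK rT r3] by (simp add: sg_def algebra_simps)
  qed
  then show ?thesis using reduces_rel[OF red EK] cr by (simp add: supp_add supp_diff)
qed

end

section \<open>Probes\<close>

text \<open>
  The crossings of a finger with the strand in one gap.  \<open>Probe t (a, p) n q\<close> lies after the point
  \<open>p\<close> if \<open>a\<close> holds and before it otherwise; \<open>t\<close> tells whether the two strands are parallel.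
\<close>

datatype probe = Probe (par: bool) (gap: "bool \<times> point") (neg: nat) (pst: nat)

definition over :: "probe \<Rightarrow> point list" where
  "over l = (if par l then [(neg l, True), (pst l, True)] else [(pst l, True), (neg l, True)])"

definition under :: "probe \<Rightarrow> point list" where
  "under l = [(neg l, False), (pst l, False)]"

text \<open>
  The understrands of the probes in one gap.  The order of the antiparallel ones is reversed because
  the overstrands of all probes follow each other in the order of \<open>L\<close>; in this way two neighbours of one
  type bound a bigon.
\<close>

definition at_gap :: "probe list \<Rightarrow> bool \<times> point \<Rightarrow> point list" where
  "at_gap L u = concat (map under (rev (filter (\<lambda>l. gap l = u \<and> \<not> par l) L)))
     @ concat (map under (filter (\<lambda>l. gap l = u \<and> par l) L))"

text \<open>The overstrands of all fingers are inserted before the base point \<open>z\<close>.\<close>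

definition block :: "point \<Rightarrow> probe list \<Rightarrow> point \<Rightarrow> point list" where
  "block z L p = (if p = z then concat (map over L) else []) @ at_gap L (False, p) @ p # at_gap L (True, p)"

definition labels :: "probe list \<Rightarrow> nat set" where
  "labels L = neg ` set L \<union> pst ` set L"

definition probed :: "diagram \<Rightarrow> point \<Rightarrow> probe list \<Rightarrow> diagram" where
  "probed D z L = expand (block z L) (pst ` set L) D"

definition proper :: "diagram \<Rightarrow> point \<Rightarrow> probe list \<Rightarrow> bool" where
  "proper D z L \<longleftrightarrow> gauss_diagram D \<and> z \<in> set (word D) \<and> distinct L
     \<and> inj_on neg (set L) \<and> inj_on pst (set L) \<and> neg ` set L \<inter> pst ` set L = {}
     \<and> labels L \<inter> crossings D = {} \<and> (\<forall>l\<in>set L. snd (gap l) \<in> set (word D))"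

lemma set_over: "set (over l) = {neg l, pst l} \<times> {True}"
  unfolding over_def by auto

lemma set_under: "set (under l) = {neg l, pst l} \<times> {False}"
  unfolding under_def by auto

lemma set_at_gap: "set (at_gap L u) = (\<Union>l\<in>{l \<in> set L. gap l = u}. {neg l, pst l} \<times> {False})"
  unfolding at_gap_def by (auto simp: set_under)

lemma proper_neq:
  assumes "proper D z L" "l \<in> set L" "l' \<in> set L"
  shows "neg l \<noteq> pst l'" "neg l = neg l' \<Longrightarrow> l = l'" "pst l = pst l' \<Longrightarrow> l = l'"
  using assms unfolding proper_def inj_on_def by blast+

lemma proper_pairs_disjoint:
  assumes "proper D z L" "l \<in> set L" "l' \<in> set L" "l \<noteq> l'"
  shows "{neg l, pst l} \<inter> {neg l', pst l'} = {}"
  using proper_neq[OF assms(1-3)] proper_neq[OF assms(1,3,2)] assms(4) by auto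

lemma proper_fresh:
  assumes "proper D z L" "l \<in> set L" "p \<in> set (word D)"
  shows "fst p \<noteq> neg l" "fst p \<noteq> pst l"
  using assms unfolding proper_def labels_def crossings_def by blast+

lemma proper_fresh_labels:
  assumes "proper D z L" "p \<in> set (word D)"
  shows "fst p \<notin> labels L"
  using assms unfolding proper_def crossings_def by blast

lemma distinct_at_gap:
  assumes "proper D z L" shows "distinct (at_gap L u)"
proof -
  have d: "distinct (concat (map under K))" if "distinct K" "set K \<subseteq> set L" for K
  proof (rule distinct_concat_map[OF that(1)])
    fix p assume "p \<in> set K"
    then show "distinct (under p)" using proper_neq(1)[OF assms, of p p] that(2) by (auto simp: under_def)
  next
    fix p q assume "p \<in> set K" "q \<in> set K" "p \<noteq> q"
    then show "set (under p) \<inter> set (under q) = {}"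
      using proper_pairs_disjoint[OF assms, of p q] that(2) unfolding set_under by blast
  qed
  have "False" if q: "q \<in> set (concat (map under (rev (filter (\<lambda>l. gap l = u \<and> \<not> par l) L))))"
      "q \<in> set (concat (map under (filter (\<lambda>l. gap l = u \<and> par l) L)))" for q
  proof -
    obtain l where l: "l \<in> set L" "\<not> par l" "q \<in> set (under l)" using q(1) by auto
    obtain l' where l': "l' \<in> set L" "par l'" "q \<in> set (under l')" using q(2) by auto
    have "l \<noteq> l'" using l l' by blast
    from proper_pairs_disjoint[OF assms l(1) l'(1) this] show False using l(3) l'(3) unfolding set_under by blast
  qed
  then have "set (concat (map under (rev (filter (\<lambda>l. gap l = u \<and> \<not> par l) L))))
      \<inter> set (concat (map under (filter (\<lambda>l. gap l = u \<and> par l) L))) = {}"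
    by blast
  moreover have "distinct L" using assms unfolding proper_def by blast
  ultimately show ?thesis unfolding at_gap_def distinct_append
    by (intro conjI d) auto
qed

lemma distinct_over:
  assumes "proper D z L" shows "distinct (concat (map over L))"
proof (rule distinct_concat_map)
  show "distinct L" using assms unfolding proper_def by blast
  fix p assume "p \<in> set L"
  then show "distinct (over p)" using proper_neq(1)[OF assms, of p p] by (auto simp: over_def)
next
  fix p q assume "p \<in> set L" "q \<in> set L" "p \<noteq> q"
  then show "set (over p) \<inter> set (over q) = {}"
    using proper_pairs_disjoint[OF assms, of p q] unfolding set_over by blast
qed

lemma set_block:
  "set (block z L p) = insert p ((if p = z then labels L \<times> {True} else {})
     \<union> (\<Union>l\<in>{l \<in> set L. snd (gap l) = p}. {neg l, pst l} \<times> {False}))"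
proof -
  have "set (concat (map over L)) = labels L \<times> {True}"
    by (auto simp: set_over labels_def)
  moreover have "{l \<in> set L. snd (gap l) = p} = {l \<in> set L. gap l = (False, p)} \<union> {l \<in> set L. gap l = (True, p)}"
    by (auto simp: prod_eq_iff)
  ultimately show ?thesis unfolding block_def by (auto simp: set_at_gap)
qed

lemma at_gap_disjoint:
  assumes "proper D z L" "u \<noteq> u'"
  shows "set (at_gap L u) \<inter> set (at_gap L u') = {}"
proof -
  have False if q: "q \<in> set (at_gap L u)" "q \<in> set (at_gap L u')" for q
  proof -
    obtain l where l: "l \<in> set L" "gap l = u" "fst q \<in> {neg l, pst l}" using q(1) unfolding set_at_gap by auto
    obtain l' where l': "l' \<in> set L" "gap l' = u'" "fst q \<in> {neg l', pst l'}" using q(2) unfolding set_at_gap by auto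
    have "l \<noteq> l'" using l l' assms(2) by blast
    from proper_pairs_disjoint[OF assms(1) l(1) l'(1) this] show False using l(3) l'(3) by blast
  qed
  then show ?thesis by blast
qed

lemma set_at_gap_labels: "set (at_gap L u) \<subseteq> labels L \<times> {False}"
  unfolding set_at_gap labels_def by auto

lemma set_over_labels: "set (concat (map over L)) = labels L \<times> {True}"
  by (auto simp: set_over labels_def)

lemma set_block_labels: "set (block z L p) \<subseteq> insert p (labels L \<times> UNIV)"
proof -
  have "set (at_gap L u) \<subseteq> labels L \<times> UNIV" for u using set_at_gap_labels[of L u] by blast
  moreover have "set (concat (map over L)) \<subseteq> labels L \<times> UNIV" unfolding set_over_labels by blast
  moreover have "set (block z L p) \<subseteq> set (concat (map over L)) \<union> set (at_gap L (False, p)) \<union> {p} \<union> set (at_gap L (True, p))"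
    unfolding block_def by auto
  ultimately show ?thesis by blast
qed

lemma distinct_block:
  assumes L: "proper D z L" and p: "p \<in> set (word D)"
  shows "distinct (block z L p)"
proof -
  have p: "p \<notin> labels L \<times> UNIV" using proper_fresh_labels[OF L p] by (cases p) auto
  then have "p \<notin> set (at_gap L u)" for u using set_at_gap_labels[of L u] by blast
  then have "distinct (at_gap L (False, p) @ p # at_gap L (True, p))"
    using distinct_at_gap[OF L] at_gap_disjoint[OF L, of "(False, p)" "(True, p)"] by simp
  moreover have "set (concat (map over L)) \<inter> set (at_gap L (False, p) @ p # at_gap L (True, p)) = {}"
    using p set_at_gap_labels[of L] unfolding set_over_labels by (fastforce simp del: split_paired_All)
  ultimately show ?thesis unfolding block_def
    using distinct_over[OF L] by (cases "p = z") simp_all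
qed

lemma set_probed:
  assumes "proper D z L"
  shows "set (word (probed D z L)) = set (word D) \<union> labels L \<times> UNIV"
proof -
  have w: "set (word (probed D z L)) = (\<Union>p\<in>set (word D). set (block z L p))"
    unfolding probed_def expand_def by auto
  have z: "z \<in> set (word D)" and g: "\<forall>l\<in>set L. snd (gap l) \<in> set (word D)" using assms unfolding proper_def by blast+
  have 1: "set (word (probed D z L)) \<subseteq> set (word D) \<union> labels L \<times> UNIV"
    unfolding w using set_block_labels by blast
  have "labels L \<times> {True} \<subseteq> set (block z L z)" unfolding set_block by auto
  then have T: "(c, True) \<in> set (word (probed D z L))" if "c \<in> labels L" for c using w z that by blast
  have F: "(c, False) \<in> set (word (probed D z L))" if c: "c \<in> labels L" for c
  proof -
    obtain l where l: "l \<in> set L" "c \<in> {neg l, pst l}" using c unfolding labels_def by blast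
    then have "(c, False) \<in> set (block z L (snd (gap l)))" unfolding set_block by auto
    then show ?thesis unfolding w using g l(1) by blast
  qed
  have "(c, b) \<in> set (word (probed D z L))" if "c \<in> labels L" for c b
    using T[OF that] F[OF that] by (cases b) auto
  then have 2: "labels L \<times> UNIV \<subseteq> set (word (probed D z L))" by auto
  have "p \<in> set (block z L p)" for p unfolding set_block by simp
  then have "set (word D) \<subseteq> set (word (probed D z L))" unfolding w by blast
  then show ?thesis using 1 2 by (intro subset_antisym Un_least)
qed

lemma crossings_probed: "proper D z L \<Longrightarrow> crossings (probed D z L) = crossings D \<union> labels L"
  unfolding crossings_def by (simp add: set_probed image_Un)

lemma gauss_probed:
  assumes L: "proper D z L" shows "gauss_diagram (probed D z L)"
proof -
  have D: "gauss_diagram D" using L unfolding proper_def by blast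
  have "distinct (word (probed D z L))" unfolding probed_def expand_def diagram.sel
  proof (rule distinct_concat_map[OF gauss_distinct[OF D]])
    fix p assume "p \<in> set (word D)"
    then show "distinct (block z L p)" using distinct_block[OF L] by blast
  next
    fix p q assume pq: "p \<in> set (word D)" "q \<in> set (word D)" "p \<noteq> q"
    have "(c, b) \<notin> set (block z L q)" if c: "(c, b) \<in> set (block z L p)" for c b
    proof -
      note ov = set_block_labels[of z L p] set_block_labels[of z L q]
      have npq: "p \<notin> labels L \<times> UNIV" "q \<notin> labels L \<times> UNIV"
        using proper_fresh_labels[OF L pq(1)] proper_fresh_labels[OF L pq(2)] by auto
      show ?thesis
      proof (cases "c \<in> labels L")
        case False
        then show ?thesis using ov c npq pq(3) by blast
      next
        case True
        show ?thesis
        proof (cases b)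
          case True
          then show ?thesis using c pq(3) npq \<open>c \<in> labels L\<close> unfolding set_block by (auto split: if_splits)
        next
          case False
          then obtain l where "l \<in> set L" "snd (gap l) = p" "c \<in> {neg l, pst l}"
            using c npq \<open>c \<in> labels L\<close> unfolding set_block by (auto split: if_splits)
          moreover have "l' \<in> set L \<Longrightarrow> snd (gap l') = q \<Longrightarrow> c \<notin> {neg l', pst l'}" for l'
            using proper_pairs_disjoint[OF L, of l l'] calculation pq(3) by blast
          ultimately show ?thesis using False npq \<open>c \<in> labels L\<close> unfolding set_block by (auto split: if_splits)
        qed
      qed
    qed
    then show "set (block z L p) \<inter> set (block z L q) = {}" by auto
  qed
  moreover have "pos (probed D z L) = pos D \<union> pst ` set L" unfolding probed_def expand_def by simp
  moreover have "\<forall>v b. (v, b) \<in> set (word (probed D z L)) \<longrightarrow> (v, \<not> b) \<in> set (word (probed D z L))"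
    using D unfolding set_probed[OF L] gauss_diagram_def by blast
  moreover have "pos D \<union> pst ` set L \<subseteq> crossings (probed D z L)"
    using D unfolding crossings_probed[OF L] gauss_diagram_def labels_def by blast
  ultimately show ?thesis unfolding gauss_diagram_def by simp
qed

lemma pos_probed:
  assumes "proper D z L" "l \<in> set L"
  shows "neg l \<notin> pos (probed D z L)" "pst l \<in> pos (probed D z L)"
    "v \<in> crossings D \<Longrightarrow> v \<in> pos (probed D z L) \<longleftrightarrow> v \<in> pos D"
proof -
  have p: "pos (probed D z L) = pos D \<union> pst ` set L" unfolding probed_def expand_def by simp
  have "neg l \<notin> crossings D" "pos D \<subseteq> crossings D" "labels L \<inter> crossings D = {}"
    using assms unfolding proper_def labels_def gauss_diagram_def by auto
  then show "neg l \<notin> pos (probed D z L)" "pst l \<in> pos (probed D z L)"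
    "v \<in> crossings D \<Longrightarrow> v \<in> pos (probed D z L) \<longleftrightarrow> v \<in> pos D"
    using proper_neq(1)[OF assms(1,2)] assms(2) unfolding p labels_def by blast+
qed

lemma consecutive_probed:
  assumes "proper D z L" "consecutive D ps"
  shows "consecutive (probed D z L) (concat (map (block z L) ps))"
  using consecutive_expand assms gauss_distinct gauss_probed[OF assms(1)] unfolding probed_def proper_def by blast

lemma sublist_concat: "l \<in> set L \<Longrightarrow> sublist (f l) (concat (map f L))"
  by (metis (no_types, lifting) concat.simps(2) concat_append list.simps(9) map_append split_list sublist_appendI)

lemma consecutive_over:
  assumes "proper D z L"
  shows "consecutive (probed D z L) (concat (map over L))"
proof -
  have "consecutive D [z]" using assms consecutive_single unfolding proper_def by blast
  from consecutive_probed[OF assms this]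
  have "consecutive (probed D z L) (concat (map over L) @ at_gap L (False, z) @ z # at_gap L (True, z))"
    by (simp add: block_def)
  then show ?thesis using consecutive_mid[OF gauss_distinct[OF gauss_probed[OF assms]], of "[]"] by simp
qed

lemma consecutive_at_gap:
  assumes "proper D z L" "p \<in> set (word D)"
  shows "consecutive (probed D z L) (at_gap L (False, p) @ [p] @ at_gap L (True, p))"
  using consecutive_probed[OF assms(1) consecutive_single[OF assms(2)]]
    consecutive_mid[OF gauss_distinct[OF gauss_probed[OF assms(1)]], of _ "at_gap L (False, p) @ [p] @ at_gap L (True, p)" "[]"]
  by (simp add: block_def)

lemma bigon_probe:
  assumes "proper D z L" "l \<in> set L"
  shows "if par l then bigon (probed D z L) (neg l) (pst l) else bigon (probed D z L) (pst l) (neg l)"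
proof -
  note d = gauss_distinct[OF gauss_probed[OF assms(1)]]
  have 1: "consecutive (probed D z L) (over l)"
    using consecutive_sublist[OF d consecutive_over[OF assms(1)] sublist_concat[OF assms(2)]] .
  have "sublist (under l) (at_gap L (gap l))"
  proof (cases "par l")
    case True
    then have "sublist (under l) (concat (map under (filter (\<lambda>k. gap k = gap l \<and> par k) L)))"
      using assms(2) by (intro sublist_concat) auto
    then show ?thesis unfolding at_gap_def sublist_append by blast
  next
    case False
    then have "sublist (under l) (concat (map under (rev (filter (\<lambda>k. gap k = gap l \<and> \<not> par k) L))))"
      using assms(2) by (intro sublist_concat) auto
    then show ?thesis unfolding at_gap_def sublist_append by blast
  qed
  moreover obtain s p where g: "gap l = (s, p)" by (cases "gap l")
  moreover have "p \<in> set (word D)" using assms g unfolding proper_def by auto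
  note c = consecutive_at_gap[OF assms(1) this]
  have "consecutive (probed D z L) (at_gap L (s, p))"
    by (cases s) (use consecutive_mid[OF d, of "[]" "at_gap L (False, p)"]
      consecutive_mid[OF d, of "at_gap L (False, p) @ [p]" "at_gap L (True, p)" "[]"] c in auto)
  ultimately have 2: "consecutive (probed D z L) (under l)" using consecutive_sublist[OF d] by simp
  have "neg l \<notin> pos (probed D z L)" "pst l \<in> pos (probed D z L)" using pos_probed[OF assms] by auto
  then show ?thesis using 1 2 unfolding over_def under_def bigon_def by (auto split: if_splits)
qed

lemma filter_concat_map:
  assumes "\<And>l. l \<in> set L \<Longrightarrow> filter Q (f l) = (if R l then f l else [])"
  shows "filter Q (concat (map f L)) = concat (map f (filter R L))"
  using assms by (induction L) auto

lemma proper_filter: "proper D z L \<Longrightarrow> proper D z (filter R L)"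
  unfolding proper_def labels_def by (auto intro: inj_on_subset)

lemma delete_probes:
  assumes L: "proper D z L"
  shows "delete (labels (filter (\<lambda>l. \<not> R l) L)) (probed D z L) = probed D z (filter R L)"
proof -
  let ?X = "labels (filter (\<lambda>l. \<not> R l) L)"
  let ?Q = "\<lambda>p. fst p \<notin> ?X"
  have X: "neg l \<in> ?X \<longleftrightarrow> \<not> R l" "pst l \<in> ?X \<longleftrightarrow> \<not> R l" if "l \<in> set L" for l
  proof -
    have "\<not> R l \<Longrightarrow> neg l \<in> ?X \<and> pst l \<in> ?X" using that unfolding labels_def by auto
    moreover have False if R: "R l" and X: "c \<in> ?X" "c \<in> {neg l, pst l}" for c
    proof -
      obtain l' where l': "l' \<in> set L" "\<not> R l'" "c \<in> {neg l', pst l'}" using X(1) unfolding labels_def by auto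
      have "l \<noteq> l'" using R l' by blast
      from proper_pairs_disjoint[OF L \<open>l \<in> set L\<close> l'(1) this] show False using X(2) l'(3) by blast
    qed
    ultimately show "neg l \<in> ?X \<longleftrightarrow> \<not> R l" "pst l \<in> ?X \<longleftrightarrow> \<not> R l" by blast+
  qed
  have o: "filter ?Q (over l) = (if R l then over l else [])" if "l \<in> set L" for l
    unfolding over_def using X[OF that] by simp
  have u: "filter ?Q (under l) = (if R l then under l else [])" if "l \<in> set L" for l
    unfolding under_def using X[OF that] by simp
  have ov: "filter ?Q (concat (map over L)) = concat (map over (filter R L))"
    by (rule filter_concat_map) (rule o)
  have f1: "filter R (rev (filter (\<lambda>l. gap l = g \<and> \<not> par l) L)) = rev (filter (\<lambda>l. gap l = g \<and> \<not> par l) (filter R L))"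
    and f2: "filter R (filter (\<lambda>l. gap l = g \<and> par l) L) = filter (\<lambda>l. gap l = g \<and> par l) (filter R L)" for g
    by (simp_all add: rev_filter conj_ac)
  have ag: "filter ?Q (at_gap L g) = at_gap (filter R L) g" for g
    unfolding at_gap_def filter_append
    by (subst (1 2) filter_concat_map[where R = R]) (use u in \<open>auto simp only: f1 f2 set_rev set_filter\<close>)
  have "filter ?Q (block z L p) = block z (filter R L) p" if "p \<in> set (word D)" for p
  proof -
    have "?Q p" using proper_fresh[OF L _ that] unfolding labels_def by fastforce
    then show ?thesis unfolding block_def by (simp add: ov ag)
  qed
  then have "filter ?Q (concat (map (block z L) (word D))) = concat (map (block z (filter R L)) (word D))"
    by (simp add: filter_concat comp_def cong: map_cong)
  moreover have "pos D \<union> pst ` set L - ?X = pos D \<union> pst ` set (filter R L)"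
  proof -
    have "pos D \<inter> ?X = {}" using L unfolding proper_def gauss_diagram_def labels_def by auto
    moreover have "pst ` set L - ?X = pst ` set (filter R L)" using X(2) by auto
    ultimately show ?thesis by blast
  qed
  ultimately show ?thesis unfolding probed_def expand_def delete_def by simp
qed

lemma probed_Nil: "probed D z [] = D"
proof -
  have "concat (map (block z []) ws) = ws" for ws
    by (induction ws) (simp_all add: block_def at_gap_def)
  then show ?thesis unfolding probed_def expand_def by simp
qed

lemma reduces_probes:
  assumes L: "proper D z L"
  shows "reduces (probed D z L) (probed D z (filter R L))"
proof -
  let ?I = "set (filter (\<lambda>l. \<not> R l) L)"
  let ?f = "\<lambda>l. if par l then neg l else pst l" and ?g = "\<lambda>l. if par l then pst l else neg l"
  have "reduces (probed D z L) (delete (?f ` ?I \<union> ?g ` ?I) (probed D z L))"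
  proof (rule reduces_bigons)
    show "bigon (probed D z L) (?f l) (?g l)" if "l \<in> ?I" for l
      using bigon_probe[OF L, of l] that by (auto split: if_splits)
    show "{?f l, ?g l} \<inter> {?f k, ?g k} = {}" if "l \<in> ?I" "k \<in> ?I" "l \<noteq> k" for l k
      using proper_pairs_disjoint[OF L, of l k] that by auto
  qed (use gauss_probed[OF L] in auto)
  moreover have "?f ` ?I \<union> ?g ` ?I = labels (filter (\<lambda>l. \<not> R l) L)" unfolding labels_def by (auto split: if_splits)
  ultimately show ?thesis using delete_probes[OF L] by simp
qed

lemma reduces_probed: "proper D z L \<Longrightarrow> reduces (probed D z L) D"
  using reduces_probes[of D z L "\<lambda>_. False"] by (simp add: probed_Nil)

section \<open>Relations between probes\<close>

lemma at_gap_pair: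
  "at_gap [l1, l2] u =
    (if gap l2 = u \<and> \<not> par l2 then under l2 else []) @ (if gap l1 = u \<and> \<not> par l1 then under l1 else [])
    @ (if gap l1 = u \<and> par l1 then under l1 else []) @ (if gap l2 = u \<and> par l2 then under l2 else [])"
  unfolding at_gap_def by simp

lemma filter_eq_single: "distinct L \<Longrightarrow> x \<in> set L \<Longrightarrow> filter (\<lambda>l. l = x) L = [x]"
proof (induction L)
  case (Cons a L)
  then show ?case by (cases "a = x") (auto simp: filter_empty_conv)
qed simp

lemma filter_pair:
  assumes "distinct (L1 @ L2)" "x \<in> set L1" "y \<in> set L2"
  shows "filter (\<lambda>l. l = x \<or> l = y) (L1 @ L2) = [x, y]"
proof -
  have "filter (\<lambda>l. l = x \<or> l = y) L1 = filter (\<lambda>l. l = x) L1" using assms by (intro filter_cong) auto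
  moreover have "filter (\<lambda>l. l = x \<or> l = y) L2 = filter (\<lambda>l. l = y) L2" using assms by (intro filter_cong) auto
  moreover have "filter (\<lambda>l. l = x) L1 = [x]" "filter (\<lambda>l. l = y) L2 = [y]"
    using filter_eq_single assms by (metis distinct_append)+
  ultimately show ?thesis by simp
qed

context knot_parity
begin

lemma rel_trans: "D \<in> K \<Longrightarrow> rel D (f - g) \<Longrightarrow> rel D (g - h) \<Longrightarrow> rel D (f - h)"
  using rel_add[of D "f - g" "g - h"] by simp

lemma rel_sym: "D \<in> K \<Longrightarrow> rel D (f - g) \<Longrightarrow> rel D (g - f)"
  using rel_minus[of D "f - g"] by simp

lemma rel_bigon_swap: "D \<in> K \<Longrightarrow> bigon D y x \<Longrightarrow> rel D (gen x + gen y)"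
  using rel_bigon[of D y x] by (simp add: add.commute)

lemma probed_K: "proper D z L \<Longrightarrow> D \<in> K \<Longrightarrow> probed D z L \<in> K"
  using reduces_K[OF reduces_probed gauss_probed] by blast

lemma rel_probe:
  assumes "D \<in> K" "proper D z L" "l \<in> set L"
  shows "rel (probed D z L) (gen (neg l) + gen (pst l))"
proof (cases "par l")
  case True
  then show ?thesis using bigon_probe[OF assms(2,3)] rel_bigon[OF probed_K[OF assms(2,1)]] by simp
next
  case False
  then show ?thesis using bigon_probe[OF assms(2,3)] rel_bigon_swap[OF probed_K[OF assms(2,1)]] by simp
qed

text \<open>
  Let both probes be parallel.  Then \<open>pst l1\<close> and \<open>neg l2\<close> follow each other on both strands and
  have opposite signs, so they bound a bigon, and so do \<open>neg l1\<close> and \<open>pst l1\<close>.  Hence \<open>neg l1\<close> and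
  \<open>neg l2\<close> both have the opposite of the parity of \<open>pst l1\<close>.  The antiparallel case is similar.  The probes
  may become neighbours only after the crossings in \<open>X\<close> have been removed.
\<close>

lemma adjacent_probes:
  assumes D: "D \<in> K" and L: "proper D z [l1, l2]" and t: "par l1 = par l2"
    and red: "reduces (probed D z [l1, l2]) (delete X (probed D z [l1, l2]))"
    and X: "labels [l1, l2] \<inter> X = {}"
    and adj: "consecutive (delete X (probed D z [l1, l2])) (if par l1 then under l1 @ under l2 else under l2 @ under l1)"
  shows "rel (probed D z [l1, l2]) (gen (neg l1) - gen (neg l2))"
proof -
  let ?Q = "probed D z [l1, l2]" and ?R = "delete X (probed D z [l1, l2])"
  have Q: "?Q \<in> K" using probed_K L D by blast
  have gR: "gauss_diagram ?R" using gauss_delete gauss_probed L by blast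
  then have R: "?R \<in> K" using reduces_K red Q gauss_probed[OF L] by blast
  note d = gauss_distinct[OF gR]
  have "filter (\<lambda>p. fst p \<notin> X) (over l1 @ over l2) = over l1 @ over l2"
    using X by (auto simp: over_def labels_def)
  then have ov: "consecutive ?R (over l1 @ over l2)"
    using consecutive_delete[OF gauss_distinct[OF gauss_probed[OF L]] consecutive_over[OF L], of X] by simp
  have sgn: "neg l1 \<notin> pos ?R" "pst l1 \<in> pos ?R" "neg l2 \<notin> pos ?R" "pst l2 \<in> pos ?R"
    using pos_probed[OF L, of l1] pos_probed[OF L, of l2] X by (auto simp: labels_def)
  have b1: "rel ?R (gen (neg l1) + gen (pst l1))"
  proof (cases "par l1")
    case True
    have "bigon ?R (neg l1) (pst l1)" unfolding bigon_def
      using sgn consecutive_mid[OF d, of "[]" "over l1" "over l2"] consecutive_mid[OF d, of "[]" "under l1" "under l2"]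
        ov adj True by (auto simp: over_def under_def)
    then show ?thesis using rel_bigon R by blast
  next
    case False
    have "bigon ?R (pst l1) (neg l1)" unfolding bigon_def
      using sgn consecutive_mid[OF d, of "[]" "over l1" "over l2"] consecutive_mid[OF d, of "under l2" "under l1" "[]"]
        ov adj False by (auto simp: over_def under_def)
    then show ?thesis by (rule rel_bigon_swap[OF R])
  qed
  have b2: "rel ?R (gen (pst l1) + gen (neg l2))"
  proof (cases "par l1")
    case True
    have "bigon ?R (pst l1) (neg l2)" unfolding bigon_def
      using sgn consecutive_mid[OF d, of "[(neg l1, True)]" "[(pst l1, True), (neg l2, True)]" "[(pst l2, True)]"]
        consecutive_mid[OF d, of "[(neg l1, False)]" "[(pst l1, False), (neg l2, False)]" "[(pst l2, False)]"]
        ov adj True t by (auto simp: over_def under_def)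
    then show ?thesis using rel_bigon R by blast
  next
    case False
    have "bigon ?R (neg l1) (pst l2)" unfolding bigon_def
      using sgn consecutive_mid[OF d, of "[(pst l1, True)]" "[(neg l1, True), (pst l2, True)]" "[(neg l2, True)]"]
        consecutive_mid[OF d, of "[(neg l2, False)]" "[(pst l2, False), (neg l1, False)]" "[(pst l1, False)]"]
        ov adj False t by (auto simp: over_def under_def)
    then have a: "rel ?R (gen (neg l1) + gen (pst l2))" using rel_bigon R by blast
    have "bigon ?R (pst l2) (neg l2)" unfolding bigon_def
      using sgn consecutive_mid[OF d, of "over l1" "over l2" "[]"] consecutive_mid[OF d, of "[]" "under l2" "under l1"]
        ov adj False t by (auto simp: over_def under_def)
    then have "rel ?R (gen (pst l2) + gen (neg l2))" using rel_bigon R by blast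
    from rel_add[OF R rel_diff[OF R b1 a] this] show ?thesis by (simp add: algebra_simps)
  qed
  have "rel ?R (gen (neg l1) - gen (neg l2))" using rel_diff[OF R b1 b2] by (simp add: algebra_simps)
  then show ?thesis using reduces_rel_up[OF red Q] by blast
qed

lemma same_gap:
  assumes D: "D \<in> K" and L: "proper D z [l1, l2]" and t: "par l1 = par l2" and g: "gap l1 = gap l2"
  shows "rel (probed D z [l1, l2]) (gen (neg l1) - gen (neg l2))"
proof (rule adjacent_probes[OF D L t, of "{}"])
  obtain s p where u: "gap l1 = (s, p)" by (cases "gap l1")
  have "p \<in> set (word D)" using L u unfolding proper_def by auto
  from consecutive_at_gap[OF L this]
  have "consecutive (probed D z [l1, l2]) (at_gap [l1, l2] (s, p))"
    using consecutive_mid[OF gauss_distinct[OF gauss_probed[OF L]], of "[]" "at_gap [l1,l2] (False, p)"]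
     consecutive_mid[OF gauss_distinct[OF gauss_probed[OF L]], of "at_gap [l1,l2] (False, p) @ [p]" "at_gap [l1,l2] (True, p)" "[]"]
    by (cases s) auto
  then show "consecutive (delete {} (probed D z [l1, l2])) (if par l1 then under l1 @ under l2 else under l2 @ under l1)"
    using g t u by (auto simp: at_gap_pair)
qed (auto intro: reduces.stop)

text \<open>
  The finger slides across \<open>v\<close>.  The type of a probe decides which of its crossings is next
  to \<open>v\<close>; as \<open>slide\<close> speaks of that one, \<open>rel_probe\<close> is used to pass to the negative crossing.
  With \<open>i\<close> and \<open>j\<close> chosen freely, the sign condition is always met by one of the two values of \<open>b\<close>.
\<close>

lemma crossing_relation:
  assumes D: "D \<in> K" and L: "proper D z [l1, l2]" and v: "v \<in> crossings D"
    and p: "par l1 = i" "par l2 = j"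
    and g: "gap l1 = (\<not> i, (v, b))" "gap l2 = (j, (v, \<not> b))"
    and s: "v \<in> pos D \<longleftrightarrow> b = (i \<noteq> j)"
  shows "rel (probed D z [l1, l2]) (gen (neg l1) - gen (neg l2) - sg (i \<noteq> j) (gen v))"
proof -
  let ?Q = "probed D z [l1, l2]"
  define x where "x = (if i then pst l1 else neg l1)"
  define x' where "x' = (if i then neg l1 else pst l1)"
  define r where "r = (if j then pst l2 else neg l2)"
  define r' where "r' = (if j then neg l2 else pst l2)"
  have Q: "?Q \<in> K" using probed_K L D by blast
  have gD: "gauss_diagram D" using D K_gauss by blast
  note d = gauss_distinct[OF gauss_probed[OF L]]
  have l12: "neg l1 \<noteq> pst l1" "neg l2 \<noteq> pst l2" "{neg l1, pst l1} \<inter> {neg l2, pst l2} = {}" "v \<notin> {neg l1, pst l1, neg l2, pst l2}"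
    using proper_neq(1)[OF L, of l1 l1] proper_neq(1)[OF L, of l2 l2] proper_pairs_disjoint[OF L, of l1 l2] L v
    unfolding proper_def labels_def by auto
  have vb: "(v, c) \<in> set (word D)" for c using v by (simp add: gauss_partner[OF gD])
  have z: "consecutive ?Q [(x', True), (x, True), (r', True), (r, True)]"
    using consecutive_over[OF L] p by (auto simp: over_def x_def x'_def r_def r'_def)
  have a1: "at_gap [l1, l2] (\<not> i, (v, b)) = under l1" and a2: "at_gap [l1, l2] (j, (v, \<not> b)) = under l2"
    using p g by (simp_all add: at_gap_pair)
  have I: "consecutive ?Q (if i then [(x', False), (x, False), (v, b)] else [(v, b), (x, False), (x', False)])"
  proof (cases i)
    case True
    then have "consecutive ?Q (under l1 @ [(v, b)])"
      using consecutive_mid[OF d, of "[]" "under l1 @ [(v, b)]"] consecutive_at_gap[OF L vb[of b]] a1 by simp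
    then show ?thesis using True by (simp add: under_def x_def x'_def)
  next
    case False
    then have "consecutive ?Q ([(v, b)] @ under l1)"
      using consecutive_mid[OF d, of "at_gap [l1, l2] (False, (v, b))" "[(v, b)] @ under l1" "[]"]
        consecutive_at_gap[OF L vb[of b]] a1 by simp
    then show ?thesis using False by (simp add: under_def x_def x'_def)
  qed
  have J: "consecutive ?Q (if j then [(v, \<not> b), (r', False), (r, False)] else [(r, False), (r', False), (v, \<not> b)])"
  proof (cases j)
    case False
    then have "consecutive ?Q (under l2 @ [(v, \<not> b)])"
      using consecutive_mid[OF d, of "[]" "under l2 @ [(v, \<not> b)]"] consecutive_at_gap[OF L vb[of "\<not> b"]] a2 by simp
    then show ?thesis using False by (simp add: under_def r_def r'_def)
  next
    case True
    then have "consecutive ?Q ([(v, \<not> b)] @ under l2)"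
      using consecutive_mid[OF d, of "at_gap [l1, l2] (False, (v, \<not> b))" "[(v, \<not> b)] @ under l2" "[]"]
        consecutive_at_gap[OF L vb[of "\<not> b"]] a2 by simp
    then show ?thesis using True by (simp add: under_def r_def r'_def)
  qed
  have S: "rel ?Q (sg i (gen x) - sg j (gen r) + sg (i \<noteq> j) (gen v))"
  proof (rule slide[OF Q _ z I J])
    show "distinct [v, x, x', r, r']"
    proof -
      have n: "neg l1 \<noteq> neg l2" "neg l1 \<noteq> pst l2" "pst l1 \<noteq> neg l2" "pst l1 \<noteq> pst l2" using l12(3) by simp_all
      have m: "v \<noteq> neg l1" "v \<noteq> pst l1" "v \<noteq> neg l2" "v \<noteq> pst l2" using l12(4) by simp_all
      show ?thesis using n m l12(1,2) n[symmetric] l12(1,2)[symmetric]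
        by (cases i; cases j) (simp_all add: x_def x'_def r_def r'_def)
    qed
    show "v \<in> pos ?Q \<longleftrightarrow> b = (i \<noteq> j)" using pos_probed(3)[OF L _ v, of l1] s by (metis list.set_intros(1))
    show "x \<in> pos ?Q \<longleftrightarrow> i" "r \<in> pos ?Q \<longleftrightarrow> j" "r' \<in> pos ?Q \<longleftrightarrow> \<not> j"
      using pos_probed(1,2)[OF L, of l1] pos_probed(1,2)[OF L, of l2] by (simp_all add: x_def r_def r'_def)
  qed
  have B: "rel ?Q (gen (neg l1) + gen (pst l1))" "rel ?Q (gen (neg l2) + gen (pst l2))"
    using rel_probe[OF D L, of l1] rel_probe[OF D L, of l2] by simp_all
  \<comment> \<open>The two corrections replace \<open>pst\<close> by \<open>neg\<close> where the positive crossing is the one next to \<open>v\<close>.\<close>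
  have "gen (neg l1) - gen (neg l2) - sg (i \<noteq> j) (gen v) = - (sg i (gen x) - sg j (gen r) + sg (i \<noteq> j) (gen v))
    + (if i then gen (neg l1) + gen (pst l1) else 0) - (if j then gen (neg l2) + gen (pst l2) else 0)"
    by (cases i; cases j) (simp_all add: x_def r_def sg_def algebra_simps)
  moreover have "rel ?Q \<dots>" using B rel_zero[OF Q]
    by (intro rel_diff[OF Q] rel_add[OF Q] rel_minus[OF Q] S) auto
  ultimately show ?thesis by metis
qed

text \<open>
  \<open>\<phi> True u\<close> and \<open>\<phi> False u\<close> are the potentials \<open>\<gamma>(u)\<close> and \<open>\<alpha>(u)\<close> as formal combinations of
  crossings of the diagram \<open>M\<close> with all probes.  The relations between two probes depend on the order of their
  fingers; the definition provides them in either order.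
\<close>

definition potentials :: "diagram \<Rightarrow> point \<Rightarrow> diagram \<Rightarrow> (bool \<Rightarrow> bool \<times> point \<Rightarrow> nat \<Rightarrow> int) \<Rightarrow> bool" where
  "potentials D z M \<phi> \<longleftrightarrow> M \<in> K \<and> reduces M D \<and>
     (\<forall>t1 t2 u1 u2. snd u1 \<in> set (word D) \<longrightarrow> snd u2 \<in> set (word D) \<longrightarrow>
       (\<exists>l1 l2. par l1 = t1 \<and> gap l1 = u1 \<and> par l2 = t2 \<and> gap l2 = u2 \<and> proper D z [l1, l2]
          \<and> reduces M (probed D z [l1, l2]) \<and> rel M (\<phi> t1 u1 - gen (neg l1)) \<and> rel M (\<phi> t2 u2 - gen (neg l2))))"

text \<open>
  Two copies of every probe are used, those of the first copy before those of the second one.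
  Thus any two values of \<open>\<phi>\<close>, in either order, are represented by one probe of each copy.
\<close>

lemma potentials_exist:
  assumes D: "D \<in> K" and z: "z \<in> set (word D)"
  shows "\<exists>M \<phi>. potentials D z M \<phi>"
proof -
  have gD: "gauss_diagram D" using D K_gauss by blast
  define I where "I = (UNIV :: bool set) \<times> (UNIV :: bool set) \<times> ((UNIV :: bool set) \<times> set (word D)) \<times> (UNIV :: bool set)"
  have "finite I" unfolding I_def by simp
  then obtain h :: "bool \<times> bool \<times> (bool \<times> point) \<times> bool \<Rightarrow> nat" where h: "inj_on h I"
    using finite_imp_inj_to_nat_seg by blast
  \<comment> \<open>Labels of the new crossings, beyond those of \<open>D\<close>.\<close>
  define f where "f i = h i + Suc (Max (insert 0 (crossings D)))" for i
  have f: "inj_on f I" using h unfolding f_def inj_on_def by auto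
  have fresh: "f i \<notin> crossings D" for i
  proof
    assume "f i \<in> crossings D"
    then have "f i \<le> Max (insert 0 (crossings D))" by (intro Max_ge) auto
    then show False unfolding f_def by simp
  qed
  define pr where "pr c = (\<lambda>(t, u). Probe t u (f (c, t, u, False)) (f (c, t, u, True)))" for c
  have "finite ((UNIV :: bool set) \<times> (UNIV :: bool set) \<times> set (word D))" by simp
  then obtain W where setW': "set W = (UNIV :: bool set) \<times> (UNIV :: bool set) \<times> set (word D)" and W: "distinct W"
    using finite_distinct_list by blast
  define L1 where "L1 = map (pr False) W"
  define L2 where "L2 = map (pr True) W"
  have setW: "(t, u) \<in> set W \<longleftrightarrow> snd u \<in> set (word D)" for t u
    unfolding setW' by (cases u) auto
  have fI: "f (c, t, u, k) = f (c', t', u', k') \<longleftrightarrow> c = c' \<and> t = t' \<and> u = u' \<and> k = k'"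
    if "snd u \<in> set (word D)" "snd u' \<in> set (word D)" for c t u k c' t' u' k'
  proof -
    have "(c, t, u, k) \<in> I" "(c', t', u', k') \<in> I" using that unfolding I_def by (auto simp: mem_Times_iff)
    then show ?thesis using inj_onD[OF f] by blast
  qed
  have set12: "\<exists>c t u. l = pr c (t, u) \<and> snd u \<in> set (word D)" if l: "l \<in> set (L1 @ L2)" for l
  proof -
    obtain c w where "l = pr c w" "w \<in> set W" using l unfolding L1_def L2_def by auto
    then show ?thesis using setW by (metis surj_pair)
  qed
  have prs: "par (pr c (t, u)) = t" "gap (pr c (t, u)) = u" "neg (pr c (t, u)) = f (c, t, u, False)" "pst (pr c (t, u)) = f (c, t, u, True)" for c t u
    unfolding pr_def by auto
  have L: "proper D z (L1 @ L2)"
    unfolding proper_def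
  proof (intro conjI)
    have "inj_on (pr c) (set W)" for c
      by (rule inj_onI) (auto simp: pr_def)
    then have "distinct L1" "distinct L2" unfolding L1_def L2_def using W by (auto simp: distinct_map)
    moreover have "set L1 \<inter> set L2 = {}"
    proof -
      have "pr False w \<noteq> pr True w'" if "w \<in> set W" "w' \<in> set W" for w w'
        using that fI[of "snd w" "snd w'" False "fst w" False True "fst w'" False] setW[of "fst w" "snd w"] setW[of "fst w'" "snd w'"]
        unfolding pr_def by (auto split: prod.splits)
      then show ?thesis unfolding L1_def L2_def by auto
    qed
    ultimately show "distinct (L1 @ L2)" by simp
    show "inj_on neg (set (L1 @ L2))"
    proof (rule inj_onI)
      fix l l' assume l: "l \<in> set (L1 @ L2)" "l' \<in> set (L1 @ L2)" "neg l = neg l'"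
      then show "l = l'" using set12[OF l(1)] set12[OF l(2)] by (elim exE conjE) (simp add: prs fI)
    qed
    show "inj_on pst (set (L1 @ L2))"
    proof (rule inj_onI)
      fix l l' assume l: "l \<in> set (L1 @ L2)" "l' \<in> set (L1 @ L2)" "pst l = pst l'"
      then show "l = l'" using set12[OF l(1)] set12[OF l(2)] by (elim exE conjE) (simp add: prs fI)
    qed
    have "neg l \<noteq> pst l'" if l: "l \<in> set (L1 @ L2)" "l' \<in> set (L1 @ L2)" for l l'
      using set12[OF l(1)] set12[OF l(2)] by (elim exE conjE) (simp add: prs fI)
    then show "neg ` set (L1 @ L2) \<inter> pst ` set (L1 @ L2) = {}" by blast
    have "neg l \<notin> crossings D" "pst l \<notin> crossings D" if l: "l \<in> set (L1 @ L2)" for l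
      using set12[OF l] fresh by (elim exE conjE; simp add: prs)+
    then show "labels (L1 @ L2) \<inter> crossings D = {}" unfolding labels_def by blast
    have "snd (gap l) \<in> set (word D)" if l: "l \<in> set (L1 @ L2)" for l
      using set12[OF l] by (elim exE conjE) (simp add: prs)
    then show "\<forall>l\<in>set (L1 @ L2). snd (gap l) \<in> set (word D)" by blast
  qed (use gD z in auto)
  let ?M = "probed D z (L1 @ L2)"
  let ?\<phi> = "\<lambda>t u. gen (neg (pr False (t, u)))"
  have M: "?M \<in> K" using probed_K L D by blast
  have dL: "distinct (L1 @ L2)" using L unfolding proper_def by blast
  have two: "proper D z [pr False w, pr True w'] \<and> reduces ?M (probed D z [pr False w, pr True w'])"
    if "w \<in> set W" "w' \<in> set W" for w w'
  proof -
    have "filter (\<lambda>l. l = pr False w \<or> l = pr True w') (L1 @ L2) = [pr False w, pr True w']"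
      by (rule filter_pair[OF dL]) (use that in \<open>auto simp: L1_def L2_def\<close>)
    then show ?thesis using proper_filter[OF L] reduces_probes[OF L] by metis
  qed
  have "potentials D z ?M ?\<phi>"
    unfolding potentials_def
  proof (intro conjI allI impI)
    show "?M \<in> K" by (rule M)
    show "reduces ?M D" using reduces_probed L by blast
    fix t1 t2 :: bool and u1 u2 :: "bool \<times> point" assume u: "snd u1 \<in> set (word D)" "snd u2 \<in> set (word D)"
    have w: "(t1, u1) \<in> set W" "(t2, u2) \<in> set W" using u setW by auto
    have "rel (probed D z [pr False (t2, u2), pr True (t2, u2)]) (gen (neg (pr False (t2, u2))) - gen (neg (pr True (t2, u2))))"
      by (rule same_gap[OF D]) (use two[OF w(2) w(2)] in \<open>auto simp: prs\<close>)
    then have r2: "rel ?M (gen (neg (pr False (t2, u2))) - gen (neg (pr True (t2, u2))))"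
      using reduces_rel_up[OF _ M] two[OF w(2) w(2)] by blast
    show "\<exists>l1 l2. par l1 = t1 \<and> gap l1 = u1 \<and> par l2 = t2 \<and> gap l2 = u2 \<and> proper D z [l1, l2]
          \<and> reduces ?M (probed D z [l1, l2]) \<and> rel ?M (?\<phi> t1 u1 - gen (neg l1)) \<and> rel ?M (?\<phi> t2 u2 - gen (neg l2))"
      by (rule exI[of _ "pr False (t1, u1)"], rule exI[of _ "pr True (t2, u2)"])
        (use two[OF w] r2 rel_zero[OF M] in \<open>auto simp: prs\<close>)
  qed
  then show ?thesis by blast
qed

text \<open>
  A relation between two potentials is checked in the diagram that carries just their two probes.
\<close>

lemma potentials_rel:
  assumes pot: "potentials D z M \<phi>" and u: "snd u1 \<in> set (word D)" "snd u2 \<in> set (word D)"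
    and r: "\<And>l1 l2. par l1 = t1 \<Longrightarrow> gap l1 = u1 \<Longrightarrow> par l2 = t2 \<Longrightarrow> gap l2 = u2 \<Longrightarrow> proper D z [l1, l2]
       \<Longrightarrow> rel (probed D z [l1, l2]) (gen (neg l1) - gen (neg l2) - c)"
  shows "rel M (\<phi> t1 u1 - \<phi> t2 u2 - c)"
proof -
  obtain l1 l2 where l: "par l1 = t1" "gap l1 = u1" "par l2 = t2" "gap l2 = u2" "proper D z [l1, l2]"
    "reduces M (probed D z [l1, l2])" "rel M (\<phi> t1 u1 - gen (neg l1))" "rel M (\<phi> t2 u2 - gen (neg l2))"
    using pot u unfolding potentials_def by metis
  have M: "M \<in> K" using pot unfolding potentials_def by blast
  have "rel M (gen (neg l1) - gen (neg l2) - c)" using reduces_rel_up[OF l(6) M r[OF l(1-5)]] .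
  from rel_diff[OF M rel_add[OF M l(7) this] l(8)] show ?thesis by (simp add: algebra_simps)
qed

lemma potentials_single:
  assumes pot: "potentials D z M \<phi>" and u: "snd u \<in> set (word D)"
    and r: "\<And>l. par l = t \<Longrightarrow> gap l = u \<Longrightarrow> proper D z [l] \<Longrightarrow> rel (probed D z [l]) (gen (neg l) - c)"
  shows "rel M (\<phi> t u - c)"
proof -
  obtain l1 l2 where l: "par l1 = t" "gap l1 = u" "proper D z [l1, l2]"
    "reduces M (probed D z [l1, l2])" "rel M (\<phi> t u - gen (neg l1))"
    using pot u unfolding potentials_def by metis
  have M: "M \<in> K" using pot unfolding potentials_def by blast
  have "l1 \<noteq> l2" using l(3) unfolding proper_def by auto
  then have f: "filter (\<lambda>l. l = l1) [l1, l2] = [l1]" by auto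
  have "reduces M (probed D z [l1])" using reduces_trans[OF l(4) reduces_probes[OF l(3), of "\<lambda>l. l = l1"]] f by simp
  moreover have "proper D z [l1]" using proper_filter[OF l(3), of "\<lambda>l. l = l1"] f by simp
  ultimately have "rel M (gen (neg l1) - c)" using reduces_rel_up[OF _ M r[OF l(1,2)]] by blast
  then show ?thesis using rel_trans[OF M l(5)] by blast
qed

end

section \<open>Parities of folds\<close>

abbreviation fold_word :: "bool \<Rightarrow> nat \<Rightarrow> nat \<Rightarrow> point list" where
  "fold_word b c d \<equiv> [(c, b), (d, b), (c, \<not> b), (d, \<not> b)]"

lemma fold_bigon:
  assumes "gauss_diagram D" "consecutive D (fold_word b c d)" "c \<in> pos D \<longleftrightarrow> d \<notin> pos D"
  shows "bigon D c d"
proof -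
  note d = gauss_distinct[OF assms(1)]
  have "consecutive D [(c, b), (d, b)]" "consecutive D [(c, \<not> b), (d, \<not> b)]"
    using consecutive_mid[OF d, of "[]" "[(c, b), (d, b)]"] consecutive_mid[OF d, of "[(c, b), (d, b)]" "[(c, \<not> b), (d, \<not> b)]" "[]"] assms(2)
    by simp_all
  then show ?thesis unfolding bigon_def using assms(3) by (cases b) simp_all
qed

lemma at_gap_empty: "(\<And>l. l \<in> set L \<Longrightarrow> gap l \<noteq> u) \<Longrightarrow> at_gap L u = []"
  unfolding at_gap_def by auto

lemma at_gap_labels: "proper D z L \<Longrightarrow> labels L \<inter> X = {} \<Longrightarrow> filter (\<lambda>p. fst p \<notin> X) (at_gap L u) = at_gap L u"
  using set_at_gap_labels[of L u] by (auto simp: filter_id_conv)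

context knot_parity
begin

text \<open>
  The function \<open>\<epsilon> = \<gamma> - \<alpha>\<close>; it turns out to be the parity of a fold.
\<close>

definition fold_potential :: "(bool \<Rightarrow> bool \<times> point \<Rightarrow> nat \<Rightarrow> int) \<Rightarrow> bool \<times> point \<Rightarrow> nat \<Rightarrow> int" where
  "fold_potential \<phi> u = \<phi> True u - \<phi> False u"

lemma potentials_crossing:
  assumes "D \<in> K" "potentials D z M \<phi>" "v \<in> crossings D" "v \<in> pos D \<longleftrightarrow> b = (i \<noteq> j)"
  shows "rel M (\<phi> i (\<not> i, (v, b)) - \<phi> j (j, (v, \<not> b)) - sg (i \<noteq> j) (gen v))"
proof (rule potentials_rel[OF assms(2)])
  show "snd (\<not> i, (v, b)) \<in> set (word D)" "snd (j, (v, \<not> b)) \<in> set (word D)"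
    using assms(3) by (simp_all add: gauss_partner[OF K_gauss[OF assms(1)]])
qed (use crossing_relation assms in blast)

lemma potentials_K: "potentials D z M \<phi> \<Longrightarrow> M \<in> K"
  unfolding potentials_def by blast

text \<open>
  \<open>n\<close> is the passage from SW to NE and \<open>m\<close> the passage from SE to NW.
\<close>

lemma potentials_four:
  assumes "D \<in> K" "potentials D z M \<phi>" "v \<in> crossings D"
    and n: "n = (v, v \<in> pos D)" and m: "m = (v, v \<notin> pos D)"
  shows "rel M (\<phi> False (True, m) - \<phi> False (False, n) + gen v)"
    "rel M (\<phi> False (True, n) - \<phi> True (True, m) - gen v)"
    "rel M (\<phi> True (False, n) - \<phi> False (False, m) - gen v)"
    "rel M (\<phi> True (False, m) - \<phi> True (True, n) + gen v)"
  using potentials_crossing[OF assms(1-3), of "v \<notin> pos D" False False]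
    potentials_crossing[OF assms(1-3), of "v \<in> pos D" False True]
    potentials_crossing[OF assms(1-3), of "v \<in> pos D" True False]
    potentials_crossing[OF assms(1-3), of "v \<notin> pos D" True True]
  by (simp_all add: n m sg_def)

text \<open>
  The alternating sum of the four expressions for the parity of \<open>v\<close>, in which it cancels.
\<close>

lemma potentials_conservation:
  assumes "D \<in> K" "potentials D z M \<phi>" "v \<in> crossings D"
    and n: "n = (v, v \<in> pos D)" and m: "m = (v, v \<notin> pos D)"
  shows "rel M (fold_potential \<phi> (True, n) + fold_potential \<phi> (True, m) - fold_potential \<phi> (False, n) - fold_potential \<phi> (False, m))"
proof -
  note M = potentials_K[OF assms(2)]
  note f = potentials_four[OF assms]
  show ?thesis
    using rel_minus[OF M rel_add[OF M rel_add[OF M f(1,2)] rel_add[OF M f(3,4)]]]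
    by (simp add: fold_potential_def algebra_simps)
qed

lemma potentials_jump:
  assumes "D \<in> K" "potentials D z M \<phi>" "v \<in> crossings D"
    and n: "n = (v, v \<in> pos D)" and m: "m = (v, v \<notin> pos D)"
  shows "rel M (\<phi> False (True, n) - \<phi> False (False, n) - fold_potential \<phi> (True, m))"
    "rel M (\<phi> False (True, m) - \<phi> False (False, m) + fold_potential \<phi> (False, n))"
proof -
  note M = potentials_K[OF assms(2)]
  note f = potentials_four[OF assms]
  show "rel M (\<phi> False (True, n) - \<phi> False (False, n) - fold_potential \<phi> (True, m))"
    using rel_add[OF M f(1,2)] by (simp add: fold_potential_def algebra_simps)
  show "rel M (\<phi> False (True, m) - \<phi> False (False, m) + fold_potential \<phi> (False, n))"
    using rel_add[OF M f(1,3)] by (simp add: fold_potential_def algebra_simps)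
qed

text \<open>
  Two gaps that become one gap when the crossings in \<open>X\<close> are removed have the same potentials.  For
  antiparallel probes the roles of the two gaps are exchanged, since the understrands of such probes
  appear in the reversed order.
\<close>

lemma potentials_merge:
  assumes D: "D \<in> K" and pot: "potentials D z M \<phi>" and u: "snd u1 \<in> set (word D)" "snd u2 \<in> set (word D)" "u1 \<noteq> u2"
    and X: "X \<subseteq> crossings D"
    and red: "\<And>l1 l2. proper D z [l1, l2] \<Longrightarrow> {gap l1, gap l2} = {u1, u2} \<Longrightarrow>
      reduces (probed D z [l1, l2]) (delete X (probed D z [l1, l2]))
      \<and> consecutive (delete X (probed D z [l1, l2])) (at_gap [l1, l2] u1 @ at_gap [l1, l2] u2)"
  shows "rel M (\<phi> t u1 - \<phi> t u2)"
proof -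
  have lab: "labels L \<inter> X = {}" if "proper D z L" for L using that X unfolding proper_def by blast
  show ?thesis
  proof (cases t)
    case True
    have "rel M (\<phi> True u1 - \<phi> True u2 - 0)"
    proof (rule potentials_rel[OF pot u(1,2)])
      fix l1 l2 assume l: "par l1 = True" "gap l1 = u1" "par l2 = True" "gap l2 = u2" "proper D z [l1, l2]"
      have "rel (probed D z [l1, l2]) (gen (neg l1) - gen (neg l2))"
        by (rule adjacent_probes[OF D l(5) _ _ lab[OF l(5)]])
          (use l u(3) red[OF l(5)] in \<open>auto simp: at_gap_pair\<close>)
      then show "rel (probed D z [l1, l2]) (gen (neg l1) - gen (neg l2) - 0)" by simp
    qed
    then show ?thesis using True by simp
  next
    case False
    have "rel M (\<phi> False u2 - \<phi> False u1 - 0)"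
    proof (rule potentials_rel[OF pot u(2,1)])
      fix l1 l2 assume l: "par l1 = False" "gap l1 = u2" "par l2 = False" "gap l2 = u1" "proper D z [l1, l2]"
      have "rel (probed D z [l1, l2]) (gen (neg l1) - gen (neg l2))"
        by (rule adjacent_probes[OF D l(5) _ _ lab[OF l(5)]])
          (use l u(3) red[OF l(5)] in \<open>auto simp: at_gap_pair\<close>)
      then show "rel (probed D z [l1, l2]) (gen (neg l1) - gen (neg l2) - 0)" by simp
    qed
    then show ?thesis using False rel_sym[OF potentials_K[OF pot]] by simp
  qed
qed

text \<open>
  The base point is excluded since the fingers start between it and the preceding point.
\<close>

lemma merge_adjacent:
  assumes D: "D \<in> K" and pot: "potentials D z M \<phi>" and pq: "consecutive D [p, q]" "q \<noteq> z"
  shows "rel M (\<phi> t (True, p) - \<phi> t (False, q))"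
proof (rule potentials_merge[OF D pot, of _ _ "{}"])
  note dD = gauss_distinct[OF K_gauss[OF D]]
  show "snd (True, p) \<in> set (word D)" "snd (False, q) \<in> set (word D)" using consecutive_in[OF dD pq(1)] by auto
  fix l1 l2 assume l: "proper D z [l1, l2]"
  note c = consecutive_probed[OF l pq(1)]
  have "sublist (at_gap [l1, l2] (True, p) @ at_gap [l1, l2] (False, q)) (concat (map (block z [l1, l2]) [p, q]))"
  proof -
    have "concat (map (block z [l1, l2]) [p, q]) = ((if p = z then concat (map over [l1, l2]) else []) @ at_gap [l1, l2] (False, p) @ [p])
      @ (at_gap [l1, l2] (True, p) @ at_gap [l1, l2] (False, q)) @ (q # at_gap [l1, l2] (True, q))"
      using pq(2) by (simp add: block_def)
    then show ?thesis by (simp only: sublist_appendI)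
  qed
  from consecutive_sublist[OF gauss_distinct[OF gauss_probed[OF l]] c this]
  show "reduces (probed D z [l1, l2]) (delete {} (probed D z [l1, l2]))
      \<and> consecutive (delete {} (probed D z [l1, l2])) (at_gap [l1, l2] (True, p) @ at_gap [l1, l2] (False, q))"
    by (simp add: reduces.stop)
qed auto

text \<open>
  The fold is a bigon.  If it is removed, the gap before it, the gap in the middle and the gap
  after it become one, unless the fingers start in between.
\<close>

lemma merge_fold:
  assumes D: "D \<in> K" and pot: "potentials D z M \<phi>"
    and f: "consecutive D (fold_word b c d)" and s: "c \<in> pos D \<longleftrightarrow> d \<notin> pos D"
    and z: "z \<notin> {(d, b), (c, \<not> b), (d, \<not> b)}"
  shows "rel M (\<phi> t (False, (c, b)) - \<phi> t (False, (c, \<not> b)))"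
    and "consecutive D (fold_word b c d @ [q]) \<Longrightarrow> q \<noteq> z \<Longrightarrow> fst q \<notin> {c, d} \<Longrightarrow>
      rel M (\<phi> t (False, (c, b)) - \<phi> t (False, q))"
proof -
  note dD = gauss_distinct[OF K_gauss[OF D]]
  have inw: "(c, b) \<in> set (word D)" "(c, \<not> b) \<in> set (word D)" "(d, b) \<in> set (word D)" using consecutive_in[OF dD f] by auto
  then have cd: "{c, d} \<subseteq> crossings D" using gauss_partner[OF K_gauss[OF D]] by auto
  have zn: "(d, b) \<noteq> z" "(c, \<not> b) \<noteq> z" "(d, \<not> b) \<noteq> z" using z by auto
  have ncd: "c \<noteq> d" using consecutive_distinct[OF dD f] by auto
  have red: "reduces (probed D z L) (delete {c, d} (probed D z L))" if L: "proper D z L"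
    and g: "gap ` set L \<subseteq> {(False, (c, b)), (False, (c, \<not> b)), (False, q)}" "fst q \<notin> {c, d} \<or> q = (c, \<not> b)" for L q
  proof -
    have g': "gap l \<in> {(False, (c, b)), (False, (c, \<not> b)), (False, q)}" if "l \<in> set L" for l using g(1) that by blast
    have e: "at_gap L (True, (c, b)) = []" "at_gap L (False, (d, b)) = []" "at_gap L (True, (c, \<not> b)) = []"
       "at_gap L (False, (d, \<not> b)) = []" by (rule at_gap_empty, drule g', use g(2) ncd in force)+
    have "concat (map (block z L) (fold_word b c d)) = ((if (c, b) = z then concat (map over L) else []) @ at_gap L (False, (c, b)))
       @ [(c, b), (d, b)] @ (at_gap L (True, (d, b)) @ at_gap L (False, (c, \<not> b))) @ [(c, \<not> b), (d, \<not> b)] @ at_gap L (True, (d, \<not> b))"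
      using zn by (simp add: block_def e)
    note c1 = consecutive_probed[OF L f, unfolded this]
    note dL = gauss_distinct[OF gauss_probed[OF L]]
    have "consecutive (probed D z L) [(c, b), (d, b)]"
      using consecutive_mid[OF dL c1] .
    moreover have "consecutive (probed D z L) [(c, \<not> b), (d, \<not> b)]"
      using consecutive_mid[OF dL, of "((if (c, b) = z then concat (map over L) else []) @ at_gap L (False, (c, b)))
       @ [(c, b), (d, b)] @ (at_gap L (True, (d, b)) @ at_gap L (False, (c, \<not> b)))" "[(c, \<not> b), (d, \<not> b)]" "at_gap L (True, (d, \<not> b))"]
        c1 by (simp only: append_assoc)
    moreover have "pos (probed D z L) = pos D \<union> pst ` set L" unfolding probed_def expand_def by simp
    then have "x \<in> pos (probed D z L) \<longleftrightarrow> x \<in> pos D" if "x \<in> crossings D" for x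
      using L that unfolding proper_def labels_def by auto
    then have "c \<in> pos (probed D z L) \<longleftrightarrow> d \<notin> pos (probed D z L)" using s cd by simp
    ultimately have "bigon (probed D z L) c d" unfolding bigon_def by (cases b) simp_all
    then show ?thesis using reduces.bigon[OF reduces.stop] by blast
  qed
  have del: "consecutive (delete {c, d} (probed D z L)) (filter (\<lambda>p. fst p \<notin> {c, d}) (concat (map (block z L) ps)))"
    if "proper D z L" "consecutive D ps" for L ps
    using consecutive_delete[OF gauss_distinct[OF gauss_probed[OF that(1)]] consecutive_probed[OF that]] .
  have fl: "filter (\<lambda>p. fst p \<notin> {c, d}) (at_gap L u) = at_gap L u" if "proper D z L" for L u
    by (rule at_gap_labels[OF that]) (use that cd in \<open>unfold proper_def, blast\<close>)
  have fo: "filter (\<lambda>p. fst p \<notin> {c, d}) (concat (map over L)) = concat (map over L)" if L: "proper D z L" for L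
  proof -
    have "labels L \<inter> {c, d} = {}" using L cd unfolding proper_def by blast
    then have "\<forall>p\<in>set (concat (map over L)). fst p \<notin> {c, d}" unfolding set_over_labels by auto
    then show ?thesis by (rule filter_True)
  qed
  show "rel M (\<phi> t (False, (c, b)) - \<phi> t (False, (c, \<not> b)))"
  proof (rule potentials_merge[OF D pot _ _ _ cd])
    fix l1 l2 assume l: "proper D z [l1, l2]" "{gap l1, gap l2} = {(False, (c, b)), (False, (c, \<not> b))}"
    let ?L = "[l1, l2]"
    have g: "gap k \<in> {(False, (c, b)), (False, (c, \<not> b))}" if "k \<in> set ?L" for k using l(2) that by auto
    have e: "at_gap ?L (True, (c, b)) = []" "at_gap ?L (False, (d, b)) = []" "at_gap ?L (True, (d, b)) = []"
      by (rule at_gap_empty, drule g, use ncd in force)+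
    have "filter (\<lambda>p. fst p \<notin> {c, d}) (concat (map (block z ?L) (fold_word b c d)))
      = (if (c, b) = z then concat (map over ?L) else []) @ (at_gap ?L (False, (c, b)) @ at_gap ?L (False, (c, \<not> b)))
        @ (at_gap ?L (True, (c, \<not> b)) @ at_gap ?L (False, (d, \<not> b)) @ at_gap ?L (True, (d, \<not> b)))"
      using zn fo[OF l(1)] by (simp add: block_def e fl[OF l(1), simplified])
    then have "consecutive (delete {c, d} (probed D z ?L)) (at_gap ?L (False, (c, b)) @ at_gap ?L (False, (c, \<not> b)))"
      using del[OF l(1) f] consecutive_mid gauss_distinct gauss_delete gauss_probed[OF l(1)] by metis
    moreover have "reduces (probed D z ?L) (delete {c, d} (probed D z ?L))"
      by (rule red[OF l(1), of "(c, \<not> b)"]) (use l(2) in auto)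
    ultimately show "reduces (probed D z ?L) (delete {c, d} (probed D z ?L)) \<and>
      consecutive (delete {c, d} (probed D z ?L)) (at_gap ?L (False, (c, b)) @ at_gap ?L (False, (c, \<not> b)))" by blast
  qed (use inw in auto)
  assume q: "consecutive D (fold_word b c d @ [q])" "q \<noteq> z" "fst q \<notin> {c, d}"
  show "rel M (\<phi> t (False, (c, b)) - \<phi> t (False, q))"
  proof (rule potentials_merge[OF D pot _ _ _ cd])
    fix l1 l2 assume l: "proper D z [l1, l2]" "{gap l1, gap l2} = {(False, (c, b)), (False, q)}"
    let ?L = "[l1, l2]"
    have g: "gap k \<in> {(False, (c, b)), (False, q)}" if "k \<in> set ?L" for k using l(2) that by auto
    have e: "at_gap ?L (True, (c, b)) = []" "at_gap ?L (False, (d, b)) = []" "at_gap ?L (True, (d, b)) = []"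
       "at_gap ?L (False, (c, \<not> b)) = []" "at_gap ?L (True, (c, \<not> b)) = []" "at_gap ?L (False, (d, \<not> b)) = []" "at_gap ?L (True, (d, \<not> b)) = []"
      by (rule at_gap_empty, drule g, use ncd q(3) in force)+
    have "filter (\<lambda>p. fst p \<notin> {c, d}) (concat (map (block z ?L) (fold_word b c d @ [q])))
      = (if (c, b) = z then concat (map over ?L) else []) @ (at_gap ?L (False, (c, b)) @ at_gap ?L (False, q))
        @ (q # at_gap ?L (True, q))"
      using zn fo[OF l(1)] q(2,3) by (simp add: block_def e fl[OF l(1), simplified])
    then have "consecutive (delete {c, d} (probed D z ?L)) (at_gap ?L (False, (c, b)) @ at_gap ?L (False, q))"
      using del[OF l(1) q(1)] consecutive_mid gauss_distinct gauss_delete gauss_probed[OF l(1)] by metis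
    moreover have "reduces (probed D z ?L) (delete {c, d} (probed D z ?L))"
      by (rule red[OF l(1), of q]) (use l(2) q(3) in auto)
    ultimately show "reduces (probed D z ?L) (delete {c, d} (probed D z ?L)) \<and>
      consecutive (delete {c, d} (probed D z ?L)) (at_gap ?L (False, (c, b)) @ at_gap ?L (False, q))" by blast
  next
    show "snd (False, q) \<in> set (word D)" using consecutive_in[OF dD q(1)] by auto
  qed (use inw q(3) in auto)
qed

text \<open>
  At the crossing \<open>c\<close> of the fold, \<open>P(c) = \<gamma>(SW) - \<alpha>(SE)\<close>, and the gaps SW and SE are those before the two
  passages of the fold through \<open>c\<close>.  By \<open>merge_fold\<close> they have the same potentials, in whichever
  order the passages occur.
\<close>

lemma fold_parity:
  assumes D: "D \<in> K" and pot: "potentials D z M \<phi>"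
    and f: "consecutive D (fold_word b c d)" and s: "c \<in> pos D \<longleftrightarrow> d \<notin> pos D"
    and z: "z \<notin> {(d, b), (c, \<not> b), (d, \<not> b)}"
  shows "rel M (fold_potential \<phi> (False, (c, b)) - gen c)"
proof -
  note M = potentials_K[OF pot]
  have c: "c \<in> crossings D" using consecutive_in[OF gauss_distinct[OF K_gauss[OF D]] f] gauss_partner[OF K_gauss[OF D]] by auto
  have N: "rel M (\<phi> True (False, (c, c \<in> pos D)) - \<phi> False (False, (c, c \<notin> pos D)) - gen c)"
    by (rule potentials_four(3)[OF D pot c]) auto
  note m = merge_fold(1)[OF D pot f s z]
  show ?thesis
  proof (cases "b = (c \<in> pos D)")
    case True
    then have e: "(c \<in> pos D) = b" "(c \<notin> pos D) = (\<not> b)" by auto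
    from rel_diff[OF M N[unfolded e] m[of False]] show ?thesis unfolding fold_potential_def by (simp add: algebra_simps)
  next
    case False
    then have e: "(c \<in> pos D) = (\<not> b)" "(c \<notin> pos D) = b" by auto
    from rel_add[OF M N[unfolded e] m[of True]] show ?thesis unfolding fold_potential_def by (simp add: algebra_simps)
  qed
qed

text \<open>
  Both parities are the value of \<open>\<epsilon>\<close> before the fold, and \<open>\<epsilon>\<close> is the same before the first
  and before the second fold.  The fingers start before the first fold, where they do not interfere.
\<close>

lemma adjacent_folds:
  assumes W: "W \<in> K" and f: "consecutive W (fold_word b1 c1 d1 @ fold_word b2 c2 d2)"
    and s: "c1 \<in> pos W \<longleftrightarrow> d1 \<notin> pos W" "c2 \<in> pos W \<longleftrightarrow> d2 \<notin> pos W"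
  shows "rel W (gen c1 - gen c2)"
proof -
  note dW = gauss_distinct[OF K_gauss[OF W]]
  have dist: "distinct (fold_word b1 c1 d1 @ fold_word b2 c2 d2)" using consecutive_distinct[OF dW f] .
  have inw: "set (fold_word b1 c1 d1 @ fold_word b2 c2 d2) \<subseteq> set (word W)" using consecutive_in[OF dW f] .
  then have "(c1, b1) \<in> set (word W)" by simp
  then obtain M \<phi> where pot: "potentials W (c1, b1) M \<phi>" using potentials_exist[OF W] by blast
  note M = potentials_K[OF pot]
  have f1: "consecutive W (fold_word b1 c1 d1)" "consecutive W (fold_word b2 c2 d2)" "consecutive W (fold_word b1 c1 d1 @ [(c2, b2)])"
    using consecutive_mid[OF dW, of "[]" "fold_word b1 c1 d1" "fold_word b2 c2 d2"]
      consecutive_mid[OF dW, of "fold_word b1 c1 d1" "fold_word b2 c2 d2" "[]"]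
      consecutive_mid[OF dW, of "[]" "fold_word b1 c1 d1 @ [(c2, b2)]" "[(d2, b2), (c2, \<not> b2), (d2, \<not> b2)]"] f by simp_all
  have n1: "(c1, b1) \<noteq> (c2, b2)" "(c1, \<not> b1) \<noteq> (c2, b2)" "(d1, b1) \<noteq> (c2, b2)" "(d1, \<not> b1) \<noteq> (c2, b2)"
     "(c1, b1) \<noteq> (d1, b1)" "(c1, b1) \<noteq> (c2, \<not> b2)" "(c1, b1) \<noteq> (d2, b2)" "(c1, b1) \<noteq> (d2, \<not> b2)"
    using dist unfolding distinct.simps append_Cons append_Nil list.set insert_iff by blast+
  have b: "b2 = b1 \<or> b2 = (\<not> b1)" by (cases b1; cases b2) simp_all
  have "c2 \<noteq> c1" using b n1(1,2) by (elim disjE; blast)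
  moreover have "c2 \<noteq> d1" using b n1(3,4) by (elim disjE; blast)
  moreover have "c1 \<noteq> d1" using n1(5) by simp
  ultimately have ne: "(c1, b1) \<notin> {(d1, b1), (c1, \<not> b1), (d1, \<not> b1)}" "(c1, b1) \<notin> {(d2, b2), (c2, \<not> b2), (d2, \<not> b2)}"
    "(c2, b2) \<noteq> (c1, b1)" "fst (c2, b2) \<notin> {c1, d1}"
    using n1(7,8) by simp_all
  note p1 = fold_parity[OF W pot f1(1) s(1) ne(1)] and p2 = fold_parity[OF W pot f1(2) s(2) ne(2)]
  note m = merge_fold(2)[OF W pot f1(1) s(1) ne(1) f1(3) ne(3,4)]
  have "rel M (gen c1 - gen c2)"
    using rel_add[OF M rel_diff[OF M rel_diff[OF M m[of True] m[of False]] p1] p2] unfolding fold_potential_def by (simp add: algebra_simps)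
  moreover have "{c1, c2} \<subseteq> crossings W" using inw gauss_partner[OF K_gauss[OF W]] by auto
  ultimately show ?thesis using pot reduces_rel[of M W "gen c1 - gen c2"] unfolding potentials_def by (simp add: supp_diff)
qed

end

section \<open>Folds on the arcs of a diagram\<close>

text \<open>
  Which of the two segments of a fold is the upper one is chosen once, so that the words of folds can be
  inserted by a function.
\<close>

definition fold_side :: "diagram \<Rightarrow> arc \<Rightarrow> nat \<Rightarrow> nat \<Rightarrow> bool" where
  "fold_side E a x y = (SOME b. consecutive E ((case a of None \<Rightarrow> [] | Some p \<Rightarrow> [p]) @ fold_word b x y))"

lemma carries_fold_side:
  assumes "carries_fold E a x y"
  shows "consecutive E ((case a of None \<Rightarrow> [] | Some p \<Rightarrow> [p]) @ fold_word (fold_side E a x y) x y)"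
  using assms unfolding carries_fold_def fold_side_def by (elim conjE) (rule someI_ex)

locale folded_diagram =
  fixes D S E x y
  assumes folded: "folded D S E x y"
begin

lemma gauss: "gauss_diagram D" "gauss_diagram E"
  using folded unfolding folded_def by blast+

lemma dist: "distinct (word D)" "distinct (word E)"
  using gauss gauss_distinct by blast+

abbreviation "side a \<equiv> fold_side E a (x a) (y a)"
abbreviation "fold_of a \<equiv> fold_word (side a) (x a) (y a)"

lemma D_eq: "D = delete (x ` S \<union> y ` S) E"
  using folded unfolding folded_def by blast

lemma carries: "a \<in> S \<Longrightarrow> carries_fold E a (x a) (y a)"
  using folded unfolding folded_def by blast

lemma fold_consecutive: "Some p \<in> S \<Longrightarrow> consecutive E (p # fold_of (Some p))"
  using carries_fold_side[OF carries, of "Some p"] by simp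

lemma fold_word_consecutive:
  assumes "a \<in> S" shows "consecutive E (fold_of a)"
proof (cases a)
  case None
  then show ?thesis using carries_fold_side[OF carries[OF assms]] by simp
next
  case (Some p)
  then show ?thesis using fold_consecutive[of p] assms consecutive_mid[OF dist(2), of "[p]" "fold_of a" "[]"] by simp
qed

lemma sign: "a \<in> S \<Longrightarrow> x a \<in> pos E \<longleftrightarrow> y a \<notin> pos E"
  using carries unfolding carries_fold_def by blast

lemma bigon: "a \<in> S \<Longrightarrow> bigon E (x a) (y a)"
  using fold_bigon[OF gauss(2) fold_word_consecutive sign] .

lemma in_S: "S \<subseteq> arcs D" "finite S"
  using folded finite_subset[of S "arcs D"] unfolding folded_def by (auto simp: arcs_def)

lemma labels_disjoint:
  assumes "a \<in> S" "a' \<in> S"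
  shows "x a \<noteq> y a'" "x a = x a' \<longleftrightarrow> a = a'" "y a = y a' \<longleftrightarrow> a = a'"
  using folded assms unfolding folded_def by (auto dest: inj_onD)

lemma labels_pairs:
  assumes a: "a \<in> S" "a' \<in> S" "a \<noteq> a'" shows "{x a, y a} \<inter> {x a', y a'} = {}"
proof -
  have "x a \<noteq> x a'" "y a \<noteq> y a'" "x a \<noteq> y a'" "y a \<noteq> x a'"
    using labels_disjoint(2,3)[OF a(1,2)] a(3) labels_disjoint(1)[OF a(1,2)] labels_disjoint(1)[OF a(2,1)] by auto
  then show ?thesis by simp
qed

lemma labels_in: "a \<in> S \<Longrightarrow> x a \<in> crossings E \<and> y a \<in> crossings E"
  using bigon_crossings[OF gauss(2) bigon] .

lemma labels_notin: "a \<in> S \<Longrightarrow> x a \<notin> crossings D \<and> y a \<notin> crossings D"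
  unfolding D_eq crossings_delete by blast

lemma word_D: "set (word D) \<subseteq> set (word E)"
  by (subst D_eq) (auto simp: word_delete)

lemma crossings_E: "crossings D \<subseteq> crossings E"
  by (subst D_eq) simp

lemma pos_D: "v \<in> crossings D \<Longrightarrow> v \<in> pos D \<longleftrightarrow> v \<in> pos E"
  using labels_notin by (subst (1) D_eq) auto

lemma reduces_folds:
  assumes "T \<subseteq> S"
  shows "reduces E (delete (x ` T \<union> y ` T) E)"
proof (rule reduces_bigons)
  show "finite T" using assms in_S finite_subset by blast
  show "{x i, y i} \<inter> {x j, y j} = {}" if "i \<in> T" "j \<in> T" "i \<noteq> j" for i j
    using labels_pairs[of i j] that assms by (meson subsetD)
qed (use gauss bigon assms in auto)

lemma reduces_E: "reduces E D"
  using reduces_folds[OF order_refl] by (simp only: D_eq[symmetric])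

definition blow :: "point \<Rightarrow> point list" where
  "blow p = p # (if Some p \<in> S then fold_of (Some p) else [])"

lemma fold_points:
  assumes "a \<in> S" "fst p \<in> {x a, y a}"
  shows "p \<in> set (fold_of a)"
  using assms(2) by (cases p; cases "snd p"; cases "side a") auto

text \<open>A fold is entered only from the start of its arc.\<close>

lemma fold_pred:
  assumes a: "Some p \<in> S" and e: "fst e \<in> {x (Some p), y (Some p)}" and q: "consecutive E [q, e]"
  shows "q = p \<or> (fst q \<in> {x (Some p), y (Some p)} \<and> q \<noteq> (y (Some p), \<not> side (Some p)))"
proof -
  define b where "b = side (Some p)"
  define c where "c = x (Some p)"
  define d where "d = y (Some p)"
  have f: "consecutive E [p, (c, b), (d, b), (c, \<not> b), (d, \<not> b)]"
    using fold_consecutive[OF a] unfolding b_def c_def d_def .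
  have cd: "c \<noteq> d" using labels_disjoint(1)[OF a a] unfolding c_def d_def .
  have s: "consecutive E [p, (c, b)]" "consecutive E [(c, b), (d, b)]" "consecutive E [(d, b), (c, \<not> b)]" "consecutive E [(c, \<not> b), (d, \<not> b)]"
    by (rule consecutive_sublist[OF dist(2) f]; simp add: sublist_code)+
  have "e \<in> set [(c, b), (d, b), (c, \<not> b), (d, \<not> b)]"
    using fold_points[OF a, of e] e unfolding b_def c_def d_def .
  then consider "e = (c, b)" | "e = (d, b)" | "e = (c, \<not> b)" | "e = (d, \<not> b)" by auto
  then have "q = p \<or> (fst q \<in> {c, d} \<and> q \<noteq> (d, \<not> b))"
  proof cases
    case 1
    then have "q = p" using consecutive_unique_prev[OF dist(2) q] s(1) by blast
    then show "q = p \<or> (fst q \<in> {c, d} \<and> q \<noteq> (d, \<not> b))" by blast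
  next
    case 2
    then have "q = (c, b)" using consecutive_unique_prev[OF dist(2) q] s(2) by blast
    then show "q = p \<or> (fst q \<in> {c, d} \<and> q \<noteq> (d, \<not> b))" using cd by simp
  next
    case 3
    then have "q = (d, b)" using consecutive_unique_prev[OF dist(2) q] s(3) by blast
    then show "q = p \<or> (fst q \<in> {c, d} \<and> q \<noteq> (d, \<not> b))" by simp
  next
    case 4
    then have "q = (c, \<not> b)" using consecutive_unique_prev[OF dist(2) q] s(4) by blast
    then show "q = p \<or> (fst q \<in> {c, d} \<and> q \<noteq> (d, \<not> b))" using cd by simp
  qed
  then show ?thesis unfolding b_def c_def d_def .
qed

lemma S_Some: "a \<in> S \<Longrightarrow> word D \<noteq> [] \<Longrightarrow> \<exists>p. a = Some p \<and> p \<in> set (word D)"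
  using in_S(1) unfolding arcs_def by auto

lemma last_blow: "last (blow p) = (if Some p \<in> S then (y (Some p), \<not> side (Some p)) else p)"
  unfolding blow_def by simp

text \<open>
  The points between \<open>p\<close> and \<open>q\<close> belong to folds.  The fold on the arc of \<open>p\<close> comes first; a further
  point would be in another fold, which can be entered only from the start of another arc.
\<close>

lemma consecutive_blow_pair:
  assumes pq: "consecutive D [p, q]"
  shows "consecutive E (blow p @ [q])"
proof -
  let ?X = "x ` S \<union> y ` S"
  obtain us where us: "consecutive E (p # us @ [q])" "fst ` set us \<subseteq> ?X" "fst p \<notin> ?X" "fst q \<notin> ?X"
    using lift_pair[OF dist(2), of ?X p q] pq by (auto simp: D_eq[symmetric])
  have b: "consecutive E (blow p)"
    using fold_consecutive[of p] consecutive_single[of p E] consecutive_in[OF dist(2) us(1)] unfolding blow_def by auto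
  have D0: "word D \<noteq> []" using consecutive_in[OF dist(1) pq] by auto
  obtain t where t: "blow p = p # t" "fst ` set t \<subseteq> ?X"
    unfolding blow_def by (cases "Some p \<in> S") auto
  have le: "length t \<le> length us"
  proof (rule ccontr)
    assume "\<not> length t \<le> length us"
    then have "\<exists>r. t = (us @ [q]) @ r"
      using consecutive_append_unique[OF dist(2) us(1), of t] b t by auto
    then have "q \<in> set t" by auto
    then show False using t(2) us(4) by auto
  qed
  then obtain r where r: "us @ [q] = t @ r"
    using consecutive_append_unique[OF dist(2), of p t "us @ [q]"] b t(1) us(1) by auto
  then have "r \<noteq> []" using le by (metis Suc_n_not_le_n append_Nil2 length_append_singleton)
  then obtain e r' where e: "r = e # r'" by (cases r) auto
  have "consecutive E (butlast (blow p) @ [last (blow p), e] @ r')"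
    using us(1) r e t(1) by (metis append.assoc append_Cons append_butlast_last_id append_Nil list.distinct(1))
  then have le: "consecutive E [last (blow p), e]" using consecutive_mid[OF dist(2)] by blast
  have "r' = []"
  proof (rule ccontr)
    assume "r' \<noteq> []"
    then have "e \<in> set us" using r e
      by (metis append_Cons append_butlast_last_id butlast_append butlast_snoc in_set_conv_decomp list.distinct(1) butlast.simps(2))
    then have "fst e \<in> ?X" using us(2) by blast
    then obtain a where a: "a \<in> S" "fst e \<in> {x a, y a}" by blast
    then obtain p' where p': "a = Some p'" "p' \<in> set (word D)" using S_Some D0 by blast
    have n: "last (blow p) = p' \<or> (fst (last (blow p)) \<in> {x a, y a} \<and> last (blow p) \<noteq> (y a, \<not> side a))"
      using fold_pred[of p' e "last (blow p)"] a p' le by simp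
    have p'X: "fst p' \<notin> ?X" using p'(2) unfolding word_delete[of ?X E, folded D_eq] by simp
    show False
    proof (cases "Some p \<in> S")
      case True
      have l: "last (blow p) = (y (Some p), \<not> side (Some p))" using True last_blow by simp
      have "last (blow p) \<noteq> p'" using l p'X True by auto
      then have "y (Some p) \<in> {x a, y a}" "last (blow p) \<noteq> (y a, \<not> side a)" using n l by auto
      then have "a = Some p" using labels_pairs[OF True a(1)] by blast
      then show False using l \<open>last (blow p) \<noteq> (y a, \<not> side a)\<close> by simp
    next
      case False
      then have "last (blow p) = p" using last_blow by simp
      then have "p = p'" using n us(3) a(1) by auto
      then show False using False a(1) p'(1) by simp
    qed
  qed
  then have "us @ [q] = t @ [e]" using r e by simp
  then show ?thesis using us(1) t(1) by simp
qed

lemma fst_blow: "q \<in> set (blow p) \<Longrightarrow> q = p \<or> (Some p \<in> S \<and> fst q \<in> {x (Some p), y (Some p)})"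
  unfolding blow_def by (auto split: if_splits)

lemma blow_disjoint:
  assumes "p \<in> set (word D)" "q \<in> set (word D)" "p \<noteq> q"
  shows "set (blow p) \<inter> set (blow q) = {}"
proof -
  have False if e: "e \<in> set (blow p)" "e \<in> set (blow q)" for e
  proof -
    have D: "fst p \<in> crossings D" "fst q \<in> crossings D" using assms unfolding crossings_def by auto
    from fst_blow[OF e(1)] fst_blow[OF e(2)] show False
      using assms(3) D labels_notin[of "Some p"] labels_notin[of "Some q"] labels_pairs[of "Some p" "Some q"]
      by (elim disjE conjE) (simp, metis insert_iff singletonD, metis insert_iff singletonD, blast)
  qed
  then show ?thesis by blast
qed

lemma consecutive_blow:
  assumes "consecutive D ps"
  shows "consecutive E (concat (map blow ps))"
  using assms
proof (induction ps rule: induct_list012)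
  case (2 p)
  then have "p \<in> set (word D)" using consecutive_in[OF dist(1), of "[p]"] by simp
  then show ?case using fold_consecutive[of p] consecutive_single[of p E] word_D by (auto simp: blow_def)
next
  case (3 p q ps)
  have "consecutive D (q # ps)" "consecutive D [p, q]"
    using consecutive_mid[OF dist(1), of "[p]" "q # ps" "[]"] consecutive_mid[OF dist(1), of "[]" "[p, q]" ps] 3(3) by simp_all
  then have 1: "consecutive E (concat (map blow (q # ps)))" and 2: "consecutive E (blow p @ [q])"
    using 3(2) consecutive_blow_pair by auto
  obtain t where t: "concat (map blow (q # ps)) = q # t" by (simp add: blow_def)
  have "p \<notin> set (q # ps)" "set (p # q # ps) \<subseteq> set (word D)"
    using consecutive_distinct[OF dist(1) 3(3)] consecutive_in[OF dist(1) 3(3)] by auto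
  then have "set (blow p) \<inter> set (blow k) = {}" if "k \<in> set (q # ps)" for k
    using blow_disjoint[of p k] that by auto
  then have "set (blow p) \<inter> set (concat (map blow (q # ps))) = {}" unfolding set_concat set_map by blast
  then have "set (blow p) \<inter> set t = {}" unfolding t by auto
  then have "consecutive E (blow p @ q # t)"
    using consecutive_join[OF dist(2) 2, of t] 1 unfolding t by blast
  then show ?case using t by simp
qed simp

end

section \<open>The cycle condition and the normalization\<close>

lemma block_other: "p \<noteq> z \<Longrightarrow> (\<And>l. l \<in> set L \<Longrightarrow> snd (gap l) \<noteq> p) \<Longrightarrow> block z L p = [p]"
  unfolding block_def using at_gap_empty[of L "(False, p)"] at_gap_empty[of L "(True, p)"] by fastforce

context knot_parity
begin

text \<open>
  An antiparallel finger that starts and ends next to the base point is a kink inside a kink.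
\<close>

lemma alpha_before_base:
  assumes E: "E \<in> K" and pot: "potentials E z M \<phi>" and z: "z \<in> set (word E)"
  shows "rel M (\<phi> False (False, z))"
proof -
  have "rel M (\<phi> False (False, z) - 0)"
  proof (rule potentials_single[OF pot])
    fix l assume l: "par l = False" "gap l = (False, z)" "proper E z [l]"
    let ?Q = "probed E z [l]"
    note d = gauss_distinct[OF gauss_probed[OF l(3)]]
    have "concat (map (block z [l]) [z]) = [(pst l, True)] @ [(neg l, True), (neg l, False)] @ [(pst l, False), z]"
      using l by (simp add: block_def at_gap_def over_def under_def)
    then have "consecutive ?Q [(neg l, True), (neg l, False)]"
      using consecutive_mid[OF d] consecutive_probed[OF l(3) consecutive_single[OF z]] by metis
    then have "kink ?Q (neg l) True" unfolding kink_def by simp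
    then show "rel ?Q (gen (neg l) - 0)" using rel_kink[OF probed_K[OF l(3) E]] by simp
  qed (use z in simp)
  then show ?thesis by simp
qed

text \<open>
  The finger has to reach back over the fold that precedes the base point.  When the fold is
  removed, its positive crossing becomes a kink.
\<close>

lemma alpha_fold_base:
  assumes E: "E \<in> K" and pot: "potentials E z M \<phi>"
    and f: "consecutive E (p # fold_word b c d @ [z])" and s: "c \<in> pos E \<longleftrightarrow> d \<notin> pos E"
    and nz: "fst z \<notin> {c, d}" "fst p \<notin> {c, d}"
  shows "rel M (\<phi> False (True, p))"
proof -
  note dE = gauss_distinct[OF K_gauss[OF E]]
  have inE: "set (p # fold_word b c d @ [z]) \<subseteq> set (word E)" using consecutive_in[OF dE f] .
  then have cd: "c \<in> crossings E" "d \<in> crossings E" using gauss_partner[OF K_gauss[OF E]] by auto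
  have pz: "p \<noteq> z" using consecutive_neq[OF dE, of "[]" p "fold_word b c d" z "[]"] f by simp
  have "rel M (\<phi> False (True, p) - 0)"
  proof (rule potentials_single[OF pot])
    fix l assume l: "par l = False" "gap l = (True, p)" "proper E z [l]"
    let ?Q = "probed E z [l]"
    have Q: "?Q \<in> K" using probed_K[OF l(3) E] .
    have gQ: "gauss_diagram ?Q" using gauss_probed[OF l(3)] .
    note d = gauss_distinct[OF gQ]
    have bl: "block z [l] e = [e]" if "fst e \<in> {c, d}" for e
      by (rule block_other) (use that nz l(2) in auto)
    have "concat (map (block z [l]) (p # fold_word b c d @ [z])) =
       [p, (neg l, False), (pst l, False)] @ fold_word b c d @ [(pst l, True), (neg l, True), z]"
      using l pz bl[of "(c, b)"] bl[of "(d, b)"] bl[of "(c, \<not> b)"] bl[of "(d, \<not> b)"]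
      by (simp add: block_def[of z _ p] block_def[of z _ z] at_gap_def over_def under_def)
    then have c1: "consecutive ?Q ([p, (neg l, False), (pst l, False)] @ fold_word b c d @ [(pst l, True), (neg l, True), z])"
      using consecutive_probed[OF l(3) f] by simp
    then have "consecutive ?Q (fold_word b c d)" by (rule consecutive_mid[OF d])
    moreover have "c \<in> pos ?Q \<longleftrightarrow> d \<notin> pos ?Q" using s pos_probed(3)[OF l(3), of l] cd by simp
    ultimately have "bigon ?Q c d" by (rule fold_bigon[OF gQ])
    then have red: "reduces ?Q (delete {c, d} ?Q)" using reduces.bigon[OF reduces.stop] by blast
    have "neg l \<notin> {c, d}" "pst l \<notin> {c, d}" using l(3) cd unfolding proper_def labels_def by auto
    then have "consecutive (delete {c, d} ?Q) ([p, (neg l, False)] @ [(pst l, False), (pst l, True)] @ [(neg l, True), z])"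
      using consecutive_delete[OF d c1, of "{c, d}"] nz by simp
    then have "consecutive (delete {c, d} ?Q) [(pst l, False), (pst l, True)]"
      by (rule consecutive_mid[OF gauss_distinct[OF gauss_delete[OF gQ]]])
    \<comment> \<open>Without the fold, both passages through the positive crossing follow each other.\<close>
    then have "kink (delete {c, d} ?Q) (pst l) False" unfolding kink_def by simp
    then have "rel ?Q (gen (pst l))"
      using rel_kink reduces_rel_up[OF red Q] reduces_K[OF red gQ] Q by blast
    moreover have "rel ?Q (gen (neg l) + gen (pst l))" using rel_probe[OF E l(3)] by simp
    ultimately show "rel ?Q (gen (neg l) - 0)" using rel_diff[OF Q, of "gen (neg l) + gen (pst l)" "gen (pst l)"] by simp
  qed (use inE in auto)
  then show ?thesis by simp
qed

text \<open>
  A parallel finger that starts and ends next to the base point is itself a fold, adjacent to the given one.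
\<close>

lemma gamma_before_base:
  assumes E: "E \<in> K" and pot: "potentials E z M \<phi>"
    and f: "consecutive E (fold_word b c d @ [z])" and s: "c \<in> pos E \<longleftrightarrow> d \<notin> pos E"
    and nz: "fst z \<notin> {c, d}"
  shows "rel M (\<phi> True (False, z) - gen c)"
proof (rule potentials_single[OF pot])
  note dE = gauss_distinct[OF K_gauss[OF E]]
  have inE: "set (fold_word b c d @ [z]) \<subseteq> set (word E)" using consecutive_in[OF dE f] .
  then show "snd (False, z) \<in> set (word E)" by auto
  have cd: "c \<in> crossings E" "d \<in> crossings E" using inE gauss_partner[OF K_gauss[OF E]] by auto
  fix l assume l: "par l = True" "gap l = (False, z)" "proper E z [l]"
  let ?Q = "probed E z [l]"
  have Q: "?Q \<in> K" using probed_K[OF l(3) E] .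
  note d = gauss_distinct[OF gauss_probed[OF l(3)]]
  have bl: "block z [l] e = [e]" if "fst e \<in> {c, d}" for e
    by (rule block_other) (use that nz l(2) in auto)
  have "concat (map (block z [l]) (fold_word b c d @ [z])) = [] @ (fold_word b c d @ fold_word True (neg l) (pst l)) @ [z]"
    using l bl[of "(c, b)"] bl[of "(d, b)"] bl[of "(c, \<not> b)"] bl[of "(d, \<not> b)"]
    by (simp add: block_def[of z _ z] at_gap_def over_def under_def)
  then have "consecutive ?Q (fold_word b c d @ fold_word True (neg l) (pst l))"
    using consecutive_mid[OF d] consecutive_probed[OF l(3) f] by metis
  then have "rel ?Q (gen c - gen (neg l))"
    by (rule adjacent_folds[OF Q]) (use s pos_probed[OF l(3), of l] cd in auto)
  then show "rel ?Q (gen (neg l) - gen c)" by (rule rel_sym[OF Q])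
qed

text \<open>
  The base point \<open>z\<close> needs separate treatment if it is the end \<open>n\<close> of the arc, because there the
  fingers start between the fold and \<open>n\<close>.
\<close>

lemma arc_potentials:
  assumes E: "E \<in> K" and pot: "potentials E z M \<phi>" and z: "z \<in> set (word E)"
    and f: "consecutive E (p # fold_word b c d @ [n])" and s: "c \<in> pos E \<longleftrightarrow> d \<notin> pos E"
    and nz: "fst z \<notin> {c, d}" "fst p \<notin> {c, d}" "fst n \<notin> {c, d}"
  shows "rel M (fold_potential \<phi> (True, p) - gen c)"
    and "rel M (fold_potential \<phi> (False, n) - gen c)"
    and "rel M (\<phi> False (True, p) - \<phi> False (False, n))"
proof -
  note dE = gauss_distinct[OF K_gauss[OF E]] and M = potentials_K[OF pot]
  have f1: "consecutive E [p, (c, b)]" "consecutive E (fold_word b c d)" "consecutive E (fold_word b c d @ [n])"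
    by (rule consecutive_sublist[OF dE f]; simp add: sublist_code)+
  have z1: "z \<notin> {(d, b), (c, \<not> b), (d, \<not> b)}" "(c, b) \<noteq> z" using nz(1) by auto
  have a: "rel M (\<phi> t (True, p) - \<phi> t (False, (c, b)))" for t
    using merge_adjacent[OF E pot f1(1) z1(2)] .
  have e: "rel M (fold_potential \<phi> (False, (c, b)) - gen c)" using fold_parity[OF E pot f1(2) s z1(1)] .
  show 1: "rel M (fold_potential \<phi> (True, p) - gen c)"
    using rel_add[OF M rel_diff[OF M a[of True] a[of False]] e] unfolding fold_potential_def by (simp add: algebra_simps)
  show "rel M (fold_potential \<phi> (False, n) - gen c)"
  proof (cases "n = z")
    case True
    have "rel M (\<phi> True (False, z) - gen c)"
      using gamma_before_base[OF E pot _ s nz(1)] f1(3) True by blast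
    from rel_diff[OF M this alpha_before_base[OF E pot z]] show ?thesis unfolding fold_potential_def True
      by (simp add: algebra_simps)
  next
    case False
    note m = merge_fold(2)[OF E pot f1(2) s z1(1) f1(3) False nz(3)]
    show ?thesis using rel_diff[OF M e rel_diff[OF M m[of True] m[of False]]]
      unfolding fold_potential_def by (simp add: algebra_simps)
  qed
  show "rel M (\<phi> False (True, p) - \<phi> False (False, n))"
  proof (cases "n = z")
    case True
    then show ?thesis using rel_diff[OF M alpha_fold_base[OF E pot _ s nz(1,2)] alpha_before_base[OF E pot z]] f by simp
  next
    case False
    from rel_trans[OF M a merge_fold(2)[OF E pot f1(2) s z1(1) f1(3) False nz(3)]] show ?thesis .
  qed
qed

lemma extended_K:
  assumes "extended D E x y" "D \<in> K" shows "E \<in> K"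
proof -
  interpret folded_diagram D "arcs D" E x y using assms(1) unfolding extended_def by unfold_locales
  show ?thesis using reduces_K[OF reduces_E gauss(2)] assms(2) by simp
qed

text \<open>
  The first relation is the conservation law for \<open>\<epsilon>\<close>, the second one the fact that the jumps of \<open>\<alpha>\<close>
  along the knot sum up to zero.  The base point is chosen at a point of \<open>D\<close>, so that both ends of every arc
  are governed by \<open>arc_potentials\<close>.
\<close>

lemma fold_cycle:
  assumes ext: "extended D E x y" and D: "D \<in> K" and v: "v \<in> crossings D"
    and n: "n = (v, v \<in> pos D)" and m: "m = (v, v \<notin> pos D)"
  shows "rel E (gen (x (Some n)) + gen (x (Some m)) - gen (x (Some (prev_point D n))) - gen (x (Some (prev_point D m))))"
   and fold_normal: "rel E (\<Sum>v\<in>crossings D. gen (x (Some (v, v \<notin> pos D))) - gen (x (Some (prev_point D (v, v \<in> pos D)))))"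
proof -
  interpret folded_diagram D "arcs D" E x y using ext unfolding extended_def by unfold_locales
  have E: "E \<in> K" using extended_K[OF ext D] .
  have inD: "(u, b) \<in> set (word D)" if "u \<in> crossings D" for u b using that by (simp add: gauss_partner[OF gauss(1)])
  have ne: "word D \<noteq> []" using inD[OF v] by (metis empty_iff list.set(1))
  then have aD: "arcs D = Some ` set (word D)" unfolding arcs_def by simp
  have l2: "2 \<le> length (word D)" using length_ge2[OF gauss(1) ne] .
  have z: "n \<in> set (word E)" using inD[OF v] word_D n by blast
  then obtain M \<phi> where pot: "potentials E n M \<phi>" using potentials_exist[OF E] by blast
  note M = potentials_K[OF pot]
  have nlab: "fst p \<notin> {x (Some q), y (Some q)}" if "p \<in> set (word D)" "q \<in> set (word D)" for p q
  proof -
    have "fst p \<in> crossings D" using that(1) unfolding crossings_def by (rule imageI)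
    then have "x (Some q) \<noteq> fst p" "y (Some q) \<noteq> fst p"
      using labels_notin[of "Some q"] that(2) aD by auto
    then show ?thesis by simp
  qed
  have arc: "rel M (fold_potential \<phi> (True, p) - gen (x (Some p))) \<and> rel M (fold_potential \<phi> (False, q) - gen (x (Some p)))
     \<and> rel M (\<phi> False (True, p) - \<phi> False (False, q))"
    if pq: "consecutive D [p, q]" for p q
  proof -
    have w: "p \<in> set (word D)" "q \<in> set (word D)" using consecutive_in[OF dist(1) pq] by auto
    then have S: "Some p \<in> arcs D" using aD by simp
    have "consecutive E (p # fold_of (Some p) @ [q])" using consecutive_blow_pair[OF pq] S unfolding blow_def by simp
    from arc_potentials[OF E pot z this sign[OF S] nlab[OF _ w(1)] nlab[OF w(1) w(1)] nlab[OF w(2) w(1)]]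
    show ?thesis using inD[OF v] n by blast
  qed
  have prev: "consecutive D [prev_point D p, p]" and nxt: "consecutive D [p, next_point D p]" if "p \<in> set (word D)" for p
    using consecutive_prev[OF dist(1) that l2] consecutive_next[OF dist(1) that l2] by auto
  have out: "rel M (fold_potential \<phi> (True, p) - gen (x (Some p)))" if "p \<in> set (word D)" for p using arc nxt that by blast
  have inc: "rel M (fold_potential \<phi> (False, p) - gen (x (Some (prev_point D p))))" if "p \<in> set (word D)" for p using arc prev that by blast
  have suppx: "{x (Some p)} \<subseteq> crossings E" if "p \<in> set (word D)" for p using labels_in[of "Some p"] that aD by auto
  have prevD: "prev_point D p \<in> set (word D)" if "p \<in> set (word D)" for p
    using consecutive_in[OF dist(1) prev[OF that]] by auto
  have up: "rel E f" if "rel M f" "supp f \<subseteq> crossings E" for f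
    using that pot reduces_rel[of M E f] unfolding potentials_def by blast
  have pv: "u \<in> pos E \<longleftrightarrow> u \<in> pos D" if "u \<in> crossings D" for u using pos_D[OF that] by simp
  have cE: "u \<in> crossings E" if "u \<in> crossings D" for u using crossings_E that by blast
  have w: "n \<in> set (word D)" "m \<in> set (word D)" using inD[OF v] n m by auto
  have "rel M (fold_potential \<phi> (True, n) + fold_potential \<phi> (True, m) - fold_potential \<phi> (False, n) - fold_potential \<phi> (False, m))"
    using potentials_conservation[OF E pot cE[OF v], of n m] pv[OF v] n m by simp
  from rel_add[OF M rel_diff[OF M this rel_add[OF M out[OF w(1)] out[OF w(2)]]] rel_add[OF M inc[OF w(1)] inc[OF w(2)]]]
  have "rel M (gen (x (Some n)) + gen (x (Some m)) - gen (x (Some (prev_point D n))) - gen (x (Some (prev_point D m))))"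
    by (simp add: algebra_simps)
  then show "rel E (gen (x (Some n)) + gen (x (Some m)) - gen (x (Some (prev_point D n))) - gen (x (Some (prev_point D m))))"
    by (rule up) (intro supp_diff supp_add; simp only: supp_gen suppx prevD w)
  let ?f = "\<lambda>u. gen (x (Some (u, u \<notin> pos D))) - gen (x (Some (prev_point D (u, u \<in> pos D))))"
  let ?j = "\<lambda>p. \<phi> False (True, p) - \<phi> False (False, p)"
  \<comment> \<open>The sum of the two jumps of \<open>\<alpha>\<close> at a crossing is its contribution to \<open>D \<cdot> \<delta>\<close>.\<close>
  have jump: "rel M (?f u - (?j (u, True) + ?j (u, False)))" if u: "u \<in> crossings D" for u
  proof -
    let ?n = "(u, u \<in> pos D)" and ?m = "(u, u \<notin> pos D)"
    have j: "?j (u, True) + ?j (u, False) = ?j ?n + ?j ?m" by (cases "u \<in> pos D") (simp_all add: add.commute)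
    have "rel M (?j ?n - fold_potential \<phi> (True, ?m))" "rel M (?j ?m + fold_potential \<phi> (False, ?n))"
      using potentials_jump[OF E pot cE[OF u], of ?n ?m] pv[OF u] by simp_all
    from rel_minus[OF M rel_add[OF M rel_add[OF M this] rel_diff[OF M out[OF inD[OF u], of "u \<notin> pos D"] inc[OF inD[OF u], of "u \<in> pos D"]]]]
    show ?thesis unfolding j by (simp add: algebra_simps)
  qed
  have bij: "bij_betw (next_point D) (set (word D)) (set (word D))"
  proof -
    have "inj_on (next_point D) (set (word D))"
      by (rule inj_onI) (metis nxt consecutive_unique_prev[OF dist(1)])
    moreover have "next_point D ` set (word D) \<subseteq> set (word D)"
      using consecutive_in[OF dist(1) nxt] by auto
    ultimately show ?thesis by (simp add: bij_betw_def endo_inj_surj)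
  qed
  have "(\<Sum>p\<in>set (word D). \<phi> False (False, next_point D p)) = (\<Sum>p\<in>set (word D). \<phi> False (False, p))"
    by (rule sum.reindex_bij_betw[OF bij, of "\<lambda>p. \<phi> False (False, p)"])
  moreover have "rel M (\<Sum>p\<in>set (word D). \<phi> False (True, p) - \<phi> False (False, next_point D p))"
    by (rule rel_sum[OF _ M]) (use arc nxt in auto)
  \<comment> \<open>The potential \<open>\<alpha>\<close> agrees at the two ends of every arc, so the sum of its jumps telescopes.\<close>
  ultimately have "rel M (\<Sum>p\<in>set (word D). ?j p)" by (simp only: sum_subtractf)
  moreover have "set (word D) = crossings D \<times> UNIV"
    using gauss_partner[OF gauss(1)] by auto
  then have "(\<Sum>p\<in>set (word D). ?j p) = (\<Sum>u\<in>crossings D. \<Sum>b\<in>UNIV. ?j (u, b))"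
    by (simp only: sum.cartesian_product' )
  moreover have "(\<Sum>b\<in>UNIV. ?j (u, b)) = ?j (u, True) + ?j (u, False)" for u
    by (simp only: UNIV_bool) (simp add: add.commute)
  ultimately have t: "rel M (\<Sum>u\<in>crossings D. ?j (u, True) + ?j (u, False))" by (simp only:)
  have "rel M (\<Sum>u\<in>crossings D. ?f u - (?j (u, True) + ?j (u, False)))"
    by (rule rel_sum[OF _ M]) (use jump in auto)
  then have "rel M ((\<Sum>u\<in>crossings D. ?f u) - (\<Sum>u\<in>crossings D. ?j (u, True) + ?j (u, False)))"
    by (simp only: sum_subtractf)
  from rel_add[OF M this t] have "rel M (\<Sum>u\<in>crossings D. ?f u)" by (simp only: diff_add_cancel)
  then show "rel E (\<Sum>u\<in>crossings D. ?f u)"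
    by (rule up) (intro supp_sum supp_diff; simp only: supp_gen suppx prevD inD)
qed

end

section \<open>Folds on corresponding arcs\<close>

lemma folded_subset:
  assumes f: "folded D S E x y" and T: "T \<subseteq> S"
  shows "folded D (S - T) (delete (x ` T \<union> y ` T) E) x y"
proof -
  interpret folded_diagram D S E x y using f by unfold_locales
  let ?X = "x ` T \<union> y ` T" and ?W = "delete (x ` T \<union> y ` T) E"
  have lab: "x a \<notin> ?X \<and> y a \<notin> ?X" if a: "a \<in> S - T" for a
  proof -
    have "{x a, y a} \<inter> {x i, y i} = {}" if "i \<in> T" for i using labels_pairs[of a i] a that T by blast
    then show ?thesis by blast
  qed
  have "?X \<union> (x ` (S - T) \<union> y ` (S - T)) = x ` S \<union> y ` S" using T by blast
  then have D: "D = delete (x ` (S - T) \<union> y ` (S - T)) ?W"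
    using D_eq by (simp only: delete_delete Un_commute)
  have "carries_fold ?W a (x a) (y a)" if a: "a \<in> S - T" for a
    unfolding carries_fold_def
  proof
    have aS: "a \<in> S" using a by blast
    let ?p = "case a of None \<Rightarrow> [] | Some p \<Rightarrow> [p]"
    have c: "consecutive E (?p @ fold_of a)" using carries_fold_side[OF carries[OF aS]] .
    have pn: "filter (\<lambda>p. fst p \<notin> ?X) ?p = ?p"
    proof (cases a)
      case (Some p)
      then have "p \<in> set (word D)" using in_S(1) aS unfolding arcs_def by (auto split: if_splits)
      then have "fst p \<in> crossings D" unfolding crossings_def by (rule imageI)
      moreover have "i \<in> T \<Longrightarrow> x i \<notin> crossings D \<and> y i \<notin> crossings D" for i
        using labels_notin[of i] T by blast
      ultimately have "fst p \<notin> ?X" by auto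
      then show ?thesis using Some by simp
    qed simp
    have "consecutive ?W (?p @ fold_of a)"
      using consecutive_delete[OF dist(2) c, of ?X] lab[OF a] unfolding filter_append pn by simp
    then show "\<exists>b. consecutive ?W (?p @ fold_word b (x a) (y a))" by blast
    show "(x a \<in> pos ?W) = (y a \<notin> pos ?W)" using sign[OF aS] lab[OF a] by simp
  qed
  then show ?thesis using f D unfolding folded_def
    by (auto intro: gauss_delete inj_on_subset)
qed

lemma created_crossings:
  assumes m: "is_move (Move D k D')"
    and k: "(\<exists>c b. k = R1_inc c b) \<or> (\<exists>c d. k = R2_inc c d)"
  shows "created k \<subseteq> crossings D' \<and> word D' \<noteq> []"
proof -
  have "created k \<subseteq> crossings D'" "created k \<noteq> {}"
    using m k kink_crossings[of D'] bigon_crossings[of D'] by (auto simp: is_move_def)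
  then show ?thesis unfolding crossings_def by auto
qed

text \<open>
  From the last old point before them both arcs are reached through created points only, so the one
  that is reached first leads to the other.  If no old point is left, all points are created.
\<close>

lemma pieces_comparable:
  assumes d: "distinct (word D')" and D: "D = delete (created k) D'"
    and c: "correspondent_inc D k D' a a1" "correspondent_inc D k D' a a2" "a1 \<noteq> a2" and ne: "word D' \<noteq> []"
  shows "\<exists>q ps. consecutive D' (q # ps) \<and> fst ` set ps \<subseteq> created k \<and> {a1, a2} = {Some q, Some (last (q # ps))}"
proof (cases a)
  case None
  then have "word D = []" using c(1) unfolding correspondent_inc_def arcs_def by (auto split: if_splits)
  then have all: "fst p \<in> created k" if "p \<in> set (word D')" for p
    using that unfolding D word_delete by (auto simp: filter_empty_conv)
  have "a1 \<in> arcs D'" "a2 \<in> arcs D'" using c unfolding correspondent_inc_def by auto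
  then obtain q1 q2 where q: "a1 = Some q1" "a2 = Some q2" "q1 \<in> set (word D')" "q2 \<in> set (word D')"
    using ne unfolding arcs_def by auto
  obtain us where us: "cyc (word D') (q1 # us)" using cut_at_in[OF q(3)] cyc_cut_at by metis
  have "q2 \<in> set us" using cyc_set[OF us] q c(3) by auto
  then obtain us1 us2 where u: "us = us1 @ q2 # us2" by (metis split_list)
  have "cyc (word D') ((q1 # us1 @ [q2]) @ us2)" using us u by simp
  then have cc: "consecutive D' (q1 # us1 @ [q2])" using consecutive_iff[OF d] by blast
  then have "fst ` set (us1 @ [q2]) \<subseteq> created k" using all consecutive_in[OF d cc] by auto
  then show ?thesis using cc q by (intro exI[of _ q1] exI[of _ "us1 @ [q2]"]) simp
next
  case (Some q)
  have main: ?thesis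
    if p: "consecutive D' (q # ps1)" "consecutive D' (q # ps2)" "fst ` set ps2 \<subseteq> created k" "length ps1 \<le> length ps2"
      and a: "{a1, a2} = {Some (last (q # ps1)), Some (last (q # ps2))}" for ps1 ps2
  proof -
    obtain r where r: "ps2 = ps1 @ r" using consecutive_append_unique[OF d p(1,2,4)] by blast
    have "q # ps2 = butlast (q # ps1) @ (last (q # ps1) # r)" using r
      by (metis append.assoc append_Cons append_Nil append_butlast_last_id list.distinct(1))
    then have "consecutive D' (last (q # ps1) # r)" using p(2) consecutive_mid[OF d, of "butlast (q # ps1)" "last (q # ps1) # r" "[]"] by simp
    moreover have "last (last (q # ps1) # r) = last (q # ps2)" using r by (cases r) auto
    moreover have "fst ` set r \<subseteq> created k" using p(3) r by auto
    ultimately show ?thesis using a by metis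
  qed
  obtain ps1 where p1: "consecutive D' (q # ps1)" "fst ` set ps1 \<subseteq> created k" "a1 = Some (last (q # ps1))"
    using c(1) Some unfolding correspondent_inc_def by auto
  obtain ps2 where p2: "consecutive D' (q # ps2)" "fst ` set ps2 \<subseteq> created k" "a2 = Some (last (q # ps2))"
    using c(2) Some unfolding correspondent_inc_def by auto
  show ?thesis
  proof (cases "length ps1 \<le> length ps2")
    case True
    then show ?thesis using main[OF p1(1) p2(1,2)] p1(3) p2(3) by simp
  next
    case False
    then show ?thesis using main[OF p2(1) p1(1,2)] p1(3) p2(3) by (simp add: insert_commute)
  qed
qed

context knot_parity
begin

text \<open>
  All other folds are removed, and then the crossings in \<open>X\<close>.  This makes the two folds
  adjacent.  The second step is possible if the two folds do not obstruct the bigon or the loop that is to be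
  removed, which is the last hypothesis.
\<close>

lemma folds_merge:
  assumes ext: "extended D E x y" and D: "D \<in> K"
    and q: "consecutive D (q1 # ps @ [q2])" "fst ` set (ps @ [q2]) \<subseteq> X" and X: "X \<subseteq> crossings D"
    and red: "\<And>W. folded_diagram D {Some q1, Some q2} W x y \<Longrightarrow> reduces W (delete X W)"
  shows "rel E (gen (x (Some q1)) - gen (x (Some q2)))"
proof -
  interpret e: folded_diagram D "arcs D" E x y using ext unfolding extended_def by unfold_locales
  have E: "E \<in> K" using extended_K[OF ext D] .
  have dq: "distinct (q1 # ps @ [q2])" using consecutive_distinct[OF e.dist(1) q(1)] .
  have "q1 \<in> set (word D)" "q2 \<in> set (word D)" using consecutive_in[OF e.dist(1) q(1)] by auto
  then have qa: "{Some q1, Some q2} \<subseteq> arcs D" unfolding arcs_def by auto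
  define T where "T = arcs D - {Some q1, Some q2}"
  define W where "W = delete (x ` T \<union> y ` T) E"
  have "arcs D - T = {Some q1, Some q2}" unfolding T_def using qa by blast
  then have "folded D {Some q1, Some q2} W x y"
    using folded_subset[OF e.folded, of T] unfolding W_def T_def by auto
  then interpret w: folded_diagram D "{Some q1, Some q2}" W x y by unfold_locales
  have rW: "reduces E W" using e.reduces_folds[of T] unfolding W_def T_def by blast
  then have W: "W \<in> K" using reduces_K e.gauss(2) E by blast
  have rX: "reduces W (delete X W)" by (rule red) unfold_locales
  then have V: "delete X W \<in> K" using reduces_K w.gauss(2) W by blast
  have lab: "x (Some q1) \<notin> X" "y (Some q1) \<notin> X" "x (Some q2) \<notin> X" "y (Some q2) \<notin> X"
    using w.labels_notin X by blast+
  have mid: "concat (map w.blow us) = us" if "set us \<subseteq> set ps" for us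
    using that dq by (induction us) (auto simp: w.blow_def)
  have "concat (map w.blow (q1 # ps @ [q2])) = q1 # w.fold_of (Some q1) @ ps @ q2 # w.fold_of (Some q2)"
    using mid[of ps] by (simp add: w.blow_def)
  then have "consecutive W (q1 # w.fold_of (Some q1) @ ps @ q2 # w.fold_of (Some q2))"
    using w.consecutive_blow[OF q(1)] by metis
  note c = consecutive_delete[OF w.dist(2) this, of X]
  have "filter (\<lambda>p. fst p \<notin> X) ps = []" "fst q2 \<in> X" using q(2) by (auto simp: filter_empty_conv)
  then have "filter (\<lambda>p. fst p \<notin> X) (q1 # w.fold_of (Some q1) @ ps @ q2 # w.fold_of (Some q2))
     = (if fst q1 \<in> X then [] else [q1]) @ (w.fold_of (Some q1) @ w.fold_of (Some q2)) @ []"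
    using lab by simp
  then have c2: "consecutive (delete X W) (w.fold_of (Some q1) @ w.fold_of (Some q2))"
    using c consecutive_mid[OF gauss_distinct[OF gauss_delete[OF w.gauss(2)]]] by metis
  have "rel (delete X W) (gen (x (Some q1)) - gen (x (Some q2)))"
    by (rule adjacent_folds[OF V c2]) (use w.sign[of "Some q1"] w.sign[of "Some q2"] lab in auto)
  then show ?thesis using reduces_rel_up[OF rX W] reduces_rel_up[OF rW E] by blast
qed

lemma folds_merge_kink:
  assumes ext: "extended D E x y" and D: "D \<in> K" and k: "kink D c b"
    and q: "consecutive D (q1 # ps @ [q2])" "fst ` set (ps @ [q2]) \<subseteq> {c}"
    and i: "q1 \<noteq> (c, b)" "q2 \<noteq> (c, b)"
  shows "rel E (gen (x (Some q1)) - gen (x (Some q2)))"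
proof (rule folds_merge[OF ext D q])
  have gD: "gauss_diagram D" using K_gauss[OF D] .
  show "{c} \<subseteq> crossings D" using kink_crossings[OF gD k] by simp
  fix W assume "folded_diagram D {Some q1, Some q2} W x y"
  then interpret w: folded_diagram D "{Some q1, Some q2}" W x y .
  have "w.blow (c, b) = [(c, b)]" using i unfolding w.blow_def by simp
  then have "consecutive W [(c, b), (c, \<not> b)]"
    using w.consecutive_blow_pair[of "(c, b)" "(c, \<not> b)"] k unfolding kink_def by simp
  then have "kink W c b" unfolding kink_def .
  then show "reduces W (delete {c} W)" using reduces.kink[OF reduces.stop] by blast
qed

lemma folds_merge_bigon:
  assumes ext: "extended D E x y" and D: "D \<in> K" and k: "bigon D c d"
    and q: "consecutive D (q1 # ps @ [q2])" "fst ` set (ps @ [q2]) \<subseteq> {c, d}"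
    and i: "Some q1 \<notin> inner_arcs D (R2_inc c d)" "Some q2 \<notin> inner_arcs D (R2_inc c d)"
  shows "rel E (gen (x (Some q1)) - gen (x (Some q2)))"
proof (rule folds_merge[OF ext D q])
  have gD: "gauss_diagram D" using K_gauss[OF D] .
  show cd: "{c, d} \<subseteq> crossings D" using bigon_crossings[OF gD k] by simp
  fix W assume "folded_diagram D {Some q1, Some q2} W x y"
  then interpret w: folded_diagram D "{Some q1, Some q2}" W x y .
  have b: "consecutive W [p, r]" if "consecutive D [p, r]" "Some p \<in> inner_arcs D (R2_inc c d)" for p r
  proof -
    have "w.blow p = [p]" using that(2) i unfolding w.blow_def by auto
    then show ?thesis using w.consecutive_blow_pair[OF that(1)] by simp
  qed
  have u: "consecutive W [(c, True), (d, True)]" by (rule b) (use k in \<open>simp_all add: bigon_def\<close>)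
  have l: "consecutive W [(c, False), (d, False)] \<or> consecutive W [(d, False), (c, False)]"
  proof (cases "consecutive D [(c, False), (d, False)]")
    case True
    then show ?thesis using b[OF True] by simp
  next
    case False
    then have "consecutive D [(d, False), (c, False)]" using k unfolding bigon_def by blast
    then show ?thesis using b[of "(d, False)" "(c, False)"] False by simp
  qed
  have "bigon W c d" using u l k w.pos_D[of c] w.pos_D[of d] cd unfolding bigon_def by simp
  then show "reduces W (delete {c, d} W)" using reduces.bigon[OF reduces.stop] by blast
qed

text \<open>
  Arcs inside the region of the move are not correspondent to anything; therefore the folds lie outside
  the bigon or the loop and do not obstruct its removal.
\<close>

lemma corresponding_folds:
  assumes ext: "extended D' E' x y" and D': "D' \<in> K" and m: "is_move (Move D k D')"
    and k: "(\<exists>c b. k = R1_inc c b) \<or> (\<exists>c d. k = R2_inc c d)"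
    and c: "correspondent_inc D k D' a a1" "correspondent_inc D k D' a a2"
  shows "rel E' (gen (x a1) - gen (x a2))"
proof (cases "a1 = a2")
  case True
  then show ?thesis using rel_zero[OF extended_K[OF ext D']] by simp
next
  case False
  have d: "distinct (word D')" using gauss_distinct[OF K_gauss[OF D']] .
  have D: "D = delete (created k) D'" using m k unfolding is_move_def by auto
  have ne: "word D' \<noteq> []" using created_crossings[OF m k] by blast
  obtain q ps where q: "consecutive D' (q # ps)" "fst ` set ps \<subseteq> created k" "{a1, a2} = {Some q, Some (last (q # ps))}"
    using pieces_comparable[OF d D c False ne] by blast
  have q3: "a1 = Some q \<and> a2 = Some (last (q # ps)) \<or> a1 = Some (last (q # ps)) \<and> a2 = Some q"
    using q(3) unfolding doubleton_eq_iff .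
  have "ps \<noteq> []"
  proof
    assume "ps = []"
    then show False using q3 False by simp
  qed
  then obtain us r where p: "ps = us @ [r]" by (cases ps rule: rev_cases) auto
  have qq: "consecutive D' (q # us @ [r])" "fst ` set (us @ [r]) \<subseteq> created k" using q(1,2) unfolding p by simp_all
  from p have aa: "a1 = Some q \<and> a2 = Some r \<or> a1 = Some r \<and> a2 = Some q" using q3 by simp
  have "a1 \<notin> inner_arcs D' k" "a2 \<notin> inner_arcs D' k" using c unfolding correspondent_inc_def by auto
  then have i: "Some q \<notin> inner_arcs D' k" "Some r \<notin> inner_arcs D' k" using aa by metis+
  have "rel E' (gen (x (Some q)) - gen (x (Some r)))"
  proof (cases "\<exists>c b. k = R1_inc c b")
    case True
    then obtain c b where k: "k = R1_inc c b" by blast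
    have kk: "kink D' c b" using m k unfolding is_move_def by simp
    have "q \<noteq> (c, b)" "r \<noteq> (c, b)" using i unfolding k by simp_all
    then show ?thesis by (rule folds_merge_kink[OF ext D' kk qq(1) qq(2)[unfolded k created.simps]])
  next
    case False
    then obtain c d where k': "k = R2_inc c d" using k by blast
    have "bigon D' c d" using m k' unfolding is_move_def by simp
    then show ?thesis
      by (rule folds_merge_bigon[OF ext D' _ qq(1) qq(2)[unfolded k' created.simps] i[unfolded k']])
  qed
  then have "rel E' (gen (x (Some q)) - gen (x (Some r)))" "rel E' (gen (x (Some r)) - gen (x (Some q)))"
    using rel_sym[OF extended_K[OF ext D']] by blast+
  then show ?thesis using aa by (elim disjE conjE) simp_all
qed

text \<open>
  The move is performed on \<open>E\<close> away from the folds.  Hence in \<open>F\<close> the fold on \<open>a\<close> is preceded by the start of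
  \<open>a\<close> and perhaps by created points.  The last point before the fold is the start of the arc \<open>s\<close>.
\<close>

lemma kept_fold:
  assumes ext: "extended D E x y" and m: "is_move (Move D k D')" and mE: "is_move (Move E k F)"
    and k: "(\<exists>c b. k = R1_inc c b) \<or> (\<exists>c d. k = R2_inc c d)"
    and f: "folded D' S F x' y'" and im: "(\<lambda>a. (x' a, y' a)) ` S = (\<lambda>a. (x a, y a)) ` arcs D"
    and a: "a \<in> arcs D" and s: "s \<in> S" "x' s = x a" "y' s = y a"
  shows "correspondent_inc D k D' a s"
proof -
  interpret e: folded_diagram D "arcs D" E x y using ext unfolding extended_def by unfold_locales
  interpret f: folded_diagram D' S F x' y' using f by unfold_locales
  let ?X = "created k"
  have E: "E = delete ?X F" and D: "D = delete ?X D'" using m mE k unfolding is_move_def by auto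
  have ne: "word D' \<noteq> []" using created_crossings[OF m k] by blast
  obtain q where q: "s = Some q" "q \<in> set (word D')" using f.S_Some[OF s(1) ne] by blast
  have X: "?X \<subseteq> crossings D'" using created_crossings[OF m k] by blast
  have fq: "consecutive F (q # fold_word (f.side s) (x a) (y a))" using f.fold_consecutive[of q] s q by simp
  have labX: "x a \<notin> ?X" "y a \<notin> ?X" using f.labels_notin[OF s(1)] s X by auto
  have inner: "\<exists>e. fst e \<in> ?X \<and> consecutive F [p, e]" if "Some p \<in> inner_arcs D' k" for p
    using k
  proof
    assume "\<exists>c b. k = R1_inc c b"
    then obtain c b where k: "k = R1_inc c b" by blast
    then have "p = (c, b)" using that by simp
    moreover have "consecutive F [(c, b), (c, \<not> b)]" using mE k by (simp add: is_move_def kink_def)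
    ultimately show ?thesis using k by auto
  next
    assume "\<exists>c d. k = R2_inc c d"
    then obtain c d where k: "k = R2_inc c d" by blast
    have bF: "bigon F c d" and bD: "bigon D' c d" using m mE k by (simp_all add: is_move_def)
    have cd: "c \<noteq> d" using consecutive_distinct[OF f.dist(1)] bD unfolding bigon_def by fastforce
    have ncd: "c \<in> crossings D'" "d \<in> crossings D'" using X k by auto
    have down: "consecutive D' [(u, False), (v, False)]" if "consecutive F [(u, False), (v, False)]" "{u, v} = {c, d}" for u v
    proof -
      have "u \<in> crossings D'" "v \<in> crossings D'" using that(2) ncd by (auto simp: doubleton_eq_iff)
      then have "u \<notin> x' ` S \<union> y' ` S" "v \<notin> x' ` S \<union> y' ` S" using f.labels_notin by auto
      then show ?thesis using consecutive_delete[OF f.dist(2) that(1), of "x' ` S \<union> y' ` S", folded f.D_eq] by simp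
    qed
    show ?thesis
    proof (cases "p = (c, True)")
      case True
      then show ?thesis using bF k unfolding bigon_def by auto
    next
      case False
      have "\<not> (consecutive D' [(c, False), (d, False)] \<and> consecutive D' [(d, False), (c, False)])"
      proof
        assume "consecutive D' [(c, False), (d, False)] \<and> consecutive D' [(d, False), (c, False)]"
        then have "set (word D') = {(c, False), (d, False)}" using two_cycle[OF f.dist(1)] cd by blast
        moreover have "(c, True) \<in> set (word D')" using ncd by (simp add: gauss_partner[OF f.gauss(1)])
        ultimately show False by simp
      qed
      moreover have "consecutive F [(c, False), (d, False)] \<or> consecutive F [(d, False), (c, False)]" using bF unfolding bigon_def by blast
      ultimately have "consecutive F [(c, False), (d, False)] \<and> p = (c, False) \<or> consecutive F [(d, False), (c, False)] \<and> p = (d, False)"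
        using False that k down[of c d] down[of d c] by (auto split: if_splits)
      then show ?thesis using k by auto
    qed
  qed
  have notinner: "s \<notin> inner_arcs D' k"
  proof
    assume "s \<in> inner_arcs D' k"
    then obtain e where e: "fst e \<in> ?X" "consecutive F [q, e]" using inner q(1) by blast
    have "consecutive F [q, (x a, f.side s)]"
      by (rule consecutive_sublist[OF f.dist(2) fq]) (simp add: sublist_code)
    then have "e = (x a, f.side s)" using consecutive_unique_next[OF f.dist(2) e(2)] by blast
    then show False using e(1) labX by simp
  qed
  have piece: "piece_of D' ?X a s"
  proof (cases a)
    case (Some p)
    let ?b = "e.side a" and ?b' = "f.side s"
    have fp: "consecutive E (p # fold_word ?b (x a) (y a))" using e.fold_consecutive[of p] a Some by simp
    have "p \<in> set (word D)" using a Some unfolding arcs_def by (auto split: if_splits)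
    then have pD: "fst p \<in> crossings D" unfolding crossings_def by (rule imageI)
    have pE: "consecutive E [p, (x a, ?b)]" by (rule consecutive_sublist[OF e.dist(2) fp]) (simp add: sublist_code)
    \<comment> \<open>With the other choice of the upper segment, \<open>(x a, ?b)\<close> would follow a point of the fold on \<open>a\<close>,
      but its predecessor in \<open>E\<close> is \<open>p\<close>.\<close>
    have "?b' = ?b"
    proof (rule ccontr)
      assume "?b' \<noteq> ?b"
      then have b: "?b' = (\<not> ?b)" by (cases ?b'; cases ?b) simp_all
      have "consecutive F (fold_word ?b' (x a) (y a))"
        using consecutive_mid[OF f.dist(2), of "[q]" "fold_word ?b' (x a) (y a)" "[]"] fq by simp
      then have "consecutive E (fold_word ?b' (x a) (y a))"
        using consecutive_delete[OF f.dist(2), of "fold_word ?b' (x a) (y a)" ?X] labX E by simp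
      then have "consecutive E (fold_word (\<not> ?b) (x a) (y a))" unfolding b .
      then have "consecutive E [(y a, \<not> ?b), (x a, ?b)]"
        by (rule consecutive_sublist[OF e.dist(2)]) (simp add: sublist_code)
      then have "p = (y a, \<not> ?b)" using consecutive_unique_prev[OF e.dist(2) pE] by blast
      then show False using pD e.labels_notin[OF a] by simp
    qed
    then have fq': "consecutive F (q # fold_word ?b (x a) (y a))" using fq by simp
    obtain us where us: "consecutive F (p # us @ [(x a, ?b)])" "fst ` set us \<subseteq> ?X"
      using lift_pair[OF f.dist(2), of ?X p "(x a, ?b)"] pE E by auto
    have "consecutive F [last (p # us), (x a, ?b)]"
      by (rule consecutive_last[OF f.dist(2) us(1)])
    moreover have "consecutive F [q, (x a, ?b)]"
      by (rule consecutive_sublist[OF f.dist(2) fq']) (simp add: sublist_code)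
    ultimately have "last (p # us) = q" using consecutive_unique_prev[OF f.dist(2)] by blast
    moreover have "consecutive D' (p # us)"
    proof -
      have "x' ` S = x ` arcs D" "y' ` S = y ` arcs D"
        using arg_cong[OF im, of "image fst"] arg_cong[OF im, of "image snd"] by (simp_all add: image_image)
      then have "fst p \<notin> x' ` S \<union> y' ` S" using pD e.labels_notin by auto
      moreover have "fst u \<notin> x' ` S \<union> y' ` S" if "u \<in> set us" for u
      proof -
        have "fst u \<in> crossings D'" using us(2) that X by auto
        moreover have "i \<in> S \<Longrightarrow> x' i \<notin> crossings D' \<and> y' i \<notin> crossings D'" for i
          using f.labels_notin[of i] by blast
        ultimately show ?thesis by auto
      qed
      ultimately have fl: "filter (\<lambda>r. fst r \<notin> x' ` S \<union> y' ` S) (p # us) = p # us" by (simp add: filter_id_conv)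
      have "consecutive F (p # us)" using us(1) consecutive_mid[OF f.dist(2), of "[]" "p # us" "[(x a, ?b)]"] by simp
      from consecutive_delete[OF f.dist(2) this, of "x' ` S \<union> y' ` S", folded f.D_eq, unfolded fl] show ?thesis .
    qed
    ultimately have "consecutive D' (p # us) \<and> fst ` set us \<subseteq> ?X \<and> s = Some (last (p # us))"
      using us(2) q(1) by simp
    then show ?thesis unfolding Some piece_of.simps by blast
  qed simp
  show ?thesis unfolding correspondent_inc_def using a s(1) f.in_S(1) notinner piece by blast
qed

end

section \<open>Transport along sequences of moves\<close>

fun path :: "diagram \<Rightarrow> move list \<Rightarrow> bool" where
  "path D [] \<longleftrightarrow> True"
| "path D (f # fs) \<longleftrightarrow> source f = D \<and> is_move f \<and> path (target f) fs"

fun end_of :: "diagram \<Rightarrow> move list \<Rightarrow> diagram" where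
  "end_of D [] = D"
| "end_of D (f # fs) = end_of (target f) fs"

lemma path_append [simp]: "path D (fs @ gs) \<longleftrightarrow> path D fs \<and> path (end_of D fs) gs"
  by (induction fs arbitrary: D) auto

lemma end_of_append [simp]: "end_of D (fs @ gs) = end_of (end_of D fs) gs"
  by (induction fs arbitrary: D) auto

text \<open>
  \<open>X\<close> consists of crossings that survive all the moves with their labels, so that (P0) can be composed.
\<close>

definition fixes_crossings :: "nat set \<Rightarrow> move list \<Rightarrow> bool" where
  "fixes_crossings X fs \<longleftrightarrow> (\<forall>f\<in>set fs. X \<subseteq> crossings (source f) \<and> X \<subseteq> crossings (target f)
      \<and> (\<forall>v\<in>X. crossing_map (kind f) v = v))"

lemma is_move_id: "gauss_diagram D \<Longrightarrow> is_move (Move D (Isotopy id) D)"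
proof -
  assume "gauss_diagram D"
  moreover have "map (map_prod id id) (word D) = word D" by (simp add: prod.map_id0)
  then have "word D = rotate 0 (map (map_prod id id) (word D))" by simp
  then have "\<exists>n. word D = rotate n (map (map_prod id id) (word D))" by blast
  ultimately show ?thesis unfolding is_move_def by simp
qed

text \<open>
  Only second moves and trivial isotopies occur, and they create crossings without touching the old ones.
\<close>

lemma fold_sequence_path:
  assumes "fold_sequence D x y S E fs T F"
  shows "path E fs \<and> end_of E fs = F \<and> folded D S E x y \<and> folded D T F x y
    \<and> crossings E \<subseteq> crossings F \<and> fixes_crossings (crossings E) fs"
  using assms
proof (induction rule: fold_sequence.induct)
  case start
  then show ?case by (simp add: fixes_crossings_def)
next
  case (detour fs T F)
  then have "gauss_diagram F" unfolding folded_def by blast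
  then show ?case using detour.IH is_move_id by (auto simp: fixes_crossings_def)
next
  case (fold fs T F a F')
  interpret f: folded_diagram D "insert a T" F' x y using fold.hyps by unfold_locales
  have "is_move (Move F (R2_inc (x a) (y a)) F')"
    using is_move_bigon_inc[OF f.gauss(2) f.bigon[of a]] fold.hyps by simp
  moreover have "crossings F \<subseteq> crossings F'" using fold.hyps by auto
  ultimately show ?case using fold.IH fold.hyps(3) by (auto simp: fixes_crossings_def)
qed

context knot_parity
begin

lemma move_group_rel:
  assumes "is_move f" "source f \<in> K"
  shows "group_rel (G (source f)) (G (target f)) (A f)"
proof (rule partial_iso_group_rel)
  show "partial_iso (G (source f)) (G (target f)) (A f)" using iso assms by blast
  show "group (G (source f))" "group (G (target f))"
    using group K_move[OF assms(1)] assms(2) by (auto simp: comm_group_def)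
qed

lemma transport_group_rel:
  assumes "path D fs" "D \<in> K"
  shows "group_rel (G D) (G (end_of D fs)) (transport G A D fs)"
  using assms
proof (induction fs arbitrary: D)
  case Nil
  then have "group (G D)" using group[of D] by (simp add: comm_group_def)
  from group_rel_Id[OF this] show ?case by simp
next
  case (Cons f fs)
  then have f: "source f = D" "is_move f" "path (target f) fs" "target f \<in> K" using K_move[of f] by auto
  then show ?case using group_rel_O[OF move_group_rel Cons.IH[OF f(3,4)]] Cons.prems by auto
qed

lemma transport_parity:
  assumes "path D fs" "D \<in> K" "fixes_crossings X fs" "v \<in> X" "X \<subseteq> crossings D"
  shows "(P D v, P (end_of D fs) v) \<in> transport G A D fs"
  using assms
proof (induction fs arbitrary: D)
  case Nil
  then show ?case using parity_closed by auto
next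
  case (Cons f fs)
  then have f: "source f = D" "is_move f" "path (target f) fs" "target f \<in> K" "X \<subseteq> crossings (target f)"
    "v \<in> crossings (source f)" "crossing_map (kind f) v = v" "fixes_crossings X fs"
    using K_move[of f] unfolding fixes_crossings_def by auto
  have "(P D v, P (target f) v) \<in> A f" using P0[OF f(2), of v] f Cons.prems by auto
  moreover have "(P (target f) v, P (end_of (target f) fs) v) \<in> transport G A (target f) fs"
    by (rule Cons.IH) (use f Cons.prems in auto)
  ultimately show ?case by auto
qed

text \<open>
  (P0) carries the parity of the fold on \<open>a\<close> to the end of the sequence.  There the same crossings
  form a fold on an arc \<open>s\<close> that corresponds to \<open>a\<close> but need not be \<open>a'\<close>; all folds on arcs corresponding to
  \<open>a\<close> have the same parity.
\<close>

lemma extended_sequence_parity: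
  assumes f: "is_move (Move D k D')" and k: "(\<exists>c b. k = R1_inc c b) \<or> (\<exists>c d. k = R2_inc c d)" and D: "D \<in> K"
    and s: "extended_sequence (Move D k D') E x y E' x' y' fs" and ext': "extended D' E' x' y'"
  shows "group_rel (G E) (G E') (transport G A E fs)"
    and "correspondent_inc D k D' a a' \<Longrightarrow> (P E (x a), P E' (x' a')) \<in> transport G A E fs"
proof -
  have ext: "extended D E x y" using s unfolding extended_sequence_def by simp
  obtain S F n es where m: "is_move (Move E k F)" and fS: "folded D' S F x' y'"
    and im: "(\<lambda>a. (x' a, y' a)) ` S = (\<lambda>a. (x a, y a)) ` arcs D"
    and es: "fold_sequence D' x' y' S F es (arcs D') E'"
    and fs: "fs = replicate n (Move E (Isotopy id) E) @ Move E k F # es"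
    using s unfolding extended_sequence_def by auto
  interpret e: folded_diagram D "arcs D" E x y using ext unfolding extended_def by unfold_locales
  have E: "E \<in> K" using extended_K[OF ext D] .
  have D': "D' \<in> K" using K_move[OF f] D by simp
  note es' = fold_sequence_path[OF es]
  have idm: "is_move (Move E (Isotopy id) E)" using is_move_id[OF e.gauss(2)] .
  have rep: "path E (replicate n (Move E (Isotopy id) E))" "end_of E (replicate n (Move E (Isotopy id) E)) = E" for n
    by (induction n) (simp_all add: idm)
  have p: "path E fs" "end_of E fs = E'" unfolding fs using rep m es' by auto
  have cEF: "crossings E \<subseteq> crossings F" using m k unfolding is_move_def by auto
  have km: "crossing_map k v = v" for v using k by auto
  have fx: "fixes_crossings (crossings E) fs"
    unfolding fixes_crossings_def
  proof (intro ballI)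
    fix h assume "h \<in> set fs"
    then consider "h = Move E (Isotopy id) E" | "h = Move E k F" | "h \<in> set es" unfolding fs by auto
    then show "crossings E \<subseteq> crossings (source h) \<and> crossings E \<subseteq> crossings (target h) \<and>
      (\<forall>v\<in>crossings E. crossing_map (kind h) v = v)"
    proof cases
      case 3
      then show ?thesis using es' cEF unfolding fixes_crossings_def by blast
    qed (use cEF km in auto)
  qed
  show "group_rel (G E) (G E') (transport G A E fs)" using transport_group_rel[OF p(1) E] p(2) by simp
  assume c: "correspondent_inc D k D' a a'"
  then have a: "a \<in> arcs D" unfolding correspondent_inc_def by blast
  have "(x a, y a) \<in> (\<lambda>a. (x' a, y' a)) ` S" unfolding im using a by (rule imageI)
  then obtain s where s: "s \<in> S" "x' s = x a" "y' s = y a" by (elim imageE) simp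
  have xa: "x a \<in> crossings E" using e.labels_in[OF a] by blast
  have "correspondent_inc D k D' a s" by (rule kept_fold[OF ext f m k fS im a s])
  then have "rel E' (gen (x' s) - gen (x' a'))" using corresponding_folds[OF ext' D' f k _ c] by blast
  moreover have E': "E' \<in> K" using extended_K[OF ext' D'] .
  moreover have "x' s \<in> crossings E'" "x' a' \<in> crossings E'"
  proof -
    interpret e': folded_diagram D' "arcs D'" E' x' y' using ext' unfolding extended_def by unfold_locales
    have "s \<in> arcs D'" "a' \<in> arcs D'" using c s(1) fS unfolding correspondent_inc_def folded_def by auto
    then show "x' s \<in> crossings E'" "x' a' \<in> crossings E'" using e'.labels_in by auto
  qed
  ultimately have "P E' (x' s) = P E' (x' a')" using rel_eq val_gen by metis
  then show "(P E (x a), P E' (x' a')) \<in> transport G A E fs"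
    using transport_parity[OF p(1) E fx xa order_refl] p(2) s(2) by simp
qed

text \<open>
  All three parts of the sequence fix the crossings of \<open>F\<close>, which include the folds on the arcs
  other than the sides of the triangle.
\<close>

lemma R3_sequence_parity:
  assumes D: "D \<in> K"
    and e: "fold_sequence D x y (arcs D - sides D u v w) F e (arcs D) E"
    and e': "fold_sequence D' x' y' (arcs D' - sides D' u v w) F' e' (arcs D') E'"
    and m: "is_move (Move F (R3 u v w) F')"
    and l: "\<And>a. a \<in> arcs D - sides D u v w \<Longrightarrow> x' (map_option (side_swap u v w) a) = x a"
    and R: "R = (transport G A F e)\<inverse> O A (Move F (R3 u v w) F') O transport G A F' e'"
  shows "group_rel (G E) (G E') R"
    and "a \<in> arcs D - sides D u v w \<Longrightarrow> a' = map_option (side_swap u v w) a \<Longrightarrow> (P E (x a), P E' (x' a')) \<in> R"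
proof -
  note p = fold_sequence_path[OF e] and p' = fold_sequence_path[OF e']
  interpret f: folded_diagram D "arcs D" E x y using p by unfold_locales blast
  interpret f0: folded_diagram D "arcs D - sides D u v w" F x y using p by unfold_locales blast
  have F: "F \<in> K" using reduces_K[OF f0.reduces_E f0.gauss(2)] D by simp
  have F': "F' \<in> K" using K_move[OF m] F by simp
  have gr: "group_rel (G F) (G E) (transport G A F e)" "group_rel (G F') (G E') (transport G A F' e')"
    "group_rel (G F) (G F') (A (Move F (R3 u v w) F'))"
    using transport_group_rel[of F e] transport_group_rel[of F' e'] move_group_rel[OF m] p p' F F' by auto
  show "group_rel (G E) (G E') R"
    unfolding R by (rule group_rel_O[OF group_rel_converse[OF gr(1)] group_rel_O[OF gr(3,2)]])
  assume a: "a \<in> arcs D - sides D u v w" "a' = map_option (side_swap u v w) a"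
  have xF: "x a \<in> crossings F" using f0.labels_in[OF a(1)] by blast
  have "crossings F' = crossings F"
  proof -
    have F'_eq: "F' = Diagram (map (side_swap u v w) (word F)) (pos F)" and t: "triangle F u v w"
      using m by (simp_all add: is_move_def)
    have "{u, v, w} \<subseteq> crossings F" using t unfolding triangle_def by blast
    have 1: "fst (side_swap u v w p) \<in> crossings F" if "fst p \<in> crossings F" for p
      using that \<open>{u, v, w} \<subseteq> crossings F\<close> unfolding side_swap_def transpose_def by auto
    have 2: "fst p = fst (side_swap u v w p) \<or> fst p \<in> {u, v, w}" for p
      unfolding side_swap_def transpose_def by auto
    have gF': "gauss_diagram F'" using m unfolding is_move_def move.sel by blast
    have "crossings F' \<subseteq> crossings F"
      using 1 unfolding F'_eq by (force simp: crossings_def)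
    moreover have "c \<in> crossings F'" if c: "c \<in> crossings F" for c
    proof -
      have len: "distinct (word F')" "distinct (word F)" using gF' gauss_distinct f0.gauss(2) by auto
      have "card (set (word F')) = card (set (word F))"
        using distinct_card[OF len(1)] distinct_card[OF len(2)] by (simp add: F'_eq)
      moreover have "set (word F') \<subseteq> set (word F)"
      proof
        fix q assume "q \<in> set (word F')"
        then have "fst q \<in> crossings F" using \<open>crossings F' \<subseteq> crossings F\<close> unfolding crossings_def by auto
        then show "q \<in> set (word F)" using gauss_partner[OF f0.gauss(2), of "fst q" "snd q"] by simp
      qed
      ultimately have "set (word F') = set (word F)" by (intro card_subset_eq) auto
      then show ?thesis using c unfolding crossings_def by simp
    qed
    ultimately show ?thesis by blast
  qed
  then have xF': "x a \<in> crossings F'" using xF by simp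
  have "(P F (x a), P F' (x a)) \<in> A (Move F (R3 u v w) F')"
    using P0[OF m, of "x a"] F xF xF' by simp
  moreover have "(P F (x a), P E (x a)) \<in> transport G A F e"
    using transport_parity[of F e "crossings F" "x a"] p F xF by auto
  moreover have "(P F' (x a), P E' (x a)) \<in> transport G A F' e'"
    using transport_parity[of F' e' "crossings F'" "x a"] p' F' xF' by auto
  ultimately show "(P E (x a), P E' (x' a')) \<in> R" unfolding R using l[OF a(1)] a(2) by auto
qed

lemma extended_iso_parity:
  assumes f: "reidemeister f" "source f \<in> K" and ext: "extended (source f) E x y" "extended (target f) E' x' y'"
    and R: "extended_iso G A f E x y E' x' y' R"
  shows "group_rel (G E) (G E') R \<and> (\<forall>a a'. correspondent f a a' \<longrightarrow> (P E (x a), P E' (x' a')) \<in> R)"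
  using R
proof cases
  case (R1_inc D c b D' fs)
  have "is_move (Move D (R1_inc c b) D')" "D \<in> K" using f R1_inc unfolding reidemeister_def by auto
  from extended_sequence_parity[OF this(1) _ this(2) R1_inc(3)] ext R1_inc
  show ?thesis by auto
next
  case (R2_inc D c d D' fs)
  have "is_move (Move D (R2_inc c d) D')" "D \<in> K" using f R2_inc unfolding reidemeister_def by auto
  from extended_sequence_parity[OF this(1) _ this(2) R2_inc(3)] ext R2_inc
  show ?thesis by auto
next
  case (R1_dec D' c b D fs)
  have m: "is_move (Move D (R1_dec c b) D')" and D: "D \<in> K" using f R1_dec unfolding reidemeister_def by auto
  have D': "D' \<in> K" using K_move[OF m] D by simp
  have m': "is_move (Move D' (R1_inc c b) D)" using m unfolding is_move_def move.sel performs.simps by blast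
  from extended_sequence_parity[OF m' _ D' R1_dec(3)] ext R1_dec
  show ?thesis by (auto intro: group_rel_converse)
next
  case (R2_dec D' c d D fs)
  have m: "is_move (Move D (R2_dec c d) D')" and D: "D \<in> K" using f R2_dec unfolding reidemeister_def by auto
  have D': "D' \<in> K" using K_move[OF m] D by simp
  have m': "is_move (Move D' (R2_inc c d) D)" using m unfolding is_move_def move.sel performs.simps by blast
  from extended_sequence_parity[OF m' _ D' R2_dec(3)] ext R2_dec
  show ?thesis by (auto intro: group_rel_converse)
next
  case (R3 D u v w F e D' F' e')
  have D: "D \<in> K" using f R3 by simp
  show ?thesis
    using R3_sequence_parity[OF D R3(3,4,5) _ R3(2)] R3(6) R3(1) by auto
qed

end

section \<open>The cycle and the quasi-index of one diagram\<close>

lemma arcs_at: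
  assumes "gauss_diagram D" "v \<in> crossings D"
  shows "NE D v \<in> arcs D" "NW D v \<in> arcs D" "SW D v \<in> arcs D" "SE D v \<in> arcs D"
proof -
  have p: "(v, b) \<in> set (word D)" for b using assms by (simp add: gauss_partner)
  then have ne: "word D \<noteq> []" by force
  have "prev_point D (v, b) \<in> set (word D)" for b
    using consecutive_in[OF gauss_distinct[OF assms(1)] consecutive_prev[OF gauss_distinct[OF assms(1)] p length_ge2[OF assms(1) ne]]] by auto
  then show "NE D v \<in> arcs D" "NW D v \<in> arcs D" "SW D v \<in> arcs D" "SE D v \<in> arcs D"
    unfolding NE_def NW_def SW_def SE_def arcs_def using p ne by auto
qed

lemma incoming_eq:
  assumes "gauss_diagram D" "v \<in> crossings D"
  shows "incoming D v = {SW D v, SE D v}" "SW D v \<noteq> SE D v" "outgoing D v = {NE D v, NW D v}" "NE D v \<noteq> NW D v"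
proof -
  note d = gauss_distinct[OF assms(1)]
  have p: "(v, b) \<in> set (word D)" for b using assms by (simp add: gauss_partner)
  then have ne: "word D \<noteq> []" by force
  note l = length_ge2[OF assms(1) ne]
  have pr: "consecutive D [prev_point D (v, b), (v, b)]" for b using consecutive_prev[OF d p l] .
  have i0: "p' \<in> set (word D) \<and> fst (next_point D p') = v \<longleftrightarrow> p' = prev_point D (v, True) \<or> p' = prev_point D (v, False)" for p'
  proof
    assume a: "p' \<in> set (word D) \<and> fst (next_point D p') = v"
    then obtain b where "next_point D p' = (v, b)" by (metis prod.collapse)
    then have "consecutive D [p', (v, b)]" using consecutive_next[OF d _ l, of p'] a by simp
    then have "p' = prev_point D (v, b)" using prev_pointI[OF d] by metis
    then show "p' = prev_point D (v, True) \<or> p' = prev_point D (v, False)" by (cases b) auto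
  next
    assume "p' = prev_point D (v, True) \<or> p' = prev_point D (v, False)"
    then obtain b where c: "consecutive D [p', (v, b)]" using pr by blast
    then show "p' \<in> set (word D) \<and> fst (next_point D p') = v"
      using next_pointI[OF d c] consecutive_in[OF d c] by simp
  qed
  then have i: "incoming D v = {Some (prev_point D (v, True)), Some (prev_point D (v, False))}"
    unfolding incoming_def i0 by blast
  show "incoming D v = {SW D v, SE D v}" unfolding i SW_def SE_def by (cases "v \<in> pos D") auto
  have o0: "p' \<in> set (word D) \<and> fst p' = v \<longleftrightarrow> p' = (v, True) \<or> p' = (v, False)" for p'
    using p by (cases p'; cases "snd p'") auto
  have "outgoing D v = {Some (v, True), Some (v, False)}" unfolding outgoing_def o0 by blast
  then show "outgoing D v = {NE D v, NW D v}" unfolding NE_def NW_def by (cases "v \<in> pos D") auto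
  show "NE D v \<noteq> NW D v" unfolding NE_def NW_def by simp
  have "prev_point D (v, True) \<noteq> prev_point D (v, False)"
    using consecutive_unique_next[OF d pr[of True]] pr[of False] by force
  then show "SW D v \<noteq> SE D v" unfolding SW_def SE_def by (cases "v \<in> pos D") auto
qed

text \<open>
  A walk along the knot that starts at \<open>v\<close> in the direction NE stays in the right half until the next
  visit of \<open>v\<close>, which is along SE, and leaves the right half there.
\<close>

lemma right_half_step:
  assumes g: "gauss_diagram D" and v: "v \<in> crossings D" and pq: "consecutive D [p, q]"
  shows "right_half D v (Some q) = (if q = (v, v \<in> pos D) then 1 else if q = (v, v \<notin> pos D) then 0 else right_half D v (Some p))"
    "q = (v, v \<in> pos D) \<Longrightarrow> right_half D v (Some p) = 0"
    "q = (v, v \<notin> pos D) \<Longrightarrow> right_half D v (Some p) = 1"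
proof -
  note d = gauss_distinct[OF g]
  define n where "n = (v, v \<in> pos D)"
  define m where "m = (v, v \<notin> pos D)"
  have nm: "n \<in> set (word D)" "m \<in> set (word D)" "n \<noteq> m" using v gauss_partner[OF g] unfolding n_def m_def by auto
  obtain us where us: "cut_at n (word D) = n # us" using cut_at_in[OF nm(1)] by blast
  have c0: "cyc (word D) (n # us)" using cyc_cut_at us by metis
  then have "set (n # us) = set (word D)" by (rule cyc_set)
  then have "m \<in> set us" using nm by auto
  then obtain A B where AB: "us = A @ m # B" "m \<notin> set A" using split_list_first by fast
  have tw: "takeWhile (\<lambda>p. p \<noteq> m) (cut_at n (word D)) = n # A"
    unfolding us AB using AB(2) nm(3) by (induction A) auto
  have rh: "right_half D v (Some r) = (if r \<in> set (n # A) then 1 else 0)" for r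
    unfolding right_half_def n_def[symmetric] m_def[symmetric] tw by (auto simp: image_iff)
  have dd: "distinct (n # A @ m # B)" using cyc_distinct[OF c0] d AB by simp
  have c1: "consecutive D ((n # A) @ [m])" using c0 AB consecutive_iff[OF d, of "n # A @ [m]"] by auto
  have "cyc (word D) ((m # B @ [n]) @ A)"
    using c0 AB cyc_trans[OF c0, of "(m # B) @ (n # A)"] cyc_swap[of "n # A" "m # B"] by simp
  then have c2: "consecutive D ((m # B) @ [n])" using consecutive_iff[OF d, of "m # B @ [n]"] by auto
  have pred: "p = last (h # C1)" if "consecutive D (h # C1 @ q # C2)" for h C1 C2
    using consecutive_last[OF d that] consecutive_unique_prev[OF d pq] by blast
  have qn: "p \<in> set (m # B)" if "q = n"
  proof -
    have "p = last (m # B)" using pred[of m B "[]"] c2 that by simp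
    then show ?thesis using last_in_set[of "m # B"] by blast
  qed
  have qm: "p \<in> set (n # A)" if "q = m"
  proof -
    have "p = last (n # A)" using pred[of n A "[]"] c1 that by simp
    then show ?thesis using last_in_set[of "n # A"] by blast
  qed
  have inq: "q \<in> set (n # A @ m # B)" using consecutive_in[OF d pq] cyc_set[OF c0] AB by auto
  have qA: "p \<in> set (n # A)" if qs: "q \<in> set A"
  proof -
    obtain A1 A2 where A: "A = A1 @ q # A2" using split_list[OF qs] by blast
    then have "p = last (n # A1)" using pred[of n A1 "A2 @ [m]"] c1 by simp
    then show ?thesis using A by auto
  qed
  have qB: "p \<in> set (m # B)" if qs: "q \<in> set B"
  proof -
    obtain B1 B2 where B: "B = B1 @ q # B2" using split_list[OF qs] by blast
    then have "p = last (m # B1)" using pred[of m B1 "B2 @ [n]"] c2 by simp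
    then show ?thesis using B by auto
  qed
  show "q = (v, v \<in> pos D) \<Longrightarrow> right_half D v (Some p) = 0"
    unfolding rh n_def[symmetric] using qn dd by auto
  show "q = (v, v \<notin> pos D) \<Longrightarrow> right_half D v (Some p) = 1"
    unfolding rh m_def[symmetric] using qm by auto
  show "right_half D v (Some q) = (if q = (v, v \<in> pos D) then 1 else if q = (v, v \<notin> pos D) then 0 else right_half D v (Some p))"
  proof -
    consider "q = n" | "q = m" | "q \<in> set A" | "q \<in> set B" using inq by auto
    then show ?thesis unfolding rh n_def[symmetric] m_def[symmetric]
    proof cases
      case 3
      moreover from 3 have "q \<noteq> n" "q \<noteq> m" using dd by auto
      ultimately show "(if q \<in> set (n # A) then 1 else 0) = (if q = n then 1 else if q = m then 0 else if p \<in> set (n # A) then 1 else (0::int))"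
        using qA by simp
    next
      case 4
      moreover from 4 have "q \<noteq> n" "q \<noteq> m" "q \<notin> set A" using dd by auto
      moreover have "p \<notin> set (n # A)" using qB[OF 4] dd by auto
      ultimately show "(if q \<in> set (n # A) then 1 else 0) = (if q = n then 1 else if q = m then 0 else if p \<in> set (n # A) then 1 else (0::int))"
        by simp
    qed (use dd nm in auto)
  qed
qed

lemma int_pow_minus_one: "group B \<Longrightarrow> a \<in> carrier B \<Longrightarrow> a [^]\<^bsub>B\<^esub> (-1::int) = inv\<^bsub>B\<^esub> a"
  by (simp add: group.int_pow_neg group.int_pow_1)

locale extended_knot_diagram = knot_parity + folded_diagram D "arcs D" E x y for D E x y +
  assumes D: "D \<in> K"
begin

abbreviation "\<delta> \<equiv> delta P D E x"
abbreviation "\<pi> \<equiv> quasi_index G P D E x"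

text \<open>The quasi-index as a formal combination of fold crossings.\<close>

definition index_of :: "nat \<Rightarrow> nat \<Rightarrow> int" where
  "index_of v = gen (x (NE D v)) - gen (x (SW D v))"

lemma is_extended: "extended D E x y"
  using folded unfolding extended_def .

lemma E: "E \<in> K"
  using extended_K[OF is_extended D] .

lemma GE: "comm_group (G E)"
  using group E by blast

lemma delta_val: "a \<in> arcs D \<Longrightarrow> \<delta> a = val E (gen (x a))"
  using labels_in E by (simp add: delta_def val_gen)

lemma delta_closed: "a \<in> arcs D \<Longrightarrow> \<delta> a \<in> carrier (G E)"
  using delta_val E by simp

lemma index_val: "v \<in> crossings D \<Longrightarrow> \<pi> v = val E (index_of v)"
  unfolding quasi_index_def index_of_def using arcs_at[OF gauss(1)] by (simp add: delta_val val_diff[OF E])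

lemma cycle_rel:
  assumes "v \<in> crossings D"
  shows "rel E (gen (x (NE D v)) + gen (x (NW D v)) - gen (x (SW D v)) - gen (x (SE D v)))"
  using fold_cycle(1)[OF is_extended D assms refl refl] unfolding NE_def NW_def SW_def SE_def .

lemma delta_cycle: "\<delta> \<in> cycles (G E) D"
proof -
  interpret comm_group "G E" by (rule GE)
  have "\<delta> \<in> chains (G E) D" unfolding chains_def using delta_closed by (auto simp: delta_def)
  moreover have "boundary (G E) D \<delta> v = \<one>\<^bsub>G E\<^esub>" if v: "v \<in> crossings D" for v
  proof -
    note a = arcs_at[OF gauss(1) v] and i = incoming_eq[OF gauss(1) v]
    have "rel E (gen (x (SW D v)) + gen (x (SE D v)) - (gen (x (NE D v)) + gen (x (NW D v))))"
      using rel_minus[OF E cycle_rel[OF v]] by (simp add: algebra_simps)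
    then have "val E (gen (x (SW D v)) + gen (x (SE D v)) - (gen (x (NE D v)) + gen (x (NW D v)))) = \<one>\<^bsub>G E\<^esub>"
      unfolding rel_def by blast
    then show ?thesis unfolding boundary_def i(1,3) using a i(2,4) delta_closed
      by (simp add: delta_val val_diff[OF E] val_add[OF E] E)
  qed
  ultimately show ?thesis unfolding cycles_def by blast
qed

lemma delta_normalized: "intersection_number (G E) D knot_cycle \<delta> = \<one>\<^bsub>G E\<^esub>"
proof -
  interpret comm_group "G E" by (rule GE)
  have "intersection_number (G E) D knot_cycle \<delta> = finprod (G E) (\<lambda>v. val E (gen (x (NW D v)) - gen (x (SW D v)))) (crossings D)"
    unfolding intersection_number_def knot_cycle_def using arcs_at[OF gauss(1)]
    by (intro finprod_cong') (auto simp: delta_val val_diff[OF E] E)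
  also have "\<dots> = val E (\<Sum>v\<in>crossings D. gen (x (NW D v)) - gen (x (SW D v)))"
    using val_sum[OF E finite_crossings] by metis
  also have "\<dots> = \<one>\<^bsub>G E\<^esub>"
  proof (cases "crossings D = {}")
    case False
    then obtain v where "v \<in> crossings D" by blast
    from fold_normal[OF is_extended D this refl refl] show ?thesis unfolding rel_def NW_def SW_def by blast
  qed (use E in \<open>simp only: sum.empty val_zero\<close>)
  finally show ?thesis .
qed

lemma index_other:
  assumes v: "v \<in> crossings D"
  shows "\<pi> v = \<delta> (SE D v) \<otimes>\<^bsub>G E\<^esub> inv\<^bsub>G E\<^esub> (\<delta> (NW D v))"
proof -
  have "rel E (index_of v - (gen (x (SE D v)) - gen (x (NW D v))))"
    using cycle_rel[OF v] unfolding index_of_def by (simp add: algebra_simps)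
  from rel_eq[OF E this] show ?thesis using arcs_at[OF gauss(1) v]
    by (simp add: index_val[OF v] delta_val val_diff[OF E])
qed

text \<open>
  From SW to NE this is the definition of the quasi-index, from SE to NW it is the cycle condition.
\<close>

lemma passage:
  assumes pq: "consecutive D [p, (v, b)]"
  shows "rel E (gen (x (Some (v, b))) - gen (x (Some p)) - sg (b \<longleftrightarrow> v \<in> pos D) (index_of v))"
proof -
  have "(v, b) \<in> set (word D)" using consecutive_in[OF dist(1) pq] by auto
  then have v: "v \<in> crossings D" by (simp add: gauss_partner[OF gauss(1)])
  have p: "prev_point D (v, b) = p" using prev_pointI[OF dist(1) pq] .
  show ?thesis
  proof (cases "b \<longleftrightarrow> v \<in> pos D")
    case True
    then have "Some (v, b) = NE D v" "Some p = SW D v" using p unfolding NE_def SW_def by auto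
    then show ?thesis using True rel_zero[OF E] by (simp add: sg_def index_of_def)
  next
    case False
    then have "b \<longleftrightarrow> v \<notin> pos D" by blast
    then have e: "Some (v, b) = NW D v" "Some p = SE D v" using p unfolding NW_def SE_def by auto
    show ?thesis unfolding e using False cycle_rel[OF v] by (simp add: sg_def index_of_def algebra_simps)
  qed
qed

text \<open>
  The value on \<open>a\<close> of the sum of the right halves with the quasi-indices as coefficients.
\<close>

definition half_sum :: "arc \<Rightarrow> nat \<Rightarrow> int" where
  "half_sum a = (\<Sum>v\<in>crossings D. if right_half D v a = 1 then index_of v else 0)"

text \<open>
  Only the right half of the crossing that is passed changes between the two arcs, and it changes
  in the same way as \<open>\<delta>\<close>.
\<close>

lemma half_sum_step:
  assumes pq: "consecutive D [p, q]"
  shows "rel E ((gen (x (Some q)) - half_sum (Some q)) - (gen (x (Some p)) - half_sum (Some p)))"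
proof -
  obtain u b where q: "q = (u, b)" by (cases q)
  have u: "u \<in> crossings D" using consecutive_in[OF dist(1) pq] q by (simp add: gauss_partner[OF gauss(1)])
  let ?t = "\<lambda>a v. if right_half D v a = 1 then index_of v else 0"
  have "half_sum (Some q) = ?t (Some q) u + (\<Sum>v\<in>crossings D - {u}. ?t (Some q) v)"
    unfolding half_sum_def by (rule sum.remove) (use u in auto)
  moreover have "half_sum (Some p) = ?t (Some p) u + (\<Sum>v\<in>crossings D - {u}. ?t (Some p) v)"
    unfolding half_sum_def by (rule sum.remove) (use u in auto)
  moreover have "(\<Sum>v\<in>crossings D - {u}. ?t (Some q) v) = (\<Sum>v\<in>crossings D - {u}. ?t (Some p) v)"
  proof (rule sum.cong[OF refl])
    fix v assume "v \<in> crossings D - {u}"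
    then have v: "v \<in> crossings D" "v \<noteq> u" by auto
    have "right_half D v (Some q) = right_half D v (Some p)"
      using right_half_step(1)[OF gauss(1) v(1) pq] v(2) q by simp
    then show "?t (Some q) v = ?t (Some p) v" by simp
  qed
  moreover have "?t (Some q) u - ?t (Some p) u = sg (b \<longleftrightarrow> u \<in> pos D) (index_of u)"
  proof (cases "b \<longleftrightarrow> u \<in> pos D")
    case True
    then have "q = (u, u \<in> pos D)" using q by simp
    then show ?thesis using True right_half_step(1,2)[OF gauss(1) u pq] by (simp add: sg_def)
  next
    case False
    then have "b \<longleftrightarrow> u \<notin> pos D" by blast
    then have "q = (u, u \<notin> pos D)" using q by simp
    then show ?thesis using False right_half_step(1,3)[OF gauss(1) u pq] by (simp add: sg_def)
  qed
  ultimately have eq: "(gen (x (Some q)) - half_sum (Some q)) - (gen (x (Some p)) - half_sum (Some p))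
    = gen (x (Some q)) - gen (x (Some p)) - sg (b \<longleftrightarrow> u \<in> pos D) (index_of u)"
    by (simp only: algebra_simps)
  have "rel E (gen (x (Some q)) - gen (x (Some p)) - sg (b \<longleftrightarrow> u \<in> pos D) (index_of u))"
    using passage[of p u b] pq q by simp
  then show ?thesis by (simp only: eq)
qed

lemma half_sum_const:
  assumes a: "a \<in> arcs D" "a0 \<in> arcs D"
  shows "rel E ((gen (x a) - half_sum a) - (gen (x a0) - half_sum a0))"
proof (cases "word D = []")
  case True
  then have "a = a0" using a unfolding arcs_def by simp
  then show ?thesis using rel_zero[OF E] by simp
next
  case False
  then obtain p0 p where p: "a0 = Some p0" "a = Some p" "p0 \<in> set (word D)" "p \<in> set (word D)"
    using a unfolding arcs_def by auto
  have main: "rel E ((gen (x (Some (last (p0 # ps)))) - half_sum (Some (last (p0 # ps)))) - (gen (x (Some p0)) - half_sum (Some p0)))"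
    if "consecutive D (p0 # ps)" for ps
    using that
  proof (induction ps rule: rev_induct)
    case Nil
    show ?case using rel_zero[OF E] by (simp only: last.simps simp_thms if_True diff_self)
  next
    case (snoc q ps)
    have c: "consecutive D (p0 # ps)" using consecutive_mid[OF dist(1), of "[]" "p0 # ps" "[q]"] snoc.prems by simp
    have "consecutive D [last (p0 # ps), q]" using consecutive_last[OF dist(1), of p0 ps q "[]"] snoc.prems by simp
    moreover have "last (p0 # ps @ [q]) = q" by simp
    ultimately show ?case using rel_trans[OF E half_sum_step snoc.IH[OF c]] by (simp only:)
  qed
  show ?thesis
  proof (cases "p = p0")
    case True
    then show ?thesis using p rel_zero[OF E] by simp
  next
    case False
    obtain us where us: "cyc (word D) (p0 # us)" using cut_at_in[OF p(3)] cyc_cut_at by metis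
    then have "p \<in> set us" using cyc_set[OF us] p False by auto
    then obtain us1 us2 where "us = us1 @ p # us2" by (metis split_list)
    then have "cyc (word D) ((p0 # us1 @ [p]) @ us2)" using us by simp
    then have "consecutive D (p0 # us1 @ [p])" using consecutive_iff[OF dist(1)] by blast
    from main[OF this] show ?thesis using p by simp
  qed
qed

lemma delta_decomposition:
  "\<exists>!\<rho>. \<rho> \<in> carrier (G E) \<and> \<delta> =
     (\<lambda>a \<in> arcs D. (\<Otimes>\<^bsub>G E\<^esub>v\<in>crossings D. \<pi> v [^]\<^bsub>G E\<^esub> right_half D v a) \<otimes>\<^bsub>G E\<^esub> \<rho> [^]\<^bsub>G E\<^esub> knot_cycle a)"
proof -
  interpret comm_group "G E" by (rule GE)
  have s: "(\<Otimes>\<^bsub>G E\<^esub>v\<in>crossings D. \<pi> v [^]\<^bsub>G E\<^esub> right_half D v a) = val E (half_sum a)" for a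
  proof -
    have "(\<Otimes>\<^bsub>G E\<^esub>v\<in>crossings D. \<pi> v [^]\<^bsub>G E\<^esub> right_half D v a)
       = finprod (G E) (\<lambda>v. val E (if right_half D v a = 1 then index_of v else 0)) (crossings D)"
      by (intro finprod_cong') (auto simp: index_val E right_half_def)
    also have "\<dots> = val E (half_sum a)" unfolding half_sum_def using val_sum[OF E finite_crossings] by metis
    finally show ?thesis .
  qed
  obtain a0 where a0: "a0 \<in> arcs D" unfolding arcs_def by (cases "word D") auto
  \<comment> \<open>The constant is read off on any arc.\<close>
  let ?r = "val E (gen (x a0) - half_sum a0)"
  have r: "val E (half_sum a) \<otimes>\<^bsub>G E\<^esub> ?r = \<delta> a" if a: "a \<in> arcs D" for a
  proof -
    have "val E (gen (x a) - half_sum a) = ?r" using rel_eq[OF E half_sum_const[OF a a0]] .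
    then have "val E (half_sum a) \<otimes>\<^bsub>G E\<^esub> ?r = val E (half_sum a + (gen (x a) - half_sum a))"
      using val_add[OF E] by metis
    then show ?thesis using delta_val[OF a] by simp
  qed
  show ?thesis
  proof (rule ex1I[of _ ?r])
    show "?r \<in> carrier (G E) \<and> \<delta> = (\<lambda>a \<in> arcs D. (\<Otimes>\<^bsub>G E\<^esub>v\<in>crossings D. \<pi> v [^]\<^bsub>G E\<^esub> right_half D v a) \<otimes>\<^bsub>G E\<^esub> ?r [^]\<^bsub>G E\<^esub> knot_cycle a)"
    proof
      show "\<delta> = (\<lambda>a \<in> arcs D. (\<Otimes>\<^bsub>G E\<^esub>v\<in>crossings D. \<pi> v [^]\<^bsub>G E\<^esub> right_half D v a) \<otimes>\<^bsub>G E\<^esub> ?r [^]\<^bsub>G E\<^esub> knot_cycle a)"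
        using r E by (intro ext) (auto simp: s knot_cycle_def delta_def)
    qed (use E in simp)
    fix \<rho> assume h: "\<rho> \<in> carrier (G E) \<and> \<delta> = (\<lambda>a \<in> arcs D. (\<Otimes>\<^bsub>G E\<^esub>v\<in>crossings D. \<pi> v [^]\<^bsub>G E\<^esub> right_half D v a) \<otimes>\<^bsub>G E\<^esub> \<rho> [^]\<^bsub>G E\<^esub> knot_cycle a)"
    then have "\<delta> a0 = val E (half_sum a0) \<otimes>\<^bsub>G E\<^esub> \<rho>" using a0 by (metis (no_types, lifting) restrict_apply' s knot_cycle_def int_pow_1)
    then have "\<rho> \<otimes>\<^bsub>G E\<^esub> val E (half_sum a0) = ?r \<otimes>\<^bsub>G E\<^esub> val E (half_sum a0)"
      using r[OF a0] h E by (simp add: m_comm)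
    then show "\<rho> = ?r" using h E by (simp only: right_cancel val_closed)
  qed
qed

text \<open>
  The arcs before and after the upper strand of the bigon become one arc when the bigon is removed, so
  \<open>\<delta>\<close> has the same value on them.  On the way between them \<open>\<delta>\<close> changes by \<open>\<plusminus>\<pi>(u)\<close> and by \<open>\<plusminus>\<pi>(v)\<close> with opposite
  signs, because the crossings have opposite writhes.
\<close>

lemma index_bigon:
  assumes b: "bigon D u v"
  shows "\<pi> u = \<pi> v"
proof -
  have uv: "u \<in> crossings D" "v \<in> crossings D" using bigon_crossings[OF gauss(1) b] by auto
  have T: "consecutive D [(u, True), (v, True)]" and s: "u \<in> pos D \<longleftrightarrow> v \<notin> pos D" using b unfolding bigon_def by auto
  have inw: "(u, c) \<in> set (word D)" for c using uv gauss_partner[OF gauss(1)] by simp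
  then have ne: "word D \<noteq> []" by force
  define q where "q = prev_point D (u, True)"
  have q: "consecutive D [q, (u, True)]" unfolding q_def using consecutive_prev[OF dist(1) inw length_ge2[OF gauss(1) ne]] .
  have m: "rel E (gen (x (Some q)) - gen (x (Some (v, True))))"
  proof (cases "q = (v, True)")
    case True
    then show ?thesis using rel_zero[OF E] by simp
  next
    case False
    have c: "consecutive D (q # [(u, True)] @ [(v, True)])"
      using consecutive_join[OF dist(1), of "[q]" "(u, True)" "[(v, True)]"] q T False by simp
    have n: "Some (v, True) \<notin> inner_arcs D (R2_inc u v)"
      using consecutive_distinct[OF dist(1) T] by auto
    have nq: "q \<noteq> (u, True)" using consecutive_distinct[OF dist(1) q] by auto
    have "Some q \<notin> inner_arcs D (R2_inc u v)"
    proof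
      assume "Some q \<in> inner_arcs D (R2_inc u v)"
      then have "(q = (u, False) \<and> consecutive D [(u, False), (v, False)]) \<or> (q = (v, False) \<and> consecutive D [(v, False), (u, False)])"
        using nq b unfolding bigon_def by (auto split: if_splits)
      then show False using consecutive_unique_next[OF dist(1) q] by auto
    qed
    from folds_merge_bigon[OF is_extended D b c _ this n] show ?thesis by simp
  qed
  have p1: "rel E (gen (x (Some (u, True))) - gen (x (Some q)) - sg (u \<in> pos D) (index_of u))"
    using passage[OF q] by simp
  have p2: "rel E (gen (x (Some (v, True))) - gen (x (Some (u, True))) - sg (v \<in> pos D) (index_of v))"
    using passage[OF T] by simp
  note sum = rel_add[OF E m rel_add[OF E p1 p2]]
  have "rel E (index_of u - index_of v)"
  proof (cases "u \<in> pos D")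
    case True
    then show ?thesis using rel_minus[OF E sum] s by (simp add: sg_def algebra_simps)
  next
    case False
    then show ?thesis using sum s by (simp add: sg_def algebra_simps)
  qed
  from rel_eq[OF E this] show ?thesis using index_val uv by simp
qed

lemma strand:
  assumes pq: "consecutive D [(i, b), (j, c)]"
  shows "rel E (gen (x (Some (j, c))) - gen (x (Some (prev_point D (i, b))))
    - (sg (b \<longleftrightarrow> i \<in> pos D) (index_of i) + sg (c \<longleftrightarrow> j \<in> pos D) (index_of j)))"
proof -
  have "(i, b) \<in> set (word D)" using consecutive_in[OF dist(1) pq] by auto
  then have "consecutive D [prev_point D (i, b), (i, b)]"
    using consecutive_prev[OF dist(1)] length_ge2[OF gauss(1)] by (metis list.set_cases list.distinct(1))
  from rel_add[OF E passage[OF pq] passage[OF this]] show ?thesis by (simp add: algebra_simps)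
qed

lemma index_power:
  assumes "v \<in> crossings D"
  shows "\<pi> v [^]\<^bsub>G E\<^esub> incidence D' u t w v = val E (sg (incidence D' u t w v = 1) (index_of v))"
proof -
  interpret comm_group "G E" by (rule GE)
  have "incidence D' u t w v = 1 \<or> incidence D' u t w v = -1" unfolding incidence_def by auto
  then show ?thesis unfolding index_val[OF assms] sg_def
    using E by (elim disjE) (simp_all add: int_pow_minus_one[OF is_group] int_pow_1 val_minus)
qed

end

section \<open>The arcs at a crossing that survives a move\<close>

lemma inner_next:
  fixes c d :: nat and b :: bool
  assumes k: "kink D' c b \<and> k = R1_inc c b \<or> bigon D' c d \<and> k = R2_inc c d" and p: "Some p \<in> inner_arcs D' k"
  shows "fst p \<in> created k \<and> (\<exists>e. consecutive D' [p, e] \<and> fst e \<in> created k)"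
  using k
proof (elim disjE conjE)
  assume "kink D' c b" "k = R1_inc c b"
  then show ?thesis using p unfolding kink_def by auto
next
  assume b: "bigon D' c d" "k = R2_inc c d"
  then have "consecutive D' [(c, True), (d, True)]"
    "consecutive D' [(c, False), (d, False)] \<or> consecutive D' [(d, False), (c, False)]"
    unfolding bigon_def by blast+
  moreover have "p = (c, True) \<or> consecutive D' [(c, False), (d, False)] \<and> p = (c, False)
    \<or> \<not> consecutive D' [(c, False), (d, False)] \<and> p = (d, False)"
    using p b(2) by (simp split: if_splits)
  ultimately have "(p = (c, True) \<or> p = (c, False) \<or> p = (d, False)) \<and>
    (consecutive D' [p, (c, False)] \<or> consecutive D' [p, (d, False)] \<or> consecutive D' [p, (d, True)])" by blast
  then show ?thesis using b(2) by auto
qed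

text \<open>
  The arc NE starts at \<open>v\<close> in both diagrams.  The end of SW is \<open>v\<close>: going back from \<open>v\<close> in the new diagram,
  the first point that is not created by the move is the start of SW in the old diagram.  These arcs are
  outside the region of the move, as an inner arc starts and ends at created crossings.
\<close>

lemma corner_inc:
  assumes m: "is_move (Move D k D')" and k: "(\<exists>c b. k = R1_inc c b) \<or> (\<exists>c d. k = R2_inc c d)"
    and v: "v \<in> crossings D"
  shows "correspondent_inc D k D' (NE D v) (NE D' v) \<and> correspondent_inc D k D' (SW D v) (SW D' v)"
proof -
  have g: "gauss_diagram D" "gauss_diagram D'" using m unfolding is_move_def by simp_all
  note d = gauss_distinct[OF g(1)] and d' = gauss_distinct[OF g(2)]
  have D: "D = delete (created k) D'" using m k unfolding is_move_def by auto
  have v': "v \<in> crossings D'" "v \<notin> created k" using v unfolding D crossings_delete by auto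
  have pos: "v \<in> pos D \<longleftrightarrow> v \<in> pos D'" using v'(2) unfolding D pos_delete by blast
  have inner: "fst p \<in> created k \<and> (\<exists>e. consecutive D' [p, e] \<and> fst e \<in> created k)" if "Some p \<in> inner_arcs D' k" for p
    using k
  proof (elim disjE exE)
    fix c b assume "k = R1_inc c b"
    then show ?thesis using inner_next[of D' c b k c] m that unfolding is_move_def by auto
  next
    fix c e assume "k = R2_inc c e"
    then show ?thesis using inner_next[of D' c True k e] m that unfolding is_move_def by auto
  qed
  define p where "p = (v, v \<in> pos D)"
  have p: "p \<in> set (word D)" "p \<in> set (word D')" "fst p \<notin> created k"
    unfolding p_def using v v' g by (simp_all add: gauss_partner)
  have NE: "NE D v = Some p" "NE D' v = Some p" unfolding NE_def p_def pos by auto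
  have SW: "SW D v = Some (prev_point D p)" "SW D' v = Some (prev_point D' p)" unfolding SW_def p_def pos by auto
  have a: "Some p \<in> arcs D" "Some p \<in> arcs D'" "Some (prev_point D p) \<in> arcs D" "Some (prev_point D' p) \<in> arcs D'"
    using arcs_at[OF g(1) v] arcs_at[OF g(2) v'(1)] NE SW by simp_all
  have pr': "consecutive D' [prev_point D' p, p]"
    using consecutive_prev[OF d' p(2)] length_ge2[OF g(2)] p(2) by (metis list.set_cases list.distinct(1))
  have pr: "consecutive D [prev_point D p, p]"
    using consecutive_prev[OF d p(1)] length_ge2[OF g(1)] p(1) by (metis list.set_cases list.distinct(1))
  have "piece_of D' (created k) (Some p) (Some p)" using consecutive_single[OF p(2)] by (auto intro: exI[of _ "[]"])
  then have 1: "correspondent_inc D k D' (Some p) (Some p)"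
    unfolding correspondent_inc_def using a inner[of p] p(3) by blast
  obtain us where us: "consecutive D' (prev_point D p # us @ [p])" "fst ` set us \<subseteq> created k"
    using lift_pair[OF d', of "created k" "prev_point D p" p] pr unfolding D by auto
  have l: "prev_point D' p = last (prev_point D p # us)"
    by (rule prev_pointI[OF d' consecutive_last[OF d' us(1)]])
  have "consecutive D' (prev_point D p # us)" using consecutive_mid[OF d', of "[]" "prev_point D p # us" "[p]"] us(1) by simp
  then have "piece_of D' (created k) (Some (prev_point D p)) (Some (prev_point D' p))"
    using us(2) l by (auto intro!: exI[of _ us])
  moreover have "Some (prev_point D' p) \<notin> inner_arcs D' k"
  proof
    assume "Some (prev_point D' p) \<in> inner_arcs D' k"
    then obtain e where "consecutive D' [prev_point D' p, e]" "fst e \<in> created k" using inner by blast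
    then show False using consecutive_unique_next[OF d' pr'] p(3) by blast
  qed
  ultimately have "correspondent_inc D k D' (Some (prev_point D p)) (Some (prev_point D' p))"
    unfolding correspondent_inc_def using a by blast
  then show ?thesis using 1 NE SW by simp
qed

locale third_move =
  fixes D u v w D'
  assumes move: "is_move (Move D (R3 u v w) D')"
begin

abbreviation "s \<equiv> side_swap u v w"

lemma gauss: "gauss_diagram D" "gauss_diagram D'"
  using move unfolding is_move_def move.sel by blast+

lemma dist: "distinct (word D)" "distinct (word D')"
  using gauss gauss_distinct by blast+

lemma tri: "triangle D u v w"
  using move unfolding is_move_def by simp

lemma D'_eq: "D' = Diagram (map s (word D)) (pos D)"
  using move by (simp add: is_move_def)

lemma uvw: "u \<noteq> v" "u \<noteq> w" "v \<noteq> w" "{u, v, w} \<subseteq> crossings D"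
  using tri unfolding triangle_def by simp_all

lemma swap: "s (u, True) = (v, True)" "s (v, True) = (u, True)" "s (u, False) = (w, True)" "s (w, True) = (u, False)"
    "s (v, False) = (w, False)" "s (w, False) = (v, False)"
  using uvw unfolding side_swap_def transpose_def by auto

lemma swap_other: "fst p \<notin> {u, v, w} \<Longrightarrow> s p = p"
  unfolding side_swap_def transpose_def by auto

lemma corner_cases:
  assumes "fst p \<in> {u, v, w}"
  obtains "p = (u, True)" | "p = (v, True)" | "p = (u, False)" | "p = (w, True)" | "p = (v, False)" | "p = (w, False)"
  using assms by (cases p; cases "snd p") auto

lemma swap_corner: "fst p \<in> {u, v, w} \<Longrightarrow> fst (s p) \<in> {u, v, w} \<and> s (s p) = p \<and> s p \<noteq> p"
  by (erule corner_cases) (use swap uvw in auto)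

lemma swap_swap: "s (s p) = p"
  by (cases "fst p \<in> {u, v, w}") (auto simp: swap_corner swap_other)

lemma consecutive_swap: "consecutive D ps \<Longrightarrow> consecutive D' (map s ps)"
  unfolding D'_eq by (rule consecutive_map[OF dist(1)]) (metis inj_onI swap_swap)

lemma pos_eq: "pos D' = pos D"
  unfolding D'_eq by simp

lemma crossings_D': "{u, v, w} \<subseteq> crossings D'"
proof -
  have "s (c, b) \<in> set (word D)" if "c \<in> {u, v, w}" for c b
    using swap_corner[of "(c, b)"] that uvw(4) gauss_partner[OF gauss(1), of "fst (s (c, b))" "snd (s (c, b))"] by auto
  then have "s (s (c, b)) \<in> set (word D')" if "c \<in> {u, v, w}" for c b
    using that unfolding D'_eq by simp
  then show ?thesis using gauss_partner[OF gauss(2)] unfolding swap_swap by blast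
qed

text \<open>Otherwise the two points would be the whole word.\<close>

lemma exclusive:
  assumes X: "gauss_diagram X" "{u, v, w} \<subseteq> crossings X" and p: "fst p \<in> {u, v, w}"
  shows "\<not> (consecutive X [p, s p] \<and> consecutive X [s p, p])"
proof
  assume "consecutive X [p, s p] \<and> consecutive X [s p, p]"
  then have "set (word X) = {p, s p}" using two_cycle[OF gauss_distinct[OF X(1)]] swap_corner[OF p] by metis
  moreover have "{(u, True), (v, True), (w, True)} \<subseteq> set (word X)" using X by (simp add: gauss_partner)
  ultimately have "card {(u, True), (v, True), (w, True)} \<le> card {p, s p}" by (metis card_mono finite.emptyI finite_insert)
  moreover have "card {(u, True), (v, True), (w, True)} = 3" using uvw by simp
  moreover have "card {p, s p} \<le> 2" by (simp add: card_insert_if)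
  ultimately show False by simp
qed

lemma side_iff:
  assumes X: "gauss_diagram X" "{u, v, w} \<subseteq> crossings X" and p: "fst p \<in> {u, v, w}"
  shows "Some p \<in> sides X u v w \<longleftrightarrow> consecutive X [p, s p]"
proof -
  have "p \<in> set (word X)" using gauss_partner[OF X(1), of "fst p" "snd p"] X(2) p by auto
  then have "consecutive X [p, next_point X p]"
    using consecutive_next[OF gauss_distinct[OF X(1)]] length_ge2[OF X(1)] by (metis list.set_cases list.distinct(1))
  moreover have "Some p \<in> sides X u v w \<longleftrightarrow> next_point X p = s p" unfolding sides_def using p by blast
  ultimately show ?thesis using next_pointI[OF gauss_distinct[OF X(1)], of p "s p"] by metis
qed

lemma either:
  assumes "fst p \<in> {u, v, w}"
  shows "consecutive D [s p, p] \<longleftrightarrow> \<not> consecutive D [p, s p]"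
  using tri exclusive[OF gauss(1) uvw(4) assms] assms unfolding triangle_def by blast

text \<open>
  The move reverses each side of the triangle.  Therefore both sides at a corner change between leaving and
  arriving, and the incidence index is unchanged.
\<close>

lemma side_flip:
  assumes p: "fst p \<in> {u, v, w}"
  shows "Some p \<in> sides D' u v w \<longleftrightarrow> Some p \<notin> sides D u v w"
proof -
  have "consecutive D' [p, s p] \<longleftrightarrow> \<not> consecutive D [p, s p]"
    using consecutive_swap[of "[p, s p]"] consecutive_swap[of "[s p, p]"] exclusive[OF gauss(2) crossings_D' p] either[OF p]
    by (auto simp: swap_swap)
  then show ?thesis using side_iff[OF gauss(1) uvw(4) p] side_iff[OF gauss(2) crossings_D' p] by simp
qed

lemma incidence_eq: "c \<in> {u, v, w} \<Longrightarrow> incidence D' u v w c = incidence D u v w c"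
  unfolding incidence_def using side_flip[of "(c, True)"] side_flip[of "(c, False)"] by auto

lemma correspondent_iff:
  "correspondent (Move D (R3 u v w) D') (Some p) a' \<longleftrightarrow> p \<in> set (word D) \<and> Some p \<notin> sides D u v w \<and> a' = Some (s p)"
  by (auto simp: arcs_def)

lemma prev_swap:
  assumes "p \<in> set (word D)"
  shows "consecutive D [prev_point D p, p]" "prev_point D' (s p) = s (prev_point D p)"
proof -
  show c: "consecutive D [prev_point D p, p]"
    using assms consecutive_prev[OF dist(1)] length_ge2[OF gauss(1)] by (metis list.set_cases list.distinct(1))
  show "prev_point D' (s p) = s (prev_point D p)"
    using prev_pointI[OF dist(2)] consecutive_swap[OF c] by simp
qed

text \<open>
  If the arc were a side, it would end at a corner, and \<open>p\<close> would not be the start of a side.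
\<close>

lemma incoming_correspondent:
  assumes p: "p \<in> set (word D)" and n: "fst p \<notin> {u, v, w} \<or> consecutive D [p, s p]"
  shows "correspondent (Move D (R3 u v w) D') (Some (prev_point D p)) (Some (prev_point D' (s p)))"
proof -
  let ?q = "prev_point D p"
  note c = prev_swap(1)[OF p]
  have "Some ?q \<notin> sides D u v w"
  proof
    assume i: "Some ?q \<in> sides D u v w"
    then have q: "fst ?q \<in> {u, v, w}" "next_point D ?q = s ?q" unfolding sides_def by auto
    then have "s ?q = p" using next_pointI[OF dist(1) c] by simp
    then have "fst p \<in> {u, v, w}" "s p = ?q" using swap_corner[OF q(1)] by auto
    then show False using n c exclusive[OF gauss(1) uvw(4), of p] by auto
  qed
  moreover have "?q \<in> set (word D)" using consecutive_in[OF dist(1) c] by simp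
  ultimately show ?thesis using correspondent_iff prev_swap(2)[OF p] by blast
qed

lemma corner_outside:
  assumes c: "c \<in> crossings D" "c \<notin> {u, v, w}"
  shows "correspondent (Move D (R3 u v w) D') (NE D c) (NE D' c)"
    and "correspondent (Move D (R3 u v w) D') (SW D c) (SW D' c)"
proof -
  have p: "(c, b) \<in> set (word D)" "s (c, b) = (c, b)" for b using c gauss_partner[OF gauss(1)] swap_other by auto
  have "Some (c, b) \<notin> sides D u v w" for b using c(2) unfolding sides_def by simp
  then show "correspondent (Move D (R3 u v w) D') (NE D c) (NE D' c)"
    unfolding NE_def pos_eq correspondent_iff using p by simp
  show "correspondent (Move D (R3 u v w) D') (SW D c) (SW D' c)"
    unfolding SW_def pos_eq using incoming_correspondent[OF p(1), of "c \<in> pos D"] p(2) c(2) by simp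
qed

text \<open>
  On a passage from SW to NE the growth of \<open>\<delta>\<close> is \<open>\<pi>\<close>, on the other one it is \<open>-\<pi>\<close>.  The predicate says that
  this sign agrees with the incidence index.
\<close>

definition agrees :: "point \<Rightarrow> bool" where
  "agrees p \<longleftrightarrow> ((snd p \<longleftrightarrow> fst p \<in> pos D) \<longleftrightarrow> incidence D u v w (fst p) = 1)"

text \<open>
  This is where the sign condition on a triangle enters: at the two ends of a side, the sign of the
  growth of \<open>\<delta>\<close> relative to the incidence index is opposite.
\<close>

lemma agrees_swap:
  assumes p: "fst p \<in> {u, v, w}"
  shows "agrees (s p) \<longleftrightarrow> \<not> agrees p"
proof -
  obtain \<kappa> :: int where k: "\<kappa> = 1 \<or> \<kappa> = -1" "writhe D u = \<kappa> * incidence D u v w u"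
    "writhe D w = \<kappa> * incidence D u v w w" "writhe D v = - \<kappa> * incidence D u v w v"
    using tri unfolding triangle_def by blast
  have i: "incidence D u v w c = 1 \<or> incidence D u v w c = -1" for c unfolding incidence_def by auto
  have wr: "c \<in> pos D \<longleftrightarrow> writhe D c = 1" for c unfolding writhe_def by simp
  have "u \<in> pos D \<longleftrightarrow> (\<kappa> = 1 \<longleftrightarrow> incidence D u v w u = 1)"
    unfolding wr k(2) using k(1) i[of u] by (elim disjE) simp_all
  moreover have "w \<in> pos D \<longleftrightarrow> (\<kappa> = 1 \<longleftrightarrow> incidence D u v w w = 1)"
    unfolding wr k(3) using k(1) i[of w] by (elim disjE) simp_all
  moreover have "v \<in> pos D \<longleftrightarrow> \<not> (\<kappa> = 1 \<longleftrightarrow> incidence D u v w v = 1)"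
    unfolding wr k(4) using k(1) i[of v] by (elim disjE) simp_all
  ultimately have "agrees (u, True) \<longleftrightarrow> \<kappa> = 1" "agrees (u, False) \<longleftrightarrow> \<kappa> \<noteq> 1"
    "agrees (w, True) \<longleftrightarrow> \<kappa> = 1" "agrees (w, False) \<longleftrightarrow> \<kappa> \<noteq> 1"
    "agrees (v, True) \<longleftrightarrow> \<kappa> \<noteq> 1" "agrees (v, False) \<longleftrightarrow> \<kappa> = 1"
    unfolding agrees_def by (simp_all only: fst_conv snd_conv simp_thms, blast+)
  then show ?thesis using p by (elim corner_cases) (simp_all only: swap simp_thms)
qed

end

lemma corner_correspondent:
  assumes f: "reidemeister f" and v: "v \<in> crossings (source f) \<inter> crossings (target f) - involved (kind f)"
  shows "correspondent f (NE (source f) v) (NE (target f) v) \<and> correspondent f (SW (source f) v) (SW (target f) v)"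
proof -
  obtain D k D' where F: "f = Move D k D'" by (cases f)
  have m: "is_move (Move D k D')" using f F unfolding reidemeister_def by simp
  show ?thesis
  proof (cases k)
    case (Isotopy \<sigma>)
    then show ?thesis using f F unfolding reidemeister_def by simp
  next
    case (R1_inc c b)
    then show ?thesis using corner_inc[OF m _, of v] v F by simp
  next
    case (R2_inc c d)
    then show ?thesis using corner_inc[OF m _, of v] v F by simp
  next
    case (R1_dec c b)
    have "is_move (Move D' (R1_inc c b) D)" using m unfolding R1_dec is_move_def move.sel performs.simps by blast
    from corner_inc[OF this, of v] show ?thesis using v F R1_dec by simp
  next
    case (R2_dec c d)
    have "is_move (Move D' (R2_inc c d) D)" using m unfolding R2_dec is_move_def move.sel performs.simps by blast
    from corner_inc[OF this, of v] show ?thesis using v F R2_dec by simp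
  next
    case (R3 u v' w)
    then interpret third_move D u v' w D' using m by unfold_locales simp
    show ?thesis using corner_outside[of v] v F R3 by (simp del: correspondent.simps)
  qed
qed

lemma correspondent_arcs:
  assumes f: "reidemeister f" and c: "correspondent f a a'"
  shows "a \<in> arcs (source f) \<and> a' \<in> arcs (target f)"
proof -
  obtain D k D' where F: "f = Move D k D'" by (cases f)
  show ?thesis
  proof (cases k)
    case (R3 u v w)
    then interpret third_move D u v w D' using f F unfolding reidemeister_def by unfold_locales simp
    have a: "a \<in> arcs D" "a' = map_option s a" using c F R3 by auto
    have "map_option s a \<in> arcs D'"
    proof (cases a)
      case None
      then show ?thesis using a(1) unfolding arcs_def D'_eq by (auto split: if_splits)
    next
      case (Some p)
      then have "p \<in> set (word D)" using a(1) unfolding arcs_def by (auto split: if_splits)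
      then show ?thesis unfolding Some arcs_def D'_eq by auto
    qed
    then show ?thesis using a F by simp
  qed (use c F in \<open>auto simp: correspondent_inc_def\<close>)
qed

section \<open>Moves and the quasi-index\<close>

locale extended_move = knot_parity +
  e: extended_knot_diagram K G P A D E x y + e': extended_knot_diagram K G P A D' E' x' y' for D E x y D' E' x' y' +
  fixes k R
  assumes f: "reidemeister (Move D k D')" and R: "extended_iso G A (Move D k D') E x y E' x' y' R"
begin

lemma R_rel: "group_rel (G E) (G E') R"
  and R_parity: "correspondent (Move D k D') a a' \<Longrightarrow> (P E (x a), P E' (x' a')) \<in> R"
  using extended_iso_parity[OF f _ _ _ R] e.D e.is_extended e'.is_extended by auto

lemma delta_invariant:
  assumes c: "correspondent (Move D k D') a a'"
  shows "(e.\<delta> a, e'.\<delta> a') \<in> R"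
  using R_parity[OF c] correspondent_arcs[OF f c] by (simp add: delta_def)

lemma index_invariant:
  assumes v: "v \<in> crossings D \<inter> crossings D' - involved k"
  shows "(e.\<pi> v, e'.\<pi> v) \<in> R"
  unfolding quasi_index_def
  using corner_correspondent[OF f, of v] v
  by (intro group_rel_mult[OF R_rel] group_rel_inv[OF R_rel] delta_invariant) (simp_all del: correspondent.simps)

lemma diff_invariant:
  assumes "correspondent (Move D k D') a a'" "correspondent (Move D k D') b b'"
  shows "(val E (sg t (gen (x a) - gen (x b))), val E' (sg t (gen (x' a') - gen (x' b')))) \<in> R"
proof -
  have i: "a \<in> arcs D" "a' \<in> arcs D'" "b \<in> arcs D" "b' \<in> arcs D'" using correspondent_arcs[OF f] assms by auto
  have "(val E (gen (x a) - gen (x b)), val E' (gen (x' a') - gen (x' b'))) \<in> R"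
    unfolding val_diff[OF e.E] val_diff[OF e'.E]
    using delta_invariant[OF assms(1)] delta_invariant[OF assms(2)] i
    by (intro group_rel_mult[OF R_rel] group_rel_inv[OF R_rel]) (simp_all add: e.delta_val e'.delta_val)
  from this group_rel_inv[OF R_rel this] show ?thesis
    unfolding sg_def by (cases t) (simp_all only: if_True if_False val_minus[OF e.E] val_minus[OF e'.E])
qed

text \<open>
  Let \<open>i\<close> and \<open>j\<close> be the ends of a side.  By \<open>agrees_swap\<close> the difference of the quasi-indices with the
  incidence indices as coefficients is, up to a common sign, the growth of \<open>\<delta>\<close> along the strand that contains the
  side, from the arc before the side to the arc after it.  Both arcs lie outside the triangle and correspond
  to the arcs before and after the reversed side in the other diagram.
\<close>

lemma triangle_invariant:
  assumes k: "k = R3 u v w" and ij: "i \<in> {u, v, w}" "j \<in> {u, v, w}"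
  shows "(e.\<pi> i [^]\<^bsub>G E\<^esub> incidence D u v w i \<otimes>\<^bsub>G E\<^esub> inv\<^bsub>G E\<^esub> (e.\<pi> j [^]\<^bsub>G E\<^esub> incidence D u v w j),
    e'.\<pi> i [^]\<^bsub>G E'\<^esub> incidence D' u v w i \<otimes>\<^bsub>G E'\<^esub> inv\<^bsub>G E'\<^esub> (e'.\<pi> j [^]\<^bsub>G E'\<^esub> incidence D' u v w j)) \<in> R"
proof -
  interpret third_move D u v w D' using f k unfolding reidemeister_def by unfold_locales simp
  interpret g: comm_group "G E" by (rule e.GE)
  interpret g': comm_group "G E'" by (rule e'.GE)
  define X where "X c = sg (incidence D u v w c = 1) (e.index_of c)" for c
  define X' where "X' c = sg (incidence D u v w c = 1) (e'.index_of c)" for c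
  have pw: "e.\<pi> c [^]\<^bsub>G E\<^esub> incidence D u v w c = val E (X c)"
    "e'.\<pi> c [^]\<^bsub>G E'\<^esub> incidence D' u v w c = val E' (X' c)" if "c \<in> {u, v, w}" for c
    using that uvw(4) crossings_D' e.index_power[of c D u v w] e'.index_power[of c D u v w] incidence_eq[OF that]
    unfolding X_def X'_def by auto
  have side: "(val E (X (fst p) - X (fst (s p))), val E' (X' (fst p) - X' (fst (s p)))) \<in> R"
    if p: "fst p \<in> {u, v, w}" and c: "consecutive D [p, s p]" for p
  proof -
    let ?q = "s p" and ?t = "agrees p"
    have pw: "p \<in> set (word D)" "?q \<in> set (word D)" using consecutive_in[OF dist(1) c] by auto
    have c': "consecutive D' [?q, p]" using consecutive_swap[OF c] by (simp add: swap_swap)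
    have q: "fst ?q \<in> {u, v, w}" "s ?q = p" using swap_corner[OF p] by auto
    have nq: "Some ?q \<notin> sides D u v w" using side_iff[OF gauss(1) uvw(4) q(1)] q(2) either[OF p] c by simp
    have sums: "sg (snd p \<longleftrightarrow> fst p \<in> pos D) Y + sg (snd ?q \<longleftrightarrow> fst ?q \<in> pos D) Z
        = sg ?t (sg (incidence D u v w (fst p) = 1) Y - sg (incidence D u v w (fst ?q) = 1) Z)" for Y Z
    proof -
      have "sg b Y = sg (b \<longleftrightarrow> i) (sg i Y)" for b i Y by (cases b; cases i) (simp_all add: sg_def)
      then have "sg (snd p \<longleftrightarrow> fst p \<in> pos D) Y = sg ?t (sg (incidence D u v w (fst p) = 1) Y)"
        "sg (snd ?q \<longleftrightarrow> fst ?q \<in> pos D) Z = sg (\<not> ?t) (sg (incidence D u v w (fst ?q) = 1) Z)"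
        unfolding agrees_swap[OF p, symmetric] unfolding agrees_def by blast+
      moreover have "sg t Y' + sg (\<not> t) Z' = sg t (Y' - Z')" for t Y' Z'
        unfolding sg_def by (cases t) (simp_all only: if_True if_False not_True_eq_False not_False_eq_True
            diff_conv_add_uminus minus_add_distrib minus_minus)
      ultimately show ?thesis by (simp only:)
    qed
    have flip: "val V (X1 - X2) = val V (sg ?t Y)" if V: "V \<in> K" and r: "rel V (Y - sg ?t (X1 - X2))" for V X1 X2 Y
    proof (cases ?t)
      case True
      then show ?thesis using rel_eq[OF V r] by (simp only: sg_def if_True)
    next
      case False
      have "rel V (- Y - (X1 - X2))" using rel_minus[OF V r] False by (simp only: sg_def if_False) (simp add: algebra_simps)
      then show ?thesis using rel_eq[OF V] False by (simp only: sg_def if_False)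
    qed
    have "rel E (gen (x (Some ?q)) - gen (x (Some (prev_point D p))) - sg ?t (X (fst p) - X (fst ?q)))"
      using e.strand[of "fst p" "snd p" "fst ?q" "snd ?q"] c unfolding prod.collapse sums X_def by blast
    note l = flip[OF e.E this]
    have "rel E' (gen (x' (Some p)) - gen (x' (Some (prev_point D' ?q)))
      - (sg (snd p \<longleftrightarrow> fst p \<in> pos D) (e'.index_of (fst p)) + sg (snd ?q \<longleftrightarrow> fst ?q \<in> pos D) (e'.index_of (fst ?q))))"
      using e'.strand[of "fst ?q" "snd ?q" "fst p" "snd p"] c' unfolding prod.collapse pos_eq by (simp only: add.commute)
    then have "rel E' (gen (x' (Some p)) - gen (x' (Some (prev_point D' ?q))) - sg ?t (X' (fst p) - X' (fst ?q)))"
      unfolding sums X'_def .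
    note l' = flip[OF e'.E this]
    have "correspondent (Move D k D') (Some ?q) (Some p)"
      unfolding k using correspondent_iff[of ?q "Some p"] nq pw(2) q(2) by simp
    moreover have "correspondent (Move D k D') (Some (prev_point D p)) (Some (prev_point D' ?q))"
      unfolding k using incoming_correspondent[OF pw(1)] c by blast
    ultimately show ?thesis unfolding l l' by (rule diff_invariant)
  qed
  have "(val E (X i - X j), val E' (X' i - X' j)) \<in> R"
  proof (cases "i = j")
    case True
    then show ?thesis using group_rel_one[OF R_rel] e.E e'.E by (simp only: diff_self val_zero)
  next
    case False
    then have "fst (s (i, True)) = j \<or> fst (s (i, False)) = j" using ij swap by auto
    then have "\<exists>p. fst p = i \<and> fst (s p) = j" by (metis fst_conv)
    then obtain p where p: "fst p = i" "fst (s p) = j" by blast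
    then have pp: "fst p \<in> {u, v, w}" "fst (s p) \<in> {u, v, w}" using ij by auto
    show ?thesis
    proof (cases "consecutive D [p, s p]")
      case True
      then show ?thesis using side[OF pp(1)] p by simp
    next
      case False
      then have "consecutive D [s p, s (s p)]" using either[OF pp(1)] by (simp add: swap_swap)
      from group_rel_inv[OF R_rel side[OF pp(2) this]]
      have "(val E (- (X j - X i)), val E' (- (X' j - X' i))) \<in> R"
        by (simp only: val_minus[OF e.E] val_minus[OF e'.E] swap_swap p)
      then show ?thesis by (simp only: minus_diff_eq)
    qed
  qed
  then show ?thesis unfolding pw[OF ij(1)] pw[OF ij(2)] val_diff[OF e.E] val_diff[OF e'.E] .
qed

end

theorem theorem12:
  fixes K :: "diagram set"
    and G :: "diagram \<Rightarrow> 'g monoid"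
    and P :: "diagram \<Rightarrow> nat \<Rightarrow> 'g"
    and A :: "move \<Rightarrow> ('g \<times> 'g) set"
  assumes "virtual_knot K"
    and "oriented_parity_functor K G P A"
  shows
    "(\<comment> \<open>properties of a single diagram\<close>
      \<forall>D E x y. D \<in> K \<longrightarrow> extended D E x y \<longrightarrow>
        \<comment> \<open>(a)\<close>
        delta P D E x \<in> cycles (G E) D \<and>
        \<comment> \<open>(c)\<close>
        intersection_number (G E) D knot_cycle (delta P D E x) = \<one>\<^bsub>G E\<^esub> \<and>
        \<comment> \<open>the two expressions for \<open>\<pi>\<close> agree\<close>
        (\<forall>v \<in> crossings D. quasi_index G P D E x v =
            delta P D E x (SE D v) \<otimes>\<^bsub>G E\<^esub> inv\<^bsub>G E\<^esub> (delta P D E x (NW D v))) \<and>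
        \<comment> \<open>(Q2)\<close>
        (\<forall>v1 v2 D'. is_move (Move D (R2_dec v1 v2) D') \<longrightarrow>
            quasi_index G P D E x v1 = quasi_index G P D E x v2) \<and>
        \<comment> \<open>the relation between \<open>\<delta>\<close> and \<open>\<pi>\<close>\<close>
        (\<exists>!\<rho>. \<rho> \<in> carrier (G E) \<and>
            delta P D E x =
              (\<lambda>a \<in> arcs D. (\<Otimes>\<^bsub>G E\<^esub>v\<in>crossings D. quasi_index G P D E x v [^]\<^bsub>G E\<^esub> right_half D v a)
                 \<otimes>\<^bsub>G E\<^esub> \<rho> [^]\<^bsub>G E\<^esub> knot_cycle a)))
     \<and>
     (\<comment> \<open>properties of a Reidemeister move\<close>
      \<forall>f E x y E' x' y' R. reidemeister f \<longrightarrow> source f \<in> K \<longrightarrow>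
        extended (source f) E x y \<longrightarrow> extended (target f) E' x' y' \<longrightarrow>
        extended_iso G A f E x y E' x' y' R \<longrightarrow>
        \<comment> \<open>(b)\<close>
        (\<forall>a a'. correspondent f a a' \<longrightarrow>
            (delta P (source f) E x a, delta P (target f) E' x' a') \<in> R) \<and>
        \<comment> \<open>(Q0)\<close>
        (\<forall>v \<in> crossings (source f) \<inter> crossings (target f) - involved (kind f).
            (quasi_index G P (source f) E x v, quasi_index G P (target f) E' x' v) \<in> R) \<and>
        \<comment> \<open>(Q3)\<close>
        (\<forall>u v w. kind f = R3 u v w \<longrightarrow> (\<forall>i \<in> {u, v, w}. \<forall>j \<in> {u, v, w}.
            (quasi_index G P (source f) E x i [^]\<^bsub>G E\<^esub> incidence (source f) u v w i
               \<otimes>\<^bsub>G E\<^esub> inv\<^bsub>G E\<^esub> (quasi_index G P (source f) E x j [^]\<^bsub>G E\<^esub> incidence (source f) u v w j),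
             quasi_index G P (target f) E' x' i [^]\<^bsub>G E'\<^esub> incidence (target f) u v w i
               \<otimes>\<^bsub>G E'\<^esub> inv\<^bsub>G E'\<^esub> (quasi_index G P (target f) E' x' j [^]\<^bsub>G E'\<^esub> incidence (target f) u v w j))
            \<in> R)))"
proof -
  interpret knot_parity K G P A
    using assms by (intro knot_parity.intro knot_parity_axioms.intro)
  have diagram: "extended_knot_diagram K G P A D E x y" if "D \<in> K" "extended D E x y" for D E x y
    using that unfolding extended_def by unfold_locales
  show ?thesis
  proof ((rule conjI; intro allI impI), goal_cases)
    case (1 D E x y)
    then interpret d: extended_knot_diagram K G P A D E x y by (rule diagram)
    have "d.\<pi> v1 = d.\<pi> v2" if "is_move (Move D (R2_dec v1 v2) D')" for v1 v2 D'
      by (rule d.index_bigon) (use that in \<open>simp add: is_move_def\<close>)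
    then show ?case
      using d.delta_cycle d.delta_normalized d.index_other d.delta_decomposition by blast
  next
    case (2 f E x y E' x' y' R)
    obtain D k D' where f: "f = Move D k D'" by (cases f)
    have "D' \<in> K" using K_move[of f] 2(1,2) unfolding reidemeister_def f by simp
    then interpret m: extended_move K G P A D E x y D' E' x' y' k R
      using 2 diagram unfolding f by (intro extended_move.intro extended_move_axioms.intro) (simp_all, unfold_locales)
    show ?case
      unfolding f move.sel using m.delta_invariant m.index_invariant m.triangle_invariant by blast
  qed
qed

end
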